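(* Let $n\ge2$ and let $\Omega=\mathbb{R}^n$ or let $\Omega\subset\mathbb{R}^n$ be an open, bounded Lipschitz domain. Let $h:(0,\infty)\to(0,1]$ be non-increasing with $\lim_{\lambda\to\infty}h(\lambda)=0$. There is a constant $c=c(n,\Omega)>0$ such that for every $u\in BV(\mathbb{R}^n)$ with $u=0$ on $\mathbb{R}^n\setminus\Omega$ and every $\lambda>0$, with $\mathcal{O}_\lambda$, $T_\lambda u$ and the operator $S_\lambda$ as in the context, the following hold: (a) $S_\lambda$ is non-expansive for the $L^\infty$-norm: for all $\rho\in C_c(\Omega;\mathbb{R}^n)$, $$\|S_\lambda\rho\|_\infty\le\|\rho\|_\infty.$$ (b) (Commutator-type estimate) For all $\rho\in C_c(\Omega;\mathbb{R}^n)$, $$\big|\langle DT_\lambda u,\rho\rangle-\langle Du,S_\lambda\rho\rangle\big|\le c\,h(\lambda)\,|Du|(\mathcal{O}_\lambda)\,\|\rho\|_\infty.$$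
   Context: Here $\langle\mu,\rho\rangle=\int\rho\cdot d\mu$ for an $\mathbb{R}^n$-valued measure $\mu$ on $\mathbb{R}^n$, and $\rho\in C_c(\Omega;\mathbb{R}^n)$ is extended by zero to $\mathbb{R}^n$. Cubes are non-degenerate and axis-parallel; $aQ$ denotes the cube with the same center as $Q$ and $a$ times its side length. For a vector-valued Radon measure $\mu$ on $\mathbb{R}^n$ of finite total variation, $\mathcal{M}\mu(x):=\sup_{Q\ni x}|\mu|(Q)/\ell(Q)^n$, the supremum over all cubes $Q$ containing $x$, with side length $\ell(Q)$. For $u\in BV(\mathbb{R}^n)$ and $\lambda>0$ let $\mathcal{O}_\lambda:=\{\mathcal{M}(Du)>\lambda\}$ (an open set). Fix a Whitney cover of $\mathcal{O}_\lambda$, i.e. a countable family of open cubes $Q_j$ with side lengths $r_j>0$ such that: (W1) $\bigcup_j\frac12Q_j=\mathcal{O}_\lambda$; (W2) $8Q_j\subset\mathcal{O}_\lambda$ and $16Q_j\cap(\mathbb{R}^n\setminus\mathcal{O}_\lambda)\ne\emptyset$ for all $j$; (W3) if $Q_j\cap Q_k\ne\emptyset$, then $\frac12r_k\le r_j\le2r_k$; (W4) $\frac14Q_j\cap\frac14Q_k=\emptyset$ for $j\ne k$; (W5) at every point at most $120^n$ of the sets $4Q_j$ intersect; (W6) if $\frac34Q_j\cap\frac34Q_k\neq\emptyset$, then $|Q_j\cap Q_k|\ge16^{-n}\max\{|Q_j|,|Q_k|\}$; (W9) for each $k$, the set $A_k:=\{j:\frac34Q_k\cap\frac34Q_j\ne\emptyset\}$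 has at most $120^n$ elements. Fix a subordinate partition of unity $\{\eta_j\}\subset C_c^\infty(\mathbb{R}^n)$ with, for some constant $c_0=c_0(n)\geq 1$: $c_0^{-1}\mathbf{1}_{\frac12Q_j}\le\eta_j\le\mathbf{1}_{\frac34Q_j}$; $\|\eta_j\|_\infty+r_j\|\nabla\eta_j\|_\infty+r_j^2\|\nabla^2\eta_j\|_\infty\le c_0$; and $\sum_{j\in A_k}\eta_j=1$ on $\frac34Q_k$ for each $k$. Define $u_j:=\frac1{|Q_j|}\int_{Q_j}u\,dx$ if $\frac34Q_j\subset\Omega$, and $u_j:=0$ otherwise. Let $\varphi$ be a fixed (chosen once and for all, depending only on $n$) smooth, non-negative, radially symmetric mollifier ($\int\varphi=1$) supported in the unit ball, and set $\varphi_j(x):=\epsilon_j^{-n}\varphi(x/\epsilon_j)$ with $\epsilon_j:=\frac14h(\lambda)r_j$. Define $$\mathcal{B}_ju:=\eta_j(u-u_j)-\varphi_j*(\eta_j(u-u_j)),\qquad T_\lambda u:=u-\sum_j\mathcal{B}_ju,$$ where the sum converges unconditionally in $BV(\mathbb{R}^n)$, so that $T_\lambda u\in BV(\mathbb{R}^n)$. For $\rho\in C_c(\Omega;\mathbb{R}^n)$ define $$S_\lambda\rho:=\rho-\sum_j\eta_j(\rho-\varphi_j*\rho)=\rho\,\mathbf{1}_{\mathcal{O}_\lambda^{\complement}}+\sum_j\eta_j\,(\varphi_j*\rho).$$ *)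

theory Defs
  imports "HOL-Analysis.Analysis" "HOL-Probability.Essential_Supremum"
begin

definition partial_deriv :: "'n \<Rightarrow> (real^'n \<Rightarrow> 'b::real_normed_vector) \<Rightarrow> real^'n \<Rightarrow> 'b"
  where "partial_deriv i f x = frechet_derivative f (at x) (axis i 1)"

primrec C_k :: "nat \<Rightarrow> (real^'n \<Rightarrow> 'b::real_normed_vector) \<Rightarrow> bool" where
  "C_k 0 f \<longleftrightarrow> continuous_on UNIV f"
| "C_k (Suc k) f \<longleftrightarrow> (\<forall>x. f differentiable (at x)) \<and> (\<forall>i. C_k k (partial_deriv i f))"

definition C_infinity :: "(real^'n \<Rightarrow> 'b::real_normed_vector) \<Rightarrow> bool"
  where "C_infinity f \<longleftrightarrow> (\<forall>k. C_k k f)"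

definition supp :: "(real^'n \<Rightarrow> 'b::real_normed_vector) \<Rightarrow> (real^'n) set"
  where "supp f = closure {x. f x \<noteq> 0}"

definition Cc_infinity :: "(real^'n \<Rightarrow> 'b::real_normed_vector) \<Rightarrow> bool"
  where "Cc_infinity f \<longleftrightarrow> C_infinity f \<and> compact (supp f)"

text \<open>\<open>C\<^sub>c(\<Omega>; \<real>\<^sup>n)\<close>, each field being identified with its extension by zero.\<close>

definition Cc_field :: "(real^'n) set \<Rightarrow> (real^'n \<Rightarrow> real^'n) \<Rightarrow> bool"
  where "Cc_field \<Omega> \<rho> \<longleftrightarrow> continuous_on UNIV \<rho> \<and> compact (supp \<rho>) \<and> supp \<rho> \<subseteq> \<Omega>"

definition gradient :: "(real^'n \<Rightarrow> real) \<Rightarrow> real^'n \<Rightarrow> real^'n"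
  where "gradient f x = (\<chi> i. partial_deriv i f x)"

definition hessian :: "(real^'n \<Rightarrow> real) \<Rightarrow> real^'n \<Rightarrow> real^'n^'n"
  where "hessian f x = (\<chi> i j. partial_deriv i (partial_deriv j f) x)"

definition divergence :: "(real^'n \<Rightarrow> real^'n) \<Rightarrow> real^'n \<Rightarrow> real"
  where "divergence g x = (\<Sum>i\<in>UNIV. partial_deriv i (\<lambda>y. g y $ i) x)"

definition Linf_norm :: "(real^'n \<Rightarrow> 'b::real_normed_vector) \<Rightarrow> ennreal"
  where "Linf_norm f = esssup lebesgue (\<lambda>x. ennreal (norm (f x)))"

text \<open>
  Measures are set functions on the Borel sets; their values on other sets play no role.
  The total variation \<open>|\<mu>|(A)\<close> is the supremum of \<open>\<Sum>\<^sub>i |\<mu>(E\<^sub>i)|\<close> over all countable Borel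
  partitions \<open>(E\<^sub>i)\<close> of \<open>A\<close>.
\<close>

definition variation :: "((real^'n) set \<Rightarrow> real^'n) \<Rightarrow> (real^'n) set \<Rightarrow> ennreal"
  where "variation \<mu> A =
    (SUP E \<in> {E :: nat \<Rightarrow> (real^'n) set.
        range E \<subseteq> sets borel \<and> disjoint_family E \<and> (\<Union>i. E i) = A}.
      (\<Sum>i. ennreal (norm (\<mu> (E i)))))"

definition vector_measure :: "((real^'n) set \<Rightarrow> real^'n) \<Rightarrow> bool"
  where "vector_measure \<mu> \<longleftrightarrow>
    (\<forall>E :: nat \<Rightarrow> (real^'n) set. range E \<subseteq> sets borel \<longrightarrow> disjoint_family E \<longrightarrow>
        (\<lambda>i. \<mu> (E i)) sums \<mu> (\<Union>i. E i)) \<and>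
    variation \<mu> UNIV < \<infinity>"

text \<open>
  The positive part of the Jordan decomposition of a signed measure \<open>\<nu>\<close>; the negative part is
  that of \<open>-\<nu>\<close>. Note that \<open>ennreal\<close> truncates negative numbers to \<open>0 = \<nu>({})\<close>.
\<close>

definition jordan_pos :: "((real^'n) set \<Rightarrow> real) \<Rightarrow> (real^'n) measure"
  where "jordan_pos \<nu> = measure_of UNIV (sets borel)
    (\<lambda>A. SUP B \<in> {B \<in> sets borel. B \<subseteq> A}. ennreal (\<nu> B))"

definition signed_integral :: "((real^'n) set \<Rightarrow> real) \<Rightarrow> (real^'n \<Rightarrow> real) \<Rightarrow> real"
  where "signed_integral \<nu> f =
    (LINT x|jordan_pos \<nu>. f x) - (LINT x|jordan_pos (\<lambda>A. - \<nu> A). f x)"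

definition pairing :: "((real^'n) set \<Rightarrow> real^'n) \<Rightarrow> (real^'n \<Rightarrow> real^'n) \<Rightarrow> real"
  where "pairing \<mu> \<rho> = (\<Sum>i\<in>UNIV. signed_integral (\<lambda>A. \<mu> A $ i) (\<lambda>x. \<rho> x $ i))"

definition has_deriv_measure ::
    "(real^'n \<Rightarrow> real) \<Rightarrow> ((real^'n) set \<Rightarrow> real^'n) \<Rightarrow> bool"
  where "has_deriv_measure u \<mu> \<longleftrightarrow> vector_measure \<mu> \<and>
    (\<forall>g :: real^'n \<Rightarrow> real^'n. Cc_infinity g \<longrightarrow>
      (LINT x|lebesgue. u x * divergence g x) = - pairing \<mu> g)"

definition BV :: "(real^'n \<Rightarrow> real) \<Rightarrow> bool"
  where "BV u \<longleftrightarrow> integrable lebesgue u \<and> (\<exists>\<mu>. has_deriv_measure u \<mu>)"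

text \<open>\<open>Du\<close>; for \<open>u\<close> in \<open>BV\<close> it is uniquely determined on Borel sets.\<close>

definition deriv_measure :: "(real^'n \<Rightarrow> real) \<Rightarrow> (real^'n) set \<Rightarrow> real^'n"
  where "deriv_measure u = (SOME \<mu>. has_deriv_measure u \<mu>)"

definition BV_norm :: "(real^'n \<Rightarrow> real) \<Rightarrow> ennreal"
  where "BV_norm u =
    (\<integral>\<^sup>+x. ennreal \<bar>u x\<bar> \<partial>lebesgue) + variation (deriv_measure u) UNIV"

text \<open>
  Unconditional convergence in \<open>BV\<close>, i.e. along the net of finite subsets of the index set.
  The sum is determined up to equality almost everywhere.
\<close>

definition BV_has_sum ::
    "('j \<Rightarrow> real^'n \<Rightarrow> real) \<Rightarrow> 'j set \<Rightarrow> (real^'n \<Rightarrow> real) \<Rightarrow> bool"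
  where "BV_has_sum f J v \<longleftrightarrow> (\<forall>j\<in>J. BV (f j)) \<and> BV v \<and>
    ((\<lambda>F. BV_norm (\<lambda>x. (\<Sum>j\<in>F. f j x) - v x)) \<longlongrightarrow> 0) (finite_subsets_at_top J)"

definition BV_sum :: "('j \<Rightarrow> real^'n \<Rightarrow> real) \<Rightarrow> 'j set \<Rightarrow> real^'n \<Rightarrow> real"
  where "BV_sum f J = (SOME v. BV_has_sum f J v)"

text \<open>
  Near each boundary point the set is the strict epigraph, in some direction \<open>e\<close>, of a Lipschitz
  function on the hyperplane orthogonal to \<open>e\<close>; this is the usual condition
  \<open>y\<^sub>n > \<gamma>(y\<^sub>1, \<dots>, y\<^sub>n\<^sub>-\<^sub>1)\<close> in an orthonormal coordinate system with last axis \<open>e\<close>.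
\<close>

definition lipschitz_boundary :: "(real^'n) set \<Rightarrow> bool"
  where "lipschitz_boundary \<Omega> \<longleftrightarrow>
    (\<forall>x \<in> frontier \<Omega>. \<exists>s>0. \<exists>e L. \<exists>\<gamma> :: real^'n \<Rightarrow> real.
      norm e = 1 \<and> L-lipschitz_on {y. y \<bullet> e = 0} \<gamma> \<and>
      \<Omega> \<inter> ball x s = {y. y \<bullet> e > \<gamma> (y - (y \<bullet> e) *\<^sub>R e)} \<inter> ball x s)"

definition cube :: "real^'n \<Rightarrow> real \<Rightarrow> (real^'n) set"
  where "cube z r = {x. \<forall>i. \<bar>x $ i - z $ i\<bar> < r / 2}"

text \<open>Using closed instead of open cubes does not change the supremum.\<close>

definition maximal_fun :: "((real^'n) set \<Rightarrow> real^'n) \<Rightarrow> real^'n \<Rightarrow> ennreal"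
  where "maximal_fun \<mu> x =
    (SUP (z, r) \<in> {(z, r). r > 0 \<and> x \<in> cube z r}.
      variation \<mu> (cube z r) / ennreal (r ^ CARD('n)))"

definition bad_set :: "(real^'n \<Rightarrow> real) \<Rightarrow> real \<Rightarrow> (real^'n) set"
  where "bad_set u l = {x. maximal_fun (deriv_measure u) x > ennreal l}"

text \<open>
  A family of cubes \<open>Q\<^sub>j\<close> is given by an index set \<open>J\<close> (possibly finite or empty), centers
  \<open>z j\<close> and side lengths \<open>r j\<close>, so \<open>a Q\<^sub>j\<close> is \<open>cube (z j) (a * r j)\<close>.
\<close>

definition whitney_neighbours ::
    "nat set \<Rightarrow> (nat \<Rightarrow> real^'n) \<Rightarrow> (nat \<Rightarrow> real) \<Rightarrow> nat \<Rightarrow> nat set"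
  where "whitney_neighbours J z r k =
    {j \<in> J. cube (z k) (3/4 * r k) \<inter> cube (z j) (3/4 * r j) \<noteq> {}}"

definition whitney_cover ::
    "(real^'n) set \<Rightarrow> nat set \<Rightarrow> (nat \<Rightarrow> real^'n) \<Rightarrow> (nat \<Rightarrow> real) \<Rightarrow> bool"
  where "whitney_cover U J z r \<longleftrightarrow>
    (\<forall>j\<in>J. r j > 0) \<and>
    (\<Union>j\<in>J. cube (z j) (1/2 * r j)) = U \<and>
    (\<forall>j\<in>J. cube (z j) (8 * r j) \<subseteq> U \<and> cube (z j) (16 * r j) \<inter> (- U) \<noteq> {}) \<and>
    (\<forall>j\<in>J. \<forall>k\<in>J. cube (z j) (r j) \<inter> cube (z k) (r k) \<noteq> {} \<longrightarrow>
       1/2 * r k \<le> r j \<and> r j \<le> 2 * r k) \<and>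
    (\<forall>j\<in>J. \<forall>k\<in>J. j \<noteq> k \<longrightarrow> cube (z j) (1/4 * r j) \<inter> cube (z k) (1/4 * r k) = {}) \<and>
    (\<forall>x. finite {j \<in> J. x \<in> cube (z j) (4 * r j)} \<and>
       card {j \<in> J. x \<in> cube (z j) (4 * r j)} \<le> 120 ^ CARD('n)) \<and>
    (\<forall>j\<in>J. \<forall>k\<in>J. cube (z j) (3/4 * r j) \<inter> cube (z k) (3/4 * r k) \<noteq> {} \<longrightarrow>
       measure lebesgue (cube (z j) (r j) \<inter> cube (z k) (r k))
         \<ge> (1/16) ^ CARD('n) *
           max (measure lebesgue (cube (z j) (r j))) (measure lebesgue (cube (z k) (r k)))) \<and>
    (\<forall>k\<in>J. finite (whitney_neighbours J z r k) \<and>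
       card (whitney_neighbours J z r k) \<le> 120 ^ CARD('n))"

definition whitney_partition ::
    "real \<Rightarrow> nat set \<Rightarrow> (nat \<Rightarrow> real^'n) \<Rightarrow> (nat \<Rightarrow> real) \<Rightarrow> (nat \<Rightarrow> real^'n \<Rightarrow> real) \<Rightarrow> bool"
  where "whitney_partition c0 J z r \<eta> \<longleftrightarrow>
    (\<forall>j\<in>J. Cc_infinity (\<eta> j)) \<and>
    (\<forall>j\<in>J. \<forall>x. inverse c0 * indicator (cube (z j) (1/2 * r j)) x \<le> \<eta> j x \<and>
       \<eta> j x \<le> indicator (cube (z j) (3/4 * r j)) x) \<and>
    (\<forall>j\<in>J. Linf_norm (\<eta> j) + ennreal (r j) * Linf_norm (gradient (\<eta> j)) +
       ennreal ((r j)\<^sup>2) * Linf_norm (hessian (\<eta> j)) \<le> ennreal c0) \<and>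
    (\<forall>k\<in>J. \<forall>x \<in> cube (z k) (3/4 * r k). (\<Sum>j \<in> whitney_neighbours J z r k. \<eta> j x) = 1)"

definition mollifier :: "(real^'n \<Rightarrow> real) \<Rightarrow> bool"
  where "mollifier \<phi> \<longleftrightarrow> C_infinity \<phi> \<and> (\<forall>x. \<phi> x \<ge> 0) \<and>
    (\<forall>x y. norm x = norm y \<longrightarrow> \<phi> x = \<phi> y) \<and> supp \<phi> \<subseteq> cball 0 1 \<and>
    (LINT x|lebesgue. \<phi> x) = 1"

definition mollifier_scaled :: "(real^'n \<Rightarrow> real) \<Rightarrow> real \<Rightarrow> real^'n \<Rightarrow> real"
  where "mollifier_scaled \<phi> \<epsilon> x = inverse (\<epsilon> ^ CARD('n)) * \<phi> (inverse \<epsilon> *\<^sub>R x)"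

definition convolve ::
    "(real^'n \<Rightarrow> real) \<Rightarrow> (real^'n \<Rightarrow> 'b::euclidean_space) \<Rightarrow> real^'n \<Rightarrow> 'b"
  where "convolve \<psi> f x = (LINT y|lebesgue. \<psi> (x - y) *\<^sub>R f y)"

text \<open>Convolution with \<open>\<phi>\<^sub>j\<close>, where \<open>hl\<close> is the value \<open>h(\<lambda>)\<close> and \<open>rj\<close> the side length of \<open>Q\<^sub>j\<close>.\<close>

definition mollify ::
    "(real^'n \<Rightarrow> real) \<Rightarrow> real \<Rightarrow> real \<Rightarrow> (real^'n \<Rightarrow> 'b::euclidean_space) \<Rightarrow> real^'n \<Rightarrow> 'b"
  where "mollify \<phi> hl rj f = convolve (mollifier_scaled \<phi> (1/4 * hl * rj)) f"

definition local_mean :: "(real^'n) set \<Rightarrow> (real^'n \<Rightarrow> real) \<Rightarrow> real^'n \<Rightarrow> real \<Rightarrow> real"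
  where "local_mean \<Omega> u zj rj =
    (if cube zj (3/4 * rj) \<subseteq> \<Omega>
     then (LINT x:cube zj rj|lebesgue. u x) / measure lebesgue (cube zj rj) else 0)"

definition bad_part ::
    "(real^'n) set \<Rightarrow> (real^'n \<Rightarrow> real) \<Rightarrow> real \<Rightarrow> (nat \<Rightarrow> real^'n) \<Rightarrow> (nat \<Rightarrow> real) \<Rightarrow>
     (nat \<Rightarrow> real^'n \<Rightarrow> real) \<Rightarrow> (real^'n \<Rightarrow> real) \<Rightarrow> nat \<Rightarrow> real^'n \<Rightarrow> real"
  where "bad_part \<Omega> \<phi> hl z r \<eta> u j =
    (let w = (\<lambda>x. \<eta> j x * (u x - local_mean \<Omega> u (z j) (r j)))
     in (\<lambda>x. w x - mollify \<phi> hl (r j) w x))"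

definition T_op ::
    "(real^'n) set \<Rightarrow> (real^'n \<Rightarrow> real) \<Rightarrow> real \<Rightarrow> nat set \<Rightarrow> (nat \<Rightarrow> real^'n) \<Rightarrow> (nat \<Rightarrow> real) \<Rightarrow>
     (nat \<Rightarrow> real^'n \<Rightarrow> real) \<Rightarrow> (real^'n \<Rightarrow> real) \<Rightarrow> real^'n \<Rightarrow> real"
  where "T_op \<Omega> \<phi> hl J z r \<eta> u x = u x - BV_sum (bad_part \<Omega> \<phi> hl z r \<eta> u) J x"

text \<open>For a Whitney cover the sum has only finitely many non-zero terms at each point.\<close>

definition S_op ::
    "(real^'n \<Rightarrow> real) \<Rightarrow> real \<Rightarrow> nat set \<Rightarrow> (nat \<Rightarrow> real) \<Rightarrow> (nat \<Rightarrow> real^'n \<Rightarrow> real) \<Rightarrow>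
     (real^'n \<Rightarrow> real^'n) \<Rightarrow> real^'n \<Rightarrow> real^'n"
  where "S_op \<phi> hl J r \<eta> \<rho> x =
    \<rho> x - (\<Sum>\<^sub>\<infinity>j\<in>J. \<eta> j x *\<^sub>R (\<rho> x - mollify \<phi> hl (r j) \<rho> x))"

definition scale_fun :: "(real \<Rightarrow> real) \<Rightarrow> bool"
  where "scale_fun h \<longleftrightarrow> (\<forall>t>0. 0 < h t \<and> h t \<le> 1) \<and>
    (\<forall>s t. 0 < s \<longrightarrow> s \<le> t \<longrightarrow> h t \<le> h s) \<and> (h \<longlongrightarrow> 0) at_top"

end

theory Submission
  imports Defs
begin

text \<open>
  Write \<open>w\<^sub>j = \<eta>\<^sub>j (u - u\<^sub>j)\<close>. The product rule gives \<open>Dw\<^sub>j = \<eta>\<^sub>j Du + F\<^sub>j dx\<close> with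
  \<open>F\<^sub>j = (u - u\<^sub>j) \<nabla>\<eta>\<^sub>j\<close>, and since \<open>\<phi>\<^sub>j\<close> is even, testing \<open>Dw\<^sub>j - \<phi>\<^sub>j * Dw\<^sub>j\<close> with \<open>\<rho>\<close> means
  testing \<open>Dw\<^sub>j\<close> with \<open>\<rho> - \<phi>\<^sub>j * \<rho>\<close>. The part coming from \<open>\<eta>\<^sub>j Du\<close> is exactly what \<open>S\<^sub>\<lambda>\<close>
  subtracts, so the commutator is \<open>- \<Sum>\<^sub>j \<integral> F\<^sub>j \<bullet> (\<rho> - \<phi>\<^sub>j * \<rho>) dx = - \<Sum>\<^sub>j \<integral> (F\<^sub>j - \<phi>\<^sub>j * F\<^sub>j) \<bullet> \<rho> dx\<close>.
  Mollification at scale \<open>\<epsilon>\<^sub>j\<close> moves \<open>F\<^sub>j\<close> in \<open>L\<^sup>1\<close> by at most \<open>\<epsilon>\<^sub>j |DF\<^sub>j|\<close>, and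
  \<open>|DF\<^sub>j| \<le> C r\<^sub>j\<^sup>-\<^sup>1 |Du|(2Q\<^sub>j)\<close> by the Poincare inequality; the bounded overlap of the cubes
  then yields the factor \<open>h(\<lambda>) |Du|(\<O>\<^sub>\<lambda>)\<close>.

  The Poincare inequality is needed in two cases: for the mean over \<open>Q\<^sub>j\<close>, and for the constant
  \<open>0\<close> when \<open>3/4 Q\<^sub>j\<close> leaves \<open>\<Omega>\<close>. In the second case \<open>u\<close> vanishes on \<open>Q\<^sub>j - \<Omega>\<close>, which fills
  a fixed fraction of \<open>Q\<^sub>j\<close> because the complement of a bounded Lipschitz domain satisfies a
  corkscrew condition at every scale. Both are instances of one estimate on the mean over an
  arbitrary large subset of the cube.
\<close>

section \<open>Smooth functions\<close>

text \<open>The bound on F_j - phi_j * F_j is obtained without forming D F_j. Convolution with a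
  probability kernel is an average of translations, so it suffices to bound the integral of |F_j(x +
  q) - F_j(x)|, for |q| at most r_j / 4, by a constant times |q| / r_j times the mass of 2Q_j.
  Everything thus rests on one translation estimate for u itself; the Poincare inequality follows
  from it by integrating over pairs of points and substituting y = x + q. The translation estimate
  comes from a Taylor bound on the kernel, so neither smoothness of convolutions nor density of
  smooth functions in BV enters. A second obstacle is that \<open>deriv_measure\<close> and
  \<open>BV_sum\<close> are choices. Uniqueness of the derivative measure on Borel sets, and of a BV
  sum up to null sets, makes them computable: the function T u is a.e. equal to u minus a pointwise
  series, whose derivative is an absolutely convergent series of densities with respect to \<nu> and
  Lebesgue measure. Pairing with \<rho> turns the claim into a termwise comparison of two
  series.\<close>

lemma partial_deriv_eq:
  "(f has_derivative D) (at x) \<Longrightarrow> partial_deriv i f x = D (axis i 1)"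
  unfolding partial_deriv_def using frechet_derivative_at by metis

text \<open>\<open>C_k (Suc k)\<close> speaks only of differentiability and of the partial
  derivatives, so lowering the order needs an induction. It serves the undifferentiated factors in
  the product rule.\<close>

lemma C_k_SucD: "C_k (Suc k) f \<Longrightarrow> C_k k f"
  by (induction k arbitrary: f)
    (auto intro!: differentiable_imp_continuous_on simp: differentiable_on_def
      intro: differentiable_at_withinI)

lemma C_k_const: "C_k k (\<lambda>x :: real^'n. c)"
proof (induction k arbitrary: c)
  case (Suc k)
  have "partial_deriv i (\<lambda>x :: real^'n. c) = (\<lambda>x. 0)" for i
    by (rule ext, subst partial_deriv_eq) (auto intro!: derivative_intros)
  then show ?case using Suc by auto
qed auto

lemma partial_deriv_add:
  "f differentiable (at x) \<Longrightarrow> g differentiable (at x) \<Longrightarrow>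
   partial_deriv i (\<lambda>x. f x + g x) x = partial_deriv i f x + partial_deriv i g x"
  by (subst partial_deriv_eq[OF has_derivative_add])
    (auto simp: frechet_derivative_works partial_deriv_def)

lemma partial_deriv_scaleR:
  "f differentiable (at x) \<Longrightarrow> g differentiable (at x) \<Longrightarrow>
   partial_deriv i (\<lambda>x. f x *\<^sub>R g x) x = f x *\<^sub>R partial_deriv i g x + partial_deriv i f x *\<^sub>R g x"
  by (subst partial_deriv_eq[OF has_derivative_scaleR])
    (auto simp: frechet_derivative_works partial_deriv_def)

lemma partial_deriv_linear:
  assumes "bounded_linear L" "f differentiable (at x)"
  shows "partial_deriv i (\<lambda>x. L (f x)) x = L (partial_deriv i f x)"
  by (subst partial_deriv_eq[OF bounded_linear.has_derivative[OF assms(1)]])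
    (use assms in \<open>auto simp: frechet_derivative_works partial_deriv_def\<close>)

lemma has_derivative_compose_affine:
  assumes "f differentiable (at (a + c *\<^sub>R x))"
  shows "((\<lambda>x. f (a + c *\<^sub>R x)) has_derivative
    (\<lambda>h. frechet_derivative f (at (a + c *\<^sub>R x)) (c *\<^sub>R h))) (at x)"
  by (rule has_derivative_compose[of "\<lambda>x. a + c *\<^sub>R x" "\<lambda>h. c *\<^sub>R h"])
    (use assms in \<open>auto intro!: derivative_eq_intros simp: frechet_derivative_works\<close>)

lemma partial_deriv_affine:
  assumes "f differentiable (at (a + c *\<^sub>R x))"
  shows "partial_deriv i (\<lambda>x. f (a + c *\<^sub>R x)) x = c *\<^sub>R partial_deriv i f (a + c *\<^sub>R x)"
proof -
  have "linear (frechet_derivative f (at (a + c *\<^sub>R x)))"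
    using assms by (rule linear_frechet_derivative)
  then show ?thesis
    by (subst partial_deriv_eq[OF has_derivative_compose_affine[OF assms]])
      (simp add: partial_deriv_def linear_cmul)
qed

lemma C_k_add: "C_k k f \<Longrightarrow> C_k k g \<Longrightarrow> C_k k (\<lambda>x. f x + g x)"
proof (induction k arbitrary: f g)
  case (Suc k)
  then have "partial_deriv i (\<lambda>x. f x + g x) = (\<lambda>x. partial_deriv i f x + partial_deriv i g x)" for i
    by (auto simp: partial_deriv_add)
  then show ?case using Suc by (auto intro!: derivative_intros)
qed (auto intro: continuous_intros)

lemma C_k_scaleR: "C_k k f \<Longrightarrow> C_k k g \<Longrightarrow> C_k k (\<lambda>x. f x *\<^sub>R g x)"
proof (induction k arbitrary: f g)
  case (Suc k)
  then have "partial_deriv i (\<lambda>x. f x *\<^sub>R g x) =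
      (\<lambda>x. f x *\<^sub>R partial_deriv i g x + partial_deriv i f x *\<^sub>R g x)" for i
    by (auto simp: partial_deriv_scaleR)
  moreover have "C_k k (\<lambda>x. f x *\<^sub>R partial_deriv i g x + partial_deriv i f x *\<^sub>R g x)" for i
    using Suc C_k_SucD[OF Suc(2)] C_k_SucD[OF Suc(3)] by (intro C_k_add Suc(1)) auto
  ultimately show ?case using Suc by (auto intro!: derivative_intros)
qed (auto intro: continuous_intros)

lemma C_k_linear: "bounded_linear L \<Longrightarrow> C_k k f \<Longrightarrow> C_k k (\<lambda>x. L (f x))"
proof (induction k arbitrary: f)
  case 0
  then show ?case by (auto intro: bounded_linear.continuous_on)
next
  case (Suc k)
  then have "partial_deriv i (\<lambda>x. L (f x)) = (\<lambda>x. L (partial_deriv i f x))" for i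
    by (auto simp: partial_deriv_linear)
  moreover have "(\<lambda>x. L (f x)) differentiable (at x)" for x
  proof -
    obtain D where "(f has_derivative D) (at x)" using Suc(3) by (auto simp: differentiable_def)
    then show ?thesis by (rule differentiableI[OF bounded_linear.has_derivative[OF Suc(2)]])
  qed
  ultimately show ?case using Suc by simp
qed

lemma C_k_affine: "C_k k f \<Longrightarrow> C_k k (\<lambda>x. f (a + c *\<^sub>R x))"
proof (induction k arbitrary: f)
  case 0
  then show ?case
    by (auto intro!: continuous_on_compose2[where f="\<lambda>x. a + c *\<^sub>R x" and g=f] continuous_intros)
next
  case (Suc k)
  then have "partial_deriv i (\<lambda>x. f (a + c *\<^sub>R x)) = (\<lambda>x. c *\<^sub>R partial_deriv i f (a + c *\<^sub>R x))" for i
    by (auto simp: partial_deriv_affine)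
  moreover have "C_k k (\<lambda>x. c *\<^sub>R partial_deriv i f (a + c *\<^sub>R x))" for i
    using Suc by (intro C_k_scaleR C_k_const) auto
  moreover have "(\<lambda>x. f (a + c *\<^sub>R x)) differentiable (at x)" for x
    using Suc has_derivative_compose_affine[of f a c x] by (auto intro: differentiableI)
  ultimately show ?case by simp
qed

lemma C_infinityD:
  assumes "C_infinity f"
  shows C_infinity_differentiable: "f differentiable (at x)"
    and C_infinity_continuous: "continuous_on UNIV f"
    and C_infinity_partial: "C_infinity (partial_deriv i f)"
proof -
  have k: "C_k k f" for k using assms by (simp add: C_infinity_def)
  show "f differentiable (at x)" using k[of "Suc 0"] by simp
  show "continuous_on UNIV f" using k[of 0] by simp
  show "C_infinity (partial_deriv i f)" unfolding C_infinity_def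
  proof
    fix m show "C_k m (partial_deriv i f)" using k[of "Suc m"] by simp
  qed
qed

lemma closed_supp: "closed (supp f)"
  by (simp add: supp_def)

lemma supp_subset: "closed K \<Longrightarrow> (\<And>x. x \<notin> K \<Longrightarrow> f x = 0) \<Longrightarrow> supp f \<subseteq> K"
  unfolding supp_def by (rule closure_minimal) auto

lemma not_in_supp: "x \<notin> supp f \<Longrightarrow> f x = 0"
  using closure_subset[of "{x. f x \<noteq> 0}"] by (auto simp: supp_def)

lemma compact_closed_subset: "compact K \<Longrightarrow> closed A \<Longrightarrow> A \<subseteq> K \<Longrightarrow> compact A"
  by (metis compact_Int_closed inf.absorb2)

lemma compact_supp_subset:
  "compact (supp f) \<Longrightarrow> (\<And>x. x \<notin> supp f \<Longrightarrow> g x = 0) \<Longrightarrow> compact (supp g)"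
  using compact_closed_subset[of "supp f" "supp g"] supp_subset[of "supp f" g] closed_supp[of f] closed_supp[of g]
  by blast

lemma partial_deriv_not_in_supp:
  assumes "x \<notin> supp f" shows "partial_deriv i f x = 0"
proof -
  have "((\<lambda>x. 0) has_derivative (\<lambda>x. 0)) (at x)" by simp
  then have "(f has_derivative (\<lambda>x. 0)) (at x)"
    by (rule has_derivative_transform_within_open[of _ _ _ _ "- supp f"])
      (use assms not_in_supp in \<open>auto simp: closed_supp open_Compl\<close>)
  then show ?thesis by (simp add: partial_deriv_eq)
qed

lemma Cc_infinityD:
  assumes "Cc_infinity f"
  shows Cc_infinity_differentiable: "f differentiable (at x)"
    and Cc_infinity_continuous: "continuous_on UNIV f"
    and Cc_infinity_partial: "Cc_infinity (partial_deriv i f)"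
    and Cc_infinity_compact: "compact (supp f)"
proof -
  have f: "C_infinity f" "compact (supp f)" using assms by (auto simp: Cc_infinity_def)
  then show "f differentiable (at x)" "continuous_on UNIV f" "compact (supp f)"
    by (auto intro: C_infinityD)
  show "Cc_infinity (partial_deriv i f)"
    unfolding Cc_infinity_def
  proof
    show "C_infinity (partial_deriv i f)" by (rule C_infinity_partial[OF f(1)])
    show "compact (supp (partial_deriv i f))"
      by (rule compact_supp_subset[OF f(2)]) (rule partial_deriv_not_in_supp)
  qed
qed

lemma Cc_infinity_scaleR:
  "Cc_infinity f \<Longrightarrow> C_infinity g \<Longrightarrow> Cc_infinity (\<lambda>x. f x *\<^sub>R g x)"
  unfolding Cc_infinity_def C_infinity_def
proof (intro conjI allI)
  assume f: "(\<forall>k. C_k k f) \<and> compact (supp f)" and g: "\<forall>k. C_k k g"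
  show "C_k k (\<lambda>x. f x *\<^sub>R g x)" for k using f g by (simp add: C_k_scaleR)
  show "compact (supp (\<lambda>x. f x *\<^sub>R g x))"
    by (rule compact_supp_subset[of f]) (use f in \<open>simp_all add: not_in_supp\<close>)
qed

lemma Cc_infinity_linear:
  "bounded_linear L \<Longrightarrow> Cc_infinity f \<Longrightarrow> Cc_infinity (\<lambda>x. L (f x))"
  unfolding Cc_infinity_def C_infinity_def
proof (intro conjI allI)
  assume L: "bounded_linear L" and f: "(\<forall>k. C_k k f) \<and> compact (supp f)"
  show "C_k k (\<lambda>x. L (f x))" for k using f L by (simp add: C_k_linear)
  show "compact (supp (\<lambda>x. L (f x)))"
    by (rule compact_supp_subset[of f])
      (use f L in \<open>simp_all add: not_in_supp bounded_linear.linear linear_0\<close>)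
qed

lemma Cc_infinity_affine:
  assumes "Cc_infinity f" "c \<noteq> 0" shows "Cc_infinity (\<lambda>x. f (a + c *\<^sub>R x))"
proof -
  have "supp (\<lambda>x. f (a + c *\<^sub>R x)) \<subseteq> (\<lambda>y. inverse c *\<^sub>R (y - a)) ` supp f" (is "_ \<subseteq> ?K")
  proof (rule supp_subset)
    have K: "compact ?K"
      using assms by (intro compact_continuous_image continuous_intros) (auto simp: Cc_infinity_def)
    show "closed ?K" using K compact_imp_closed by blast
    show "f (a + c *\<^sub>R x) = 0" if "x \<notin> ?K" for x
    proof (rule not_in_supp)
      have "x = inverse c *\<^sub>R ((a + c *\<^sub>R x) - a)" using assms by simp
      then show "a + c *\<^sub>R x \<notin> supp f" using that by blast
    qed
  qed
  moreover have "compact ?K"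
    using assms by (intro compact_continuous_image continuous_intros) (auto simp: Cc_infinity_def)
  ultimately have "compact (supp (\<lambda>x. f (a + c *\<^sub>R x)))"
    by (meson closed_supp compact_closed_subset)
  then show ?thesis using assms by (auto simp: Cc_infinity_def C_infinity_def intro!: C_k_affine)
qed

lemma Cc_infinity_translate: "Cc_infinity f \<Longrightarrow> Cc_infinity (\<lambda>x. f (x + y))"
  using Cc_infinity_affine[of f 1 y] by (simp add: add.commute)

lemma C_infinity_const: "C_infinity (\<lambda>x. c)"
  by (simp add: C_infinity_def C_k_const)

lemma compact_supp_bounded:
  assumes "continuous_on UNIV f" "compact (supp f)"
  obtains B where "B > 0" "\<And>x. norm (f x) \<le> B"
proof -
  have "bounded (f ` supp f)"
    by (rule compact_imp_bounded, rule compact_continuous_image) (use assms continuous_on_subset in auto)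
  then obtain B where B: "B > 0" "\<And>x. x \<in> supp f \<Longrightarrow> norm (f x) \<le> B"
    unfolding bounded_pos by auto
  have "norm (f x) \<le> B" for x
    using B not_in_supp[of x f] by (cases "x \<in> supp f") auto
  then show ?thesis using that B by blast
qed

lemma compact_supp_integrable:
  fixes f :: "real^'n \<Rightarrow> 'b::euclidean_space"
  assumes "continuous_on UNIV f" "compact (supp f)"
  shows "integrable lborel f"
proof -
  have "integrable lborel (\<lambda>x. indicator (supp f) x *\<^sub>R f x)"
    using assms by (intro borel_integrable_compact) (auto intro: continuous_on_subset)
  also have "(\<lambda>x. indicator (supp f) x *\<^sub>R f x) = f"
    by (auto simp: fun_eq_iff indicator_def not_in_supp)
  finally show ?thesis .
qed

lemma gradient_has_derivative:
  fixes f :: "real^'n \<Rightarrow> real"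
  assumes "f differentiable (at x)"
  shows "(f has_derivative (\<lambda>h. gradient f x \<bullet> h)) (at x)"
proof -
  let ?D = "frechet_derivative f (at x)"
  have D: "(f has_derivative ?D) (at x)" using assms frechet_derivative_works by blast
  interpret D: linear ?D using assms by (rule linear_frechet_derivative)
  have "?D h = gradient f x \<bullet> h" for h
  proof -
    have "?D h = ?D (\<Sum>i\<in>UNIV. (h $ i) *\<^sub>R axis i 1)"
      by (metis (no_types, lifting) basis_expansion scalar_mult_eq_scaleR sum.cong)
    also have "\<dots> = (\<Sum>i\<in>UNIV. h $ i * ?D (axis i 1))"
      by (simp add: D.sum D.scaleR)
    also have "\<dots> = gradient f x \<bullet> h"
      by (simp add: gradient_def inner_vec_def partial_deriv_def mult.commute)
    finally show ?thesis .
  qed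
  then show ?thesis using D by (metis (no_types, lifting) ext)
qed

lemma gradient_mvt:
  fixes f :: "real^'n \<Rightarrow> real"
  assumes "\<And>x. f differentiable (at x)"
  obtains t where "0 < t" "t < 1" "f (x + q) - f x = gradient f (x + t *\<^sub>R q) \<bullet> q"
proof -
  have "((\<lambda>t. f (x + t *\<^sub>R q)) has_derivative (\<lambda>s. gradient f (x + t *\<^sub>R q) \<bullet> (s *\<^sub>R q))) (at t)" for t
    by (rule has_derivative_compose[of "\<lambda>t. x + t *\<^sub>R q" "\<lambda>s. s *\<^sub>R q"])
      (auto intro!: derivative_eq_intros gradient_has_derivative assms)
  then have "\<exists>t\<in>{0<..<1}. f (x + 1 *\<^sub>R q) - f (x + 0 *\<^sub>R q) = gradient f (x + t *\<^sub>R q) \<bullet> ((1 - 0) *\<^sub>R q)"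
    by (intro mvt_simple) (auto intro: has_derivative_at_withinI)
  then show ?thesis using that by auto
qed

lemma gradient_bound_imp_lipschitz:
  fixes f :: "real^'n \<Rightarrow> real"
  assumes "\<And>x. f differentiable (at x)" "\<And>x. norm (gradient f x) \<le> B"
  shows "\<bar>f (x + q) - f x\<bar> \<le> B * norm q"
proof -
  obtain t where "f (x + q) - f x = gradient f (x + t *\<^sub>R q) \<bullet> q"
    using gradient_mvt[OF assms(1)] by metis
  then show ?thesis
    by (metis Cauchy_Schwarz_ineq2 assms(2) mult_right_mono norm_ge_zero order_trans)
qed

lemma continuous_on_gradient:
  fixes f :: "real^'n \<Rightarrow> real"
  assumes "C_infinity f" shows "continuous_on UNIV (gradient f)"
  unfolding gradient_def
  by (intro continuous_on_vec_lambda C_infinity_continuous C_infinity_partial assms)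

lemma gradient_not_in_supp: "x \<notin> supp f \<Longrightarrow> gradient f x = 0"
  by (simp add: gradient_def partial_deriv_not_in_supp vec_eq_iff)

lemma compact_supp_gradient: "compact (supp f) \<Longrightarrow> compact (supp (gradient f))"
  by (erule compact_supp_subset) (rule gradient_not_in_supp)

lemma Cc_infinity_lipschitz:
  fixes f :: "real^'n \<Rightarrow> real"
  assumes "Cc_infinity f"
  obtains B where "B \<ge> 0" "\<And>x q. \<bar>f (x + q) - f x\<bar> \<le> B * norm q"
proof -
  obtain B where "B > 0" "\<And>x. norm (gradient f x) \<le> B"
    using compact_supp_bounded[of "gradient f"] assms continuous_on_gradient compact_supp_gradient
    unfolding Cc_infinity_def by metis
  then show ?thesis
    using that[of B] gradient_bound_imp_lipschitz[of f B] Cc_infinity_differentiable[OF assms] by auto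
qed

text \<open>The mean value theorem evaluates the gradient at an intermediate point, and the gradient
  is Lipschitz because its components are again in \<open>Cc_infinity\<close>. The constant does not
  depend on \<open>x\<close>, so the bound can be integrated in \<open>x\<close>.\<close>

lemma Cc_infinity_taylor:
  fixes f :: "real^'n \<Rightarrow> real"
  assumes f: "Cc_infinity f"
  obtains C where "C \<ge> 0" "\<And>x q. \<bar>f (x + q) - f x - gradient f x \<bullet> q\<bar> \<le> C * (norm q)\<^sup>2"
proof -
  have "\<exists>B\<ge>0. \<forall>x q. \<bar>partial_deriv i f (x + q) - partial_deriv i f x\<bar> \<le> B * norm q" for i
    using Cc_infinity_lipschitz[OF Cc_infinity_partial[OF f]] by metis
  then obtain B where B: "\<And>i. B i \<ge> 0"
    "\<And>i x q. \<bar>partial_deriv i f (x + q) - partial_deriv i f x\<bar> \<le> B i * norm q"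
    by metis
  have "\<bar>f (x + q) - f x - gradient f x \<bullet> q\<bar> \<le> (\<Sum>i\<in>UNIV. B i) * (norm q)\<^sup>2" for x q
  proof -
    obtain t where t: "0 < t" "t < 1" "f (x + q) - f x = gradient f (x + t *\<^sub>R q) \<bullet> q"
      using gradient_mvt[OF Cc_infinity_differentiable[OF f]] by metis
    have "norm (gradient f (x + t *\<^sub>R q) - gradient f x) \<le>
        (\<Sum>i\<in>UNIV. \<bar>(gradient f (x + t *\<^sub>R q) - gradient f x) $ i\<bar>)"
      by (rule norm_le_l1_cart)
    also have "\<dots> \<le> (\<Sum>i\<in>UNIV. B i * norm q)"
    proof (rule sum_mono)
      fix i :: 'n
      have "\<bar>(gradient f (x + t *\<^sub>R q) - gradient f x) $ i\<bar> \<le> B i * norm (t *\<^sub>R q)"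
        using B(2)[of i x "t *\<^sub>R q"] by (simp add: gradient_def)
      also have "\<dots> \<le> B i * norm q"
        using t B(1)[of i] by (intro mult_left_mono) (auto simp: mult_left_le_one_le)
      finally show "\<bar>(gradient f (x + t *\<^sub>R q) - gradient f x) $ i\<bar> \<le> B i * norm q" .
    qed
    finally have *: "norm (gradient f (x + t *\<^sub>R q) - gradient f x) \<le> (\<Sum>i\<in>UNIV. B i) * norm q"
      by (simp add: sum_distrib_right)
    have "\<bar>f (x + q) - f x - gradient f x \<bullet> q\<bar> = \<bar>(gradient f (x + t *\<^sub>R q) - gradient f x) \<bullet> q\<bar>"
      by (simp add: t inner_diff_left)
    also have "\<dots> \<le> (\<Sum>i\<in>UNIV. B i) * norm q * norm q"
      by (meson * Cauchy_Schwarz_ineq2 mult_right_mono norm_ge_zero order_trans)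
    finally show ?thesis by (simp add: power2_eq_square mult.assoc)
  qed
  then show ?thesis using that[of "\<Sum>i\<in>UNIV. B i"] B(1) by (auto intro: sum_nonneg)
qed

section \<open>Translation invariance of Lebesgue integrals\<close>

lemma lborel_translate: "distr lborel borel (\<lambda>x. x + q) = (lborel :: 'a::euclidean_space measure)"
  using lborel_distr_plus[of q] by (simp add: add.commute[of _ q])

lemma integral_translate:
  fixes f :: "'a::euclidean_space \<Rightarrow> 'b::{banach, second_countable_topology}"
  assumes [measurable]: "f \<in> borel_measurable borel"
  shows "(LINT x|lborel. f (x + q)) = (LINT x|lborel. f x)"
  by (subst (2) lborel_translate[of q, symmetric], subst integral_distr) auto

lemma integrable_translate:
  fixes f :: "'a::euclidean_space \<Rightarrow> 'b::{banach, second_countable_topology}"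
  assumes "integrable lborel f"
  shows "integrable lborel (\<lambda>x. f (x + q))"
proof -
  have [measurable]: "f \<in> borel_measurable borel" using assms by auto
  have "integrable (distr lborel borel (\<lambda>x. x + q)) f" using assms by (simp add: lborel_translate)
  then show ?thesis by (subst (asm) integrable_distr_eq) auto
qed

lemma nn_integral_translate:
  fixes f :: "'a::euclidean_space \<Rightarrow> ennreal"
  assumes [measurable]: "f \<in> borel_measurable borel"
  shows "(\<integral>\<^sup>+x. f (x + q) \<partial>lborel) = (\<integral>\<^sup>+x. f x \<partial>lborel)"
  by (subst (2) lborel_translate[of q, symmetric], subst nn_integral_distr) auto

text \<open>The increment f(x + t e_i) - f(x) has integral zero by translation invariance and
  differs from t times the derivative by O(t^2) on a fixed ball. Dividing by t and letting t tend to
  0 gives the claim without iterated integrals.\<close>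

lemma integral_partial_deriv_eq_0:
  fixes f :: "real^'n \<Rightarrow> real"
  assumes f: "Cc_infinity f"
  shows "(LINT x|lborel. partial_deriv i f x) = 0"
proof -
  obtain C where C: "C \<ge> 0" "\<And>x q. \<bar>f (x + q) - f x - gradient f x \<bullet> q\<bar> \<le> C * (norm q)\<^sup>2"
    using Cc_infinity_taylor[OF f] by metis
  let ?e = "axis i 1 :: real^'n"
  let ?D = "partial_deriv i f"
  obtain R where R: "R > 0" "\<And>x. x \<in> supp f \<Longrightarrow> norm x \<le> R"
    using compact_imp_bounded[OF Cc_infinity_compact[OF f]] bounded_pos by metis
  have fi: "integrable lborel f" using f
    by (intro compact_supp_integrable Cc_infinityD)
  have Di: "integrable lborel ?D" using f
    by (intro compact_supp_integrable Cc_infinityD)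
  \<comment> \<open>Since t is at most 1, both f and its translate vanish outside the ball of radius
    R + 1.\<close>
  define m where "m = measure lborel (cball (0::real^'n) (R + 1))"
  have bd: "t * \<bar>integral\<^sup>L lborel ?D\<bar> \<le> C * t\<^sup>2 * m" if t: "0 < t" "t \<le> 1" for t
  proof -
    have z: "f (x + t *\<^sub>R ?e) - f x - t * ?D x = 0" if "x \<notin> cball 0 (R + 1)" for x
    proof -
      have "norm x - norm (t *\<^sub>R ?e) \<le> norm (x + t *\<^sub>R ?e)"
        by (metis norm_diff_ineq)
      then have "norm (x + t *\<^sub>R ?e) > R" using that t by (simp add: norm_axis_1)
      then have "f (x + t *\<^sub>R ?e) = 0" using R(2) not_in_supp by fastforce
      moreover have "x \<notin> supp f" using R(2)[of x] that by auto
      ultimately show ?thesis by (simp add: not_in_supp partial_deriv_not_in_supp)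
    qed
    have "(LINT x|lborel. f (x + t *\<^sub>R ?e) - f x - t * ?D x) =
        (LINT x|lborel. f (x + t *\<^sub>R ?e)) - (LINT x|lborel. f x) - t * (LINT x|lborel. ?D x)"
      using fi Di integrable_translate[OF fi] by simp
    also have "(LINT x|lborel. f (x + t *\<^sub>R ?e)) = (LINT x|lborel. f x)"
      using fi by (intro integral_translate) auto
    finally have "t * \<bar>LINT x|lborel. ?D x\<bar> = \<bar>LINT x|lborel. f (x + t *\<^sub>R ?e) - f x - t * ?D x\<bar>"
      using t by (simp add: abs_mult)
    also have "\<dots> \<le> (LINT x|lborel. \<bar>f (x + t *\<^sub>R ?e) - f x - t * ?D x\<bar>)"
      by (rule integral_abs_bound)
    also have "\<dots> \<le> (LINT x|lborel. C * t\<^sup>2 * indicator (cball (0::real^'n) (R + 1)) x)"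
    proof (rule integral_mono)
      show "integrable lborel (\<lambda>x. \<bar>f (x + t *\<^sub>R ?e) - f x - t * ?D x\<bar>)"
        using fi Di integrable_translate[OF fi] by simp
      show "integrable lborel (\<lambda>x. C * t\<^sup>2 * indicator (cball (0::real^'n) (R + 1)) x :: real)"
        using emeasure_lborel_cball_finite by (intro integrable_mult_right integrable_real_indicator) auto
      show "\<bar>f (x + t *\<^sub>R ?e) - f x - t * ?D x\<bar> \<le> C * t\<^sup>2 * indicator (cball 0 (R + 1)) x" for x
        using C(2)[of x "t *\<^sub>R ?e"] z[of x] t
        by (cases "x \<in> cball 0 (R + 1)") (auto simp: gradient_def inner_axis norm_axis_1 mult.commute)
    qed
    also have "\<dots> = C * t\<^sup>2 * m"
      by (simp add: m_def)
    finally show ?thesis .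
  qed
  have "\<bar>integral\<^sup>L lborel ?D\<bar> \<le> 0"
  proof (rule field_le_epsilon)
    fix e :: real assume e: "e > 0"
    have m: "m \<ge> 0" by (simp add: m_def)
    \<comment> \<open>The summand 1 keeps the denominator positive when \<open>C * m\<close> is
      zero; the minimum with 1 is required by \<open>bd\<close>.\<close>
    define t where "t = min 1 (e / (C * m + 1))"
    have cm: "C * m + 1 > 0" using C(1) m by (simp add: add_nonneg_pos)
    have t: "0 < t" "t \<le> 1" using e cm by (auto simp: t_def)
    have "t * \<bar>integral\<^sup>L lborel ?D\<bar> \<le> t * (t * (C * m))"
      using bd[OF t] by (simp add: power2_eq_square algebra_simps)
    then have "\<bar>integral\<^sup>L lborel ?D\<bar> \<le> t * (C * m)" using t by simp
    also have "\<dots> \<le> e / (C * m + 1) * (C * m)"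
      using C(1) m by (intro mult_right_mono) (auto simp: t_def)
    also have "\<dots> \<le> e" using e cm by (simp add: field_simps)
    finally show "\<bar>integral\<^sup>L lborel ?D\<bar> \<le> 0 + e" by simp
  qed
  then show ?thesis by simp
qed

lemma integrable_bounded_scaleR:
  fixes f :: "'a::topological_space \<Rightarrow> 'b::{banach, second_countable_topology}"
  assumes "sets M = sets borel" "integrable M f" "g \<in> borel_measurable borel" "\<And>x. \<bar>g x\<bar> \<le> B"
  shows "integrable M (\<lambda>x. g x *\<^sub>R f x)"
proof (rule Bochner_Integration.integrable_bound)
  show "integrable M (\<lambda>x. B *\<^sub>R f x)" using assms by simp
  have [measurable]: "g \<in> borel_measurable M"
    using assms measurable_cong_sets by blast
  show "(\<lambda>x. g x *\<^sub>R f x) \<in> borel_measurable M" using assms by measurable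
  show "AE x in M. norm (g x *\<^sub>R f x) \<le> norm (B *\<^sub>R f x)"
    using assms(4) by (auto intro!: always_eventually mult_right_mono order_trans[OF assms(4) abs_ge_self])
qed

section \<open>Vector measures\<close>

text \<open>A finite sum of signed measures f_k dM_k, seen as a functional on bounded Borel
  functions. An identity between several integrals becomes the vanishing of one such functional, so
  the approximation arguments are made once; they are applied below with four measures and with
  two.\<close>

locale measure_combination =
  fixes K :: "'k set" and M :: "'k \<Rightarrow> 'a::metric_space measure" and f :: "'k \<Rightarrow> 'a \<Rightarrow> real"
  assumes finite_K: "finite K" and sets_M: "k \<in> K \<Longrightarrow> sets (M k) = sets borel"
    and integrable_f: "k \<in> K \<Longrightarrow> integrable (M k) (f k)"
begin

definition comb :: "('a \<Rightarrow> real) \<Rightarrow> real"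
  where "comb g = (\<Sum>k\<in>K. \<integral>x. g x * f k x \<partial>M k)"

lemma integrable_mult_f:
  assumes "g \<in> borel_measurable borel" "\<And>x. \<bar>g x\<bar> \<le> B" "k \<in> K"
  shows "integrable (M k) (\<lambda>x. g x * f k x)"
  using integrable_bounded_scaleR[OF sets_M integrable_f assms(1,2)] assms(3) by simp

lemma comb_cmult: "comb (\<lambda>x. c * g x) = c * comb g"
  by (simp add: comb_def sum_distrib_left mult.assoc)

lemma comb_add:
  assumes "g \<in> borel_measurable borel" "\<And>x. \<bar>g x\<bar> \<le> B"
    and "h \<in> borel_measurable borel" "\<And>x. \<bar>h x\<bar> \<le> C"
  shows "comb (\<lambda>x. g x + h x) = comb g + comb h"
  unfolding comb_def sum.distrib[symmetric]
  by (intro sum.cong refl)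
    (simp add: distrib_right Bochner_Integration.integral_add integrable_mult_f[OF assms(1,2)] integrable_mult_f[OF assms(3,4)])

lemma comb_limit:
  assumes g: "\<And>m::nat. g m \<in> borel_measurable borel" "\<And>m x. \<bar>g m x\<bar> \<le> B"
    and lim: "\<And>x. (\<lambda>m. g m x) \<longlonglongrightarrow> h x"
  shows "(\<lambda>m. comb (g m)) \<longlonglongrightarrow> comb h"
  unfolding comb_def
proof (rule tendsto_sum)
  fix k assume k: "k \<in> K"
  have h: "h \<in> borel_measurable borel"
    by (rule borel_measurable_LIMSEQ_real[OF lim g(1)])
  have [measurable]: "g m \<in> borel_measurable (M k)" "h \<in> borel_measurable (M k)" "f k \<in> borel_measurable (M k)" for m
    using g h sets_M[OF k] integrable_f[OF k] measurable_cong_sets by blast+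
  show "(\<lambda>m. \<integral>x. g m x * f k x \<partial>M k) \<longlonglongrightarrow> (\<integral>x. h x * f k x \<partial>M k)"
  proof (rule integral_dominated_convergence)
    show "integrable (M k) (\<lambda>x. B * norm (f k x))" using integrable_f[OF k] by simp
    show "AE x in M k. (\<lambda>m. g m x * f k x) \<longlonglongrightarrow> h x * f k x"
      by (intro always_eventually allI tendsto_intros lim)
    show "AE x in M k. norm (g m x * f k x) \<le> B * norm (f k x)" for m
      using g(2) by (auto intro!: always_eventually mult_right_mono simp: abs_mult)
  qed measurable
qed

text \<open>Induction over non-negative Borel functions, followed by the splitting into positive and
  negative part. Boundedness is a premise inside the induction predicate, because it is what
  supplies integrability and a dominating function in each step.\<close>

lemma comb_eq_0_bounded:
  assumes sets: "\<And>A. A \<in> sets borel \<Longrightarrow> comb (indicator A) = 0"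
    and g: "g \<in> borel_measurable borel" "\<And>x. \<bar>g x\<bar> \<le> B"
  shows "comb g = 0"
proof -
  have nonneg: "(\<exists>B. \<forall>x. u x \<le> B) \<longrightarrow> comb u = 0"
    if "u \<in> borel_measurable borel" "\<And>x. 0 \<le> u x" for u
    using that
  proof (induction u rule: borel_measurable_induct_real)
    case (set A) then show ?case by (simp add: sets)
  next
    case (mult u c)
    \<comment> \<open>For c = 0 a bound on c u says nothing about u, so the induction hypothesis is
      out of reach; there the value is zero directly.\<close>
    show ?case
    proof (cases "c = 0")
      case False
      then have "(\<exists>B. \<forall>x. c * u x \<le> B) \<Longrightarrow> (\<exists>B. \<forall>x. u x \<le> B)"
        using mult.hyps(1) by (metis less_eq_real_def mult.commute pos_le_divide_eq)
      then show ?thesis using mult.IH by (simp add: comb_cmult)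
    qed (simp add: comb_def)
  next
    case (add u v)
    show ?case
    proof safe
      fix B assume B: "\<forall>x. v x + u x \<le> B"
      have u: "\<bar>u x\<bar> \<le> B" and v: "\<bar>v x\<bar> \<le> B" for x
        using B[rule_format, of x] add.hyps(2)[of x] add.hyps(4)[of x] by linarith+
      then have "comb u = 0" "comb v = 0" using add.IH by (meson abs_le_D1)+
      then show "comb (\<lambda>x. v x + u x) = 0" using comb_add[OF add.hyps(3) v add.hyps(1) u] by simp
    qed
  next
    case (seq U)
    show ?case
    proof safe
      fix B assume B: "\<forall>x. u x \<le> B"
      have "U i x \<le> u x" for i x
        using seq.hyps(3) seq.hyps(4)[of x] by (intro incseq_le) (auto simp: incseq_def le_fun_def)
      then have UB: "\<bar>U i x\<bar> \<le> B" for i x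
        using B seq.hyps(2)[of i x] by (metis abs_of_nonneg order_trans)
      then have "comb (U i) = 0" for i using seq.IH by (meson abs_le_D1)
      moreover have "(\<lambda>i. comb (U i)) \<longlonglongrightarrow> comb u"
        using seq.hyps(1,4) UB by (intro comb_limit) auto
      ultimately show "comb u = 0" by (simp add: LIMSEQ_const_iff)
    qed
  qed
  have B: "0 \<le> B" using g(2)[of undefined] by linarith
  have "max (g x) 0 \<le> B" "max (- g x) 0 \<le> B" for x using g(2)[of x] B by auto
  then have p: "comb (\<lambda>x. max (g x) 0) = 0" and n: "comb (\<lambda>x. max (- g x) 0) = 0"
    using g(1) by (auto intro!: nonneg[rule_format] exI[of _ B] simp del: max.bounded_iff)
  have "g = (\<lambda>x. max (g x) 0 + (- 1) * max (- g x) 0)" by auto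
  then have "comb g = comb (\<lambda>x. max (g x) 0 + (- 1) * max (- g x) 0)" by (rule arg_cong)
  also have "comb (\<lambda>x. max (g x) 0 + (- 1) * max (- g x) 0) =
      comb (\<lambda>x. max (g x) 0) + comb (\<lambda>x. (- 1) * max (- g x) 0)"
    by (rule comb_add[of _ B _ B]) (use g B in \<open>auto simp: abs_le_iff max_def\<close>)
  also have "\<dots> = 0" using p n comb_cmult[of "-1" "\<lambda>x. max (- g x) 0"] by simp
  finally show ?thesis .
qed

text \<open>The indicator of an open set is a bounded pointwise limit of continuous functions,
  truncated multiples of the distance to the complement. Open sets are closed under intersection and
  generate the Borel sets, so Dynkin's argument covers the rest.\<close>

lemma comb_indicator_eq_0:
  assumes cont: "\<And>g. continuous_on UNIV g \<Longrightarrow> (\<And>x. \<bar>g x\<bar> \<le> 1) \<Longrightarrow> comb g = 0"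
    and A: "A \<in> sets borel"
  shows "comb (indicator A) = 0"
proof -
  have "Int_stable {S :: 'a set. open S}" "{S :: 'a set. open S} \<subseteq> Pow UNIV"
    "A \<in> sigma_sets UNIV {S. open S}"
    using A by (auto simp: borel_def Int_stable_def)
  then show ?thesis
  proof (induction rule: sigma_sets_induct_disjoint)
    case (basic W)
    then have W: "open W" by simp
    \<comment> \<open>The whole space is separate, because \<open>infdist\<close> to the empty set
      is 0 and the approximating functions would all vanish.\<close>
    show ?case
    proof (cases "W = UNIV")
      case True
      then show ?thesis using cont[of "\<lambda>x. 1"] by (simp add: indicator_def)
    next
      case False
      define g where "g m x = min 1 (real m * infdist x (- W))" for m :: nat and x
      have "comb (g m) = 0" for m
        by (rule cont) (auto simp: g_def infdist_nonneg intro!: continuous_intros)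
      moreover have "(\<lambda>m. comb (g m)) \<longlonglongrightarrow> comb (indicator W)"
      proof (rule comb_limit)
        show "g m \<in> borel_measurable borel" for m
          unfolding g_def by (intro borel_measurable_continuous_onI continuous_intros)
        show "\<bar>g m x\<bar> \<le> 1" for m x by (auto simp: g_def infdist_nonneg)
        show "(\<lambda>m. g m x) \<longlonglongrightarrow> indicator W x" for x
        proof (cases "x \<in> W")
          case True
          then have "infdist x (- W) > 0"
            using False W by (metis Compl_iff UNIV_I closed_Compl compl_bot_eq double_compl in_closed_iff_infdist_zero infdist_nonneg order_le_less)
          then obtain N :: nat where N: "1 < real N * infdist x (- W)" using reals_Archimedean3 by blast
          have "g m x = 1" if "m \<ge> N" for m
          proof -
            have "real N * infdist x (- W) \<le> real m * infdist x (- W)"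
              using that by (intro mult_right_mono) (auto simp: infdist_nonneg)
            then show ?thesis using N by (simp add: g_def)
          qed
          then have "\<forall>\<^sub>F m in sequentially. g m x = indicator W x"
            using True by (auto simp: eventually_sequentially)
          then show ?thesis by (rule tendsto_eventually)
        next
          case False
          then show ?thesis by (auto simp: g_def)
        qed
      qed
      ultimately show ?thesis by (simp add: LIMSEQ_const_iff)
    qed
  next
    case empty
    show ?case by (simp add: comb_def)
  next
    case (compl A)
    then have [measurable]: "A \<in> sets borel" by (simp add: borel_def)
    have "indicator (UNIV - A) = (\<lambda>x. 1 + (- 1) * indicator A x :: real)"
      by (auto simp: indicator_def)
    moreover have "comb (\<lambda>x. 1 + (- 1) * indicator A x) = comb (\<lambda>x. 1) + comb (\<lambda>x. (- 1) * indicator A x)"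
      by (rule comb_add[of _ 1 _ 1]) (auto simp: indicator_def)
    ultimately show ?case using compl cont[of "\<lambda>x. 1"] comb_cmult[of "-1" "indicator A"] by simp
  next
    case (union A)
    then have A[measurable]: "A i \<in> sets borel" for i by (auto simp: borel_def)
    have *: "comb (indicator (\<Union>i<n. A i)) = 0" for n :: nat
    proof (induction n)
      case (Suc n)
      have "(\<Union>i<n. A i) \<inter> A n = {}"
        using union(1) by (auto simp: disjoint_family_on_def) (metis Int_iff empty_iff less_irrefl)
      then have "indicator (\<Union>i<Suc n. A i) = (\<lambda>x. indicator (\<Union>i<n. A i) x + indicator (A n) x :: real)"
        unfolding lessThan_Suc UN_insert Un_commute[of "A n"] fun_eq_iff by (simp add: indicator_disj_union)
      moreover have "comb (\<lambda>x. indicator (\<Union>i<n. A i) x + indicator (A n) x) =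
          comb (indicator (\<Union>i<n. A i)) + comb (indicator (A n))"
        by (rule comb_add[of _ 1 _ 1]) (auto simp: indicator_def)
      ultimately show ?case using Suc union(3) by simp
    qed (simp add: comb_def)
    have "(\<lambda>n. comb (indicator (\<Union>i<n. A i))) \<longlonglongrightarrow> comb (indicator (\<Union>i. A i))"
    proof (rule comb_limit)
      show "(\<lambda>n. indicator (\<Union>i<n. A i) x :: real) \<longlonglongrightarrow> indicator (\<Union>i. A i) x" for x
        by (rule LIMSEQ_indicator_UN)
    qed (auto simp: indicator_def)
    then show ?case by (simp add: * LIMSEQ_const_iff)
  qed
qed

end

section \<open>Bounded signed measures and their Jordan decomposition\<close>

text \<open>The bound is built in so that \<open>jordan_pos\<close> is a finite measure without an
  appeal to a Hahn decomposition.\<close>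

definition bounded_signed :: "((real^'n) set \<Rightarrow> real) \<Rightarrow> bool"
  where "bounded_signed m \<longleftrightarrow>
    (\<forall>E :: nat \<Rightarrow> (real^'n) set. range E \<subseteq> sets borel \<longrightarrow> disjoint_family E \<longrightarrow>
        (\<lambda>i. m (E i)) sums m (\<Union>i. E i)) \<and>
    (\<exists>K. \<forall>A\<in>sets borel. \<bar>m A\<bar> \<le> K)"

lemma bounded_signed_sums:
  "bounded_signed m \<Longrightarrow> (\<And>i. E i \<in> sets borel) \<Longrightarrow> disjoint_family E \<Longrightarrow>
    (\<lambda>i. m (E i)) sums m (\<Union>i::nat. E i)"
  unfolding bounded_signed_def by blast

lemma bounded_signed_uminus: "bounded_signed m \<Longrightarrow> bounded_signed (\<lambda>A. - m A)"
  unfolding bounded_signed_def by (auto intro: sums_minus)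

lemma bounded_signed_empty:
  assumes "bounded_signed m" shows "m {} = 0"
proof -
  have "(\<lambda>i::nat. m {}) sums m (\<Union>i::nat. {})"
    by (rule bounded_signed_sums[OF assms]) (auto simp: disjoint_family_on_def)
  then have "(\<lambda>i::nat. m {}) \<longlonglongrightarrow> 0" using sums_summable summable_LIMSEQ_zero by blast
  then show ?thesis by (simp add: LIMSEQ_const_iff)
qed

lemma bounded_signed_Un:
  assumes m: "bounded_signed m" and A: "A \<in> sets borel" "B \<in> sets borel" "A \<inter> B = {}"
  shows "m (A \<union> B) = m A + m B"
proof -
  let ?E = "\<lambda>i. if i = 0 then A else if i = Suc 0 then B else {}"
  have "(\<lambda>i. m (?E i)) sums m (\<Union>i. ?E i)"
    by (rule bounded_signed_sums[OF m]) (use A in \<open>auto simp: disjoint_family_on_def\<close>)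
  moreover have "(\<Union>i. ?E i) = A \<union> B" by (auto split: if_splits)
  moreover have "(\<lambda>i. m (?E i)) sums (\<Sum>i\<in>{0, Suc 0}. m (?E i))"
    by (rule sums_finite) (auto simp: bounded_signed_empty[OF m])
  ultimately show ?thesis using sums_unique2 by fastforce
qed

text \<open>Only countable additivity of the supremum needs an argument. Uniting disjoint
  competitors gives finite superadditivity, hence one inequality; for the other, a competitor in the
  union is cut along the sets \<open>E i\<close>.\<close>

lemma jordan_pos_props:
  fixes m :: "(real^'n) set \<Rightarrow> real"
  assumes m: "bounded_signed m"
  shows sets_jordan_pos: "sets (jordan_pos m) = sets borel"
    and emeasure_jordan_pos: "A \<in> sets borel \<Longrightarrow>
      emeasure (jordan_pos m) A = (SUP B \<in> {B \<in> sets borel. B \<subseteq> A}. ennreal (m B))"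
    and finite_measure_jordan_pos: "finite_measure (jordan_pos m)"
proof -
  define P where "P A = (SUP B \<in> {B \<in> sets borel. B \<subseteq> A}. ennreal (m B))" for A :: "(real^'n) set"
  have jp: "jordan_pos m = measure_of UNIV (sets borel) P"
    by (simp add: jordan_pos_def P_def[abs_def])
  show s: "sets (jordan_pos m) = sets borel"
    unfolding jp by (metis sets.sigma_sets_eq sets.space_closed sets_measure_of space_borel)
  have upper: "ennreal (m B) \<le> P A" if "B \<in> sets borel" "B \<subseteq> A" for A B
    unfolding P_def using that by (intro SUP_upper) auto
  have mono: "P A \<le> P A'" if "A \<subseteq> A'" for A A'
    unfolding P_def using that by (intro SUP_subset_mono) auto
  have super: "P A + P A' \<le> P (A \<union> A')" if d: "A \<inter> A' = {}" for A A'
  proof -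
    have *: "ennreal (m B) + ennreal (m B') \<le> P (A \<union> A')"
      if B: "B \<in> sets borel" "B \<subseteq> A" "B' \<in> sets borel" "B' \<subseteq> A'" for B B'
    proof (cases "m B \<ge> 0 \<and> m B' \<ge> 0")
      case True
      moreover have "B \<inter> B' = {}" using B d by auto
      ultimately have "ennreal (m B) + ennreal (m B') = ennreal (m (B \<union> B'))"
        using bounded_signed_Un[OF m B(1) B(3)] B d by (subst ennreal_plus[symmetric]) auto
      then show ?thesis using upper[of "B \<union> B'" "A \<union> A'"] B by auto
    next
      case False
      \<comment> \<open>A negative value is truncated to 0 by \<open>ennreal\<close>, so the other
        set alone is a sufficient competitor.\<close>
      then have "ennreal (m B) = 0 \<or> ennreal (m B') = 0" by (auto simp: ennreal_neg)
      then show ?thesis using upper[OF B(1), of "A \<union> A'"] upper[OF B(3), of "A \<union> A'"] B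
        by (auto simp: le_supI1 le_supI2)
    qed
    have "P A + P A' = (SUP B \<in> {B \<in> sets borel. B \<subseteq> A}. ennreal (m B) + P A')"
      unfolding P_def[of A] by (rule ennreal_SUP_add_left[symmetric]) auto
    also have "\<dots> \<le> P (A \<union> A')"
    proof (rule SUP_least)
      fix B assume B: "B \<in> {B \<in> sets borel. B \<subseteq> A}"
      have "ennreal (m B) + P A' = (SUP B' \<in> {B' \<in> sets borel. B' \<subseteq> A'}. ennreal (m B') + ennreal (m B))"
        unfolding P_def[of A'] by (subst ennreal_SUP_add_left) (auto simp: add.commute)
      also have "\<dots> \<le> P (A \<union> A')"
        using *[of B] B by (intro SUP_least) (simp add: add.commute)
      finally show "ennreal (m B) + P A' \<le> P (A \<union> A')" .
    qed
    finally show ?thesis .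
  qed
  have ca: "countably_additive (sets borel) P"
  proof (rule countably_additiveI)
    fix E :: "nat \<Rightarrow> (real^'n) set"
    assume E: "range E \<subseteq> sets borel" "disjoint_family E"
    show "(\<Sum>i. P (E i)) = P (\<Union>i. E i)"
    proof (rule antisym)
      have fin: "(\<Sum>i<n. P (E i)) \<le> P (\<Union>i<n. E i)" for n :: nat
      proof (induction n)
        case (Suc n)
        have "(\<Union>i<n. E i) \<inter> E n = {}"
          using E(2) by (auto simp: disjoint_family_on_def) (metis Int_iff empty_iff less_irrefl)
        then have a: "P (\<Union>i<n. E i) + P (E n) \<le> P ((\<Union>i<n. E i) \<union> E n)" by (rule super)
        have b: "(\<Sum>i<Suc n. P (E i)) \<le> P (\<Union>i<n. E i) + P (E n)"
          using add_right_mono[OF Suc, of "P (E n)"] by simp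
        have "(\<Union>i<Suc n. E i) = (\<Union>i<n. E i) \<union> E n" by (auto simp: lessThan_Suc)
        then show ?case using order_trans[OF b a] by (simp only:)
      qed simp
      show "(\<Sum>i. P (E i)) \<le> P (\<Union>i. E i)"
      proof (rule suminf_le_const)
        show "(\<Sum>i<n. P (E i)) \<le> P (\<Union>i. E i)" for n
          by (rule order_trans[OF fin mono]) auto
      qed simp
      show "P (\<Union>i. E i) \<le> (\<Sum>i. P (E i))"
        unfolding P_def[of "\<Union>i. E i"]
      proof (rule SUP_least, clarify)
        fix B :: "(real^'n) set" assume B: "B \<in> sets borel" "B \<subseteq> (\<Union>i. E i)"
        have "(\<lambda>i. m (B \<inter> E i)) sums m (\<Union>i. B \<inter> E i)"
          by (rule bounded_signed_sums[OF m])
            (use E B in \<open>auto simp: disjoint_family_on_def image_subset_iff\<close>)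
        moreover have "(\<Union>i. B \<inter> E i) = B" using B by auto
        ultimately have "(\<lambda>n. \<Sum>i<n. m (B \<inter> E i)) \<longlonglongrightarrow> m B" by (simp add: sums_def)
        then have "(\<lambda>n. ennreal (\<Sum>i<n. m (B \<inter> E i))) \<longlonglongrightarrow> ennreal (m B)" by (rule tendsto_ennrealI)
        moreover have "ennreal (\<Sum>i<n. m (B \<inter> E i)) \<le> (\<Sum>i. P (E i))" for n
        proof -
          \<comment> \<open>\<open>ennreal\<close> is additive only on non-negative numbers, so the
            terms are first replaced by their positive parts.\<close>
          have "ennreal (\<Sum>i<n. m (B \<inter> E i)) \<le> ennreal (\<Sum>i<n. max 0 (m (B \<inter> E i)))"
            by (intro ennreal_leI sum_mono) auto
          also have "\<dots> = (\<Sum>i<n. ennreal (max 0 (m (B \<inter> E i))))" by (simp add: sum_ennreal)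
          also have "\<dots> \<le> (\<Sum>i<n. P (E i))"
          proof (rule sum_mono)
            fix i
            have "ennreal (max 0 (m (B \<inter> E i))) = ennreal (m (B \<inter> E i))"
              by (auto simp: max_def ennreal_neg)
            also have "\<dots> \<le> P (E i)" using E B by (intro upper) auto
            finally show "ennreal (max 0 (m (B \<inter> E i))) \<le> P (E i)" .
          qed
          also have "\<dots> \<le> (\<Sum>i. P (E i))" by (rule sum_le_suminf) auto
          finally show ?thesis .
        qed
        ultimately show "ennreal (m B) \<le> (\<Sum>i. P (E i))"
          by (intro LIMSEQ_le_const2[of "\<lambda>n. ennreal (\<Sum>i<n. m (B \<inter> E i))"]) auto
      qed
    qed
  qed
  have "{B \<in> sets borel. B \<subseteq> {}} = {{}::(real^'n) set}" by auto
  then have P0: "P {} = 0" by (simp add: P_def bounded_signed_empty[OF m])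
  show e: "emeasure (jordan_pos m) A = (SUP B \<in> {B \<in> sets borel. B \<subseteq> A}. ennreal (m B))"
    if "A \<in> sets borel" for A
    using that ca P0 s unfolding P_def[symmetric]
    by (intro emeasure_measure_of[OF jp]) (auto simp: positive_def)
  obtain K where K: "\<And>A. A \<in> sets borel \<Longrightarrow> \<bar>m A\<bar> \<le> K"
    using m unfolding bounded_signed_def by blast
  have "emeasure (jordan_pos m) UNIV \<le> ennreal K"
    by (subst e) (auto intro!: SUP_least ennreal_leI dest: K)
  then show "finite_measure (jordan_pos m)"
    using sets_eq_imp_space_eq[OF s] by (intro finite_measureI) (auto simp: top_unique)
qed

text \<open>For B inside A, m B = m A - m (A - B) is at most m A plus the negative part of A. The
  supremum over B gives one inequality, and the same inequality for -m gives the other.\<close>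

lemma jordan_decomposition:
  fixes m :: "(real^'n) set \<Rightarrow> real"
  assumes m: "bounded_signed m" and A: "A \<in> sets borel"
  shows "m A = measure (jordan_pos m) A - measure (jordan_pos (\<lambda>A. - m A)) A"
proof -
  have ineq: "measure (jordan_pos m) A \<le> m A + measure (jordan_pos (\<lambda>A. - m A)) A"
    if m: "bounded_signed m" for m :: "(real^'n) set \<Rightarrow> real"
  proof -
    let ?n = "measure (jordan_pos (\<lambda>A. - m A)) A"
    interpret P: finite_measure "jordan_pos m" by (rule finite_measure_jordan_pos[OF m])
    interpret N: finite_measure "jordan_pos (\<lambda>A. - m A)"
      by (rule finite_measure_jordan_pos[OF bounded_signed_uminus[OF m]])
    have *: "m B \<le> m A + ?n" if B: "B \<in> sets borel" "B \<subseteq> A" for B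
    proof -
      have "ennreal (- m (A - B)) \<le> emeasure (jordan_pos (\<lambda>A. - m A)) A"
        using A B by (subst emeasure_jordan_pos[OF bounded_signed_uminus[OF m]]) (auto intro!: SUP_upper)
      then have "- m (A - B) \<le> ?n"
        by (auto simp: N.emeasure_eq_measure ennreal_le_iff2 intro: order_trans[OF _ measure_nonneg])
      moreover have "m (B \<union> (A - B)) = m B + m (A - B)"
        using A B by (intro bounded_signed_Un[OF m]) auto
      ultimately show ?thesis using B by (simp add: Un_absorb1)
    qed
    have "0 \<le> m A + ?n" using *[of "{}"] bounded_signed_empty[OF m] by simp
    moreover have "emeasure (jordan_pos m) A \<le> ennreal (m A + ?n)"
      using A by (subst emeasure_jordan_pos[OF m]) (auto intro!: SUP_least ennreal_leI *)
    ultimately show ?thesis by (simp add: P.emeasure_eq_measure)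
  qed
  show ?thesis using ineq[OF m] ineq[OF bounded_signed_uminus[OF m]] by simp
qed

text \<open>This removes the suprema of \<open>jordan_pos\<close> from integrals: any representation
  of \<open>m\<close> by densities computes its integral. Two densities are allowed because
  derivative measures will have a part with respect to \<nu> and a part with respect to Lebesgue
  measure.\<close>

lemma signed_integral_eq:
  fixes m :: "(real^'n) set \<Rightarrow> real" and M1 M2 :: "(real^'n) measure"
  assumes m: "bounded_signed m"
    and M: "sets M1 = sets borel" "sets M2 = sets borel" "integrable M1 f1" "integrable M2 f2"
    and eq: "\<And>A. A \<in> sets borel \<Longrightarrow>
      m A = (LINT x|M1. indicator A x * f1 x) + (LINT x|M2. indicator A x * f2 x)"
    and g: "g \<in> borel_measurable borel" "\<And>x. \<bar>g x\<bar> \<le> B"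
  shows "signed_integral m g = (LINT x|M1. g x * f1 x) + (LINT x|M2. g x * f2 x)"
proof -
  let ?P = "jordan_pos m" and ?N = "jordan_pos (\<lambda>A. - m A)"
  \<comment> \<open>The combination is (positive part) - (negative part) - f1 M1 - f2 M2, which
    vanishes on all Borel sets by hypothesis.\<close>
  define M where "M k = [?P, ?N, M1, M2] ! k" for k
  define f where "f k = [\<lambda>x. 1, \<lambda>x. - 1, \<lambda>x. - f1 x, \<lambda>x. - f2 x] ! k" for k
  note n = bounded_signed_uminus[OF m]
  interpret P: finite_measure ?P by (rule finite_measure_jordan_pos[OF m])
  interpret N: finite_measure ?N by (rule finite_measure_jordan_pos[OF n])
  have four: "{..<4::nat} = {0, 1, 2, 3}" by auto
  interpret measure_combination "{..<4::nat}" M f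
    by unfold_locales (auto simp: four M_def f_def M sets_jordan_pos[OF m] sets_jordan_pos[OF n])
  have sp: "space ?P = UNIV" "space ?N = UNIV"
    using sets_jordan_pos[OF m] sets_jordan_pos[OF n] by (metis sets_eq_imp_space_eq space_borel)+
  have "comb (indicator A) = 0" if A: "A \<in> sets borel" for A
  proof -
    have "A \<in> sets ?P" "A \<in> sets ?N" using A sets_jordan_pos[OF m] sets_jordan_pos[OF n] by auto
    then show ?thesis
      using jordan_decomposition[OF m A] eq[OF A]
      unfolding comb_def by (simp add: four M_def f_def sp)
  qed
  then have "comb g = 0" using g by (rule comb_eq_0_bounded)
  then show ?thesis unfolding comb_def by (simp add: four M_def f_def signed_integral_def)
qed

lemma norm_le_variation:
  assumes "A \<in> sets borel" "B \<in> sets borel" "B \<subseteq> A"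
  shows "ennreal (norm (\<mu> B)) \<le> variation \<mu> A"
proof -
  let ?E = "\<lambda>i. if i = 0 then B else if i = Suc 0 then A - B else {}"
  have "ennreal (norm (\<mu> B)) = (\<Sum>i\<in>{0}. ennreal (norm (\<mu> (?E i))))" by simp
  also have "\<dots> \<le> (\<Sum>i. ennreal (norm (\<mu> (?E i))))" by (rule sum_le_suminf) auto
  also have "\<dots> \<le> variation \<mu> A"
    unfolding variation_def
    by (rule SUP_upper2[of ?E]) (use assms in \<open>auto simp: disjoint_family_on_def split: if_splits\<close>)
  finally show ?thesis .
qed

lemma norm_le_variation_UNIV:
  "vector_measure \<mu> \<Longrightarrow> A \<in> sets borel \<Longrightarrow> norm (\<mu> A) \<le> enn2real (variation \<mu> UNIV)"
  using enn2real_mono[OF norm_le_variation[of UNIV A \<mu>]] unfolding vector_measure_def by auto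

lemma bounded_signed_component:
  fixes \<mu> :: "(real^'n) set \<Rightarrow> real^'n"
  assumes "vector_measure \<mu>" shows "bounded_signed (\<lambda>A. \<mu> A $ i)"
  unfolding bounded_signed_def
proof (intro conjI allI impI exI ballI)
  fix E :: "nat \<Rightarrow> (real^'n) set" assume "range E \<subseteq> sets borel" "disjoint_family E"
  then show "(\<lambda>j. \<mu> (E j) $ i) sums (\<mu> (\<Union>j. E j) $ i)"
    using assms unfolding vector_measure_def by (intro bounded_linear.sums[OF bounded_linear_vec_nth]) auto
next
  fix A :: "(real^'n) set" assume "A \<in> sets borel"
  then show "\<bar>\<mu> A $ i\<bar> \<le> enn2real (variation \<mu> UNIV)"
    using norm_le_variation_UNIV[OF assms] component_le_norm_cart order_trans by blast
qed

lemma sum_of_measures: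
  fixes Q :: "'k \<Rightarrow> 'a::topological_space measure"
  assumes "finite K" "\<And>k. k \<in> K \<Longrightarrow> sets (Q k) = sets borel"
  obtains M where "sets M = sets borel"
    "\<And>A. A \<in> sets borel \<Longrightarrow> emeasure M A = (\<Sum>k\<in>K. emeasure (Q k) A)"
proof -
  define M where "M = measure_of UNIV (sets (borel :: 'a measure)) (\<lambda>A. \<Sum>k\<in>K. emeasure (Q k) A)"
  have s: "sets M = sets borel"
    unfolding M_def by (metis sets.sigma_sets_eq sets.space_closed sets_measure_of space_borel)
  moreover have "emeasure M A = (\<Sum>k\<in>K. emeasure (Q k) A)" if "A \<in> sets borel" for A
  proof (rule emeasure_measure_of[OF M_def])
    show "countably_additive (sets M) (\<lambda>A. \<Sum>k\<in>K. emeasure (Q k) A)"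
    proof (rule countably_additiveI)
      fix E :: "nat \<Rightarrow> 'a set" assume E: "range E \<subseteq> sets M" "disjoint_family E"
      have "(\<Sum>i. \<Sum>k\<in>K. emeasure (Q k) (E i)) = (\<Sum>k\<in>K. \<Sum>i. emeasure (Q k) (E i))"
        by (rule suminf_sum) auto
      also have "\<dots> = (\<Sum>k\<in>K. emeasure (Q k) (\<Union>i. E i))"
        using E s assms by (intro sum.cong refl suminf_emeasure) auto
      finally show "(\<Sum>i. \<Sum>k\<in>K. emeasure (Q k) (E i)) = (\<Sum>k\<in>K. emeasure (Q k) (\<Union>i. E i))" .
    qed
  qed (use that s in \<open>auto simp: positive_def\<close>)
  ultimately show ?thesis using that by blast
qed

text \<open>
  Up to the factor \<open>2n\<close> the measure \<open>\<nu>\<close> plays the role of \<open>|\<mu>|\<close>; this spares the proof that the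
  variation is a measure.
\<close>

lemma vector_measure_polar:
  fixes \<mu> :: "(real^'n) set \<Rightarrow> real^'n"
  assumes \<mu>: "vector_measure \<mu>"
  obtains \<nu> \<sigma> where "finite_measure \<nu>" "sets \<nu> = sets borel"
    "\<sigma> \<in> borel_measurable borel" "\<And>x. norm (\<sigma> x) \<le> 1"
    "\<And>A. A \<in> sets borel \<Longrightarrow> \<mu> A = (LINT x|\<nu>. indicator A x *\<^sub>R \<sigma> x)"
    "\<And>A. A \<in> sets borel \<Longrightarrow> emeasure \<nu> A \<le> ennreal (2 * CARD('n)) * variation \<mu> A"
proof -
  \<comment> \<open>The pairs (i, True) and (i, False) index the positive and negative parts of the
    i-th component. There are 2n of them, each dominated by the variation; this is the origin of the
    factor 2n.\<close>
  define m where "m k A = (if snd k then \<mu> A $ fst k else - (\<mu> A $ fst k))" for k :: "'n \<times> bool" and A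
  have m: "bounded_signed (m k)" for k
    using bounded_signed_component[OF \<mu>, of "fst k"] bounded_signed_uminus unfolding m_def by (cases "snd k") auto
  define Q where "Q k = jordan_pos (m k)" for k
  have sQ[measurable_cong]: "sets (Q k) = sets borel" and fQ: "finite_measure (Q k)" for k
    unfolding Q_def by (rule sets_jordan_pos[OF m], rule finite_measure_jordan_pos[OF m])
  have eQ: "emeasure (Q k) A \<le> variation \<mu> A" if A: "A \<in> sets borel" for k A
    unfolding Q_def emeasure_jordan_pos[OF m A]
  proof (rule SUP_least, clarify)
    fix B assume B: "B \<in> sets borel" "B \<subseteq> A"
    have "ennreal (m k B) \<le> ennreal (norm (\<mu> B))"
      using component_le_norm_cart[of "\<mu> B" "fst k"] by (intro ennreal_leI) (auto simp: m_def)
    also have "\<dots> \<le> variation \<mu> A" by (rule norm_le_variation[OF A B])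
    finally show "ennreal (m k B) \<le> variation \<mu> A" .
  qed
  obtain M where sM[measurable_cong]: "sets M = sets borel"
    and eM: "\<And>A. A \<in> sets borel \<Longrightarrow> emeasure M A = (\<Sum>k\<in>UNIV. emeasure (Q k) A)"
    using sum_of_measures[of "UNIV :: ('n \<times> bool) set" Q] sQ by auto
  have spM: "space M = UNIV" using sM by (metis sets_eq_imp_space_eq space_borel)
  interpret M: finite_measure M
  proof (rule finite_measureI)
    have "emeasure (Q k) UNIV \<noteq> \<infinity>" for k
      using finite_measure.emeasure_finite[OF fQ] by auto
    then show "emeasure M (space M) \<noteq> \<infinity>" by (simp add: spM eM)
  qed
  \<comment> \<open>Each of the 2n parts is absolutely continuous with respect to their sum
    \<open>M\<close>, so Radon-Nikodym provides densities.\<close>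
  have "\<exists>D. D \<in> borel_measurable M \<and> (\<forall>x. 0 \<le> D x) \<and> density M (\<lambda>x. ennreal (D x)) = Q k" for k
  proof -
    have ac: "absolutely_continuous M (Q k)"
      unfolding absolutely_continuous_def
    proof
      fix A assume "A \<in> null_sets M"
      then have A: "A \<in> sets borel" "emeasure M A = 0" using sM by auto
      then have "emeasure (Q k) A = 0" using eM by (cases k) (simp add: sum_nonneg_eq_0_iff)
      then show "A \<in> null_sets (Q k)" using A sQ by auto
    qed
    obtain D where D: "D \<in> borel_measurable M" "AE x in M. RN_deriv M (Q k) x = ennreal (D x)" "\<And>x. 0 \<le> D x"
      using M.real_RN_deriv[OF fQ ac] sQ[of k] sM by metis
    have "density M (\<lambda>x. ennreal (D x)) = density M (RN_deriv M (Q k))"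
      using D by (intro density_cong) auto
    also have "\<dots> = Q k" using ac sQ sM by (intro M.density_RN_deriv) auto
    finally show ?thesis using D by blast
  qed
  then obtain D where D: "\<And>k. D k \<in> borel_measurable M" "\<And>k x. 0 \<le> D k x"
    "\<And>k. density M (\<lambda>x. ennreal (D k x)) = Q k"
    by metis
  have [measurable]: "D k \<in> borel_measurable borel" for k
    using D(1) sM measurable_cong_sets by blast
  have DQ: "emeasure (Q k) A = (\<integral>\<^sup>+x. ennreal (D k x) * indicator A x \<partial>M)" if "A \<in> sets borel" for k A
    unfolding D(3)[symmetric] using that sM by (subst emeasure_density) auto
  have Dint: "integrable M (D k)" for k
  proof (rule integrableI_nonneg)
    have "(\<integral>\<^sup>+x. ennreal (D k x) \<partial>M) = emeasure (Q k) UNIV" by (simp add: DQ)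
    also have "\<dots> < \<infinity>" using finite_measure.emeasure_finite[OF fQ] by (auto simp: less_top)
    finally show "(\<integral>\<^sup>+x. ennreal (D k x) \<partial>M) < \<infinity>" .
  qed (use D in auto)
  have DmQ: "measure (Q k) A = (LINT x|M. indicator A x * D k x)" if [measurable]: "A \<in> sets borel" for k A
  proof -
    have "(LINT x|M. indicator A x * D k x) = enn2real (\<integral>\<^sup>+x. ennreal (indicator A x * D k x) \<partial>M)"
      using D(2) by (intro integral_eq_nn_integral) auto
    also have "(\<integral>\<^sup>+x. ennreal (indicator A x * D k x) \<partial>M) = emeasure (Q k) A"
      unfolding DQ[OF that] by (intro nn_integral_cong) (auto simp: indicator_def)
    finally show ?thesis by (simp add: measure_def)
  qed
  define s where "s x = (\<Sum>i\<in>UNIV. (D (i, True) x - D (i, False) x) *\<^sub>R (axis i 1 :: real^'n))" for x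
  have s_nth: "s x $ i = (D (i, True) x - D (i, False) x)" for x and i :: 'n
    unfolding s_def by (simp add: axis_def if_distrib[of "(*) _"] cong: if_cong)
  have [measurable]: "s \<in> borel_measurable borel"
    unfolding s_def by measurable
  have sint: "integrable M s"
    unfolding s_def by (intro Bochner_Integration.integrable_sum integrable_scaleR_left Bochner_Integration.integrable_diff Dint)
  have \<mu>s: "\<mu> A = (LINT x|M. indicator A x *\<^sub>R s x)" if A[measurable]: "A \<in> sets borel" for A
  proof (rule vec_eq_iff[THEN iffD2], rule allI)
    fix i
    have "\<mu> A $ i = measure (Q (i, True)) A - measure (Q (i, False)) A"
      using jordan_decomposition[OF m A, of "(i, True)"] by (simp add: Q_def m_def[abs_def])
    also have "\<dots> = (LINT x|M. indicator A x * D (i, True) x - indicator A x * D (i, False) x)"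
      unfolding DmQ[OF A] 
      using integrable_bounded_scaleR[OF sM Dint, of "indicator A" 1] by (simp add: indicator_def)
    also have "\<dots> = (LINT x|M. (indicator A x *\<^sub>R s x) $ i)"
      by (simp add: s_nth right_diff_distrib)
    also have "\<dots> = (LINT x|M. indicator A x *\<^sub>R s x) $ i"
      using integrable_bounded_scaleR[OF sM sint, of "indicator A" 1]
      by (intro integral_bounded_linear bounded_linear_vec_nth) (simp add: indicator_def)
    finally show "\<mu> A $ i = (LINT x|M. indicator A x *\<^sub>R s x) $ i" .
  qed
  \<comment> \<open>Normalising the density: the measure is |s| dM and the direction is s / |s|.
    Where s = 0 the convention \<open>inverse 0 = 0\<close> makes \<sigma> zero, and \<nu> has no
    mass there.\<close>
  define \<nu> where "\<nu> = density M (\<lambda>x. ennreal (norm (s x)))"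
  define \<sigma> where "\<sigma> x = inverse (norm (s x)) *\<^sub>R s x" for x
  have s\<nu>: "sets \<nu> = sets borel" by (simp add: \<nu>_def sM)
  have \<nu>v: "emeasure \<nu> A \<le> ennreal (2 * CARD('n)) * variation \<mu> A" if A[measurable]: "A \<in> sets borel" for A
  proof -
    have "emeasure \<nu> A = (\<integral>\<^sup>+x. ennreal (norm (s x)) * indicator A x \<partial>M)"
      unfolding \<nu>_def using A sM by (subst emeasure_density) auto
    also have "\<dots> \<le> (\<integral>\<^sup>+x. (\<Sum>k\<in>UNIV. ennreal (D k x) * indicator A x) \<partial>M)"
    proof (rule nn_integral_mono)
      fix x
      have "norm (s x) \<le> (\<Sum>i\<in>UNIV. \<bar>s x $ i\<bar>)" by (rule norm_le_l1_cart)
      also have "\<dots> \<le> (\<Sum>i\<in>UNIV. D (i, True) x + D (i, False) x)"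
        using D(2) by (intro sum_mono) (simp add: s_nth abs_le_iff add_increasing add_increasing2)
      also have "\<dots> = (\<Sum>i\<in>UNIV. \<Sum>b\<in>UNIV. D (i, b) x)" by (simp add: UNIV_bool add.commute)
      also have "\<dots> = (\<Sum>k\<in>UNIV. D k x)" by (simp add: sum.cartesian_product)
      finally have "ennreal (norm (s x)) \<le> (\<Sum>k\<in>UNIV. ennreal (D k x))"
        using D(2) by (subst sum_ennreal) (auto intro: ennreal_leI)
      then show "ennreal (norm (s x)) * indicator A x \<le> (\<Sum>k\<in>UNIV. ennreal (D k x) * indicator A x)"
        by (auto simp: indicator_def)
    qed
    also have "\<dots> = (\<Sum>k\<in>UNIV. emeasure (Q k) A)"
      by (subst nn_integral_sum) (auto simp: DQ[OF A])
    also have "\<dots> \<le> (\<Sum>k\<in>(UNIV :: ('n \<times> bool) set). variation \<mu> A)"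
      by (intro sum_mono eQ A)
    also have "\<dots> = ennreal (2 * CARD('n)) * variation \<mu> A"
      by (simp add: ennreal_of_nat_eq_real_of_nat mult.commute)
    finally show ?thesis .
  qed
  show ?thesis
  proof
    show "finite_measure \<nu>"
    proof (rule finite_measureI)
      have "emeasure \<nu> UNIV \<le> ennreal (2 * CARD('n)) * variation \<mu> UNIV" by (rule \<nu>v) simp
      also have "\<dots> < \<infinity>" using \<mu> by (auto simp: vector_measure_def ennreal_mult_less_top)
      finally show "emeasure \<nu> (space \<nu>) \<noteq> \<infinity>"
        using s\<nu> by (metis infinity_ennreal_def less_irrefl sets_eq_imp_space_eq space_borel)
    qed
    show "\<sigma> \<in> borel_measurable borel" unfolding \<sigma>_def by measurable
    show "norm (\<sigma> x) \<le> 1" for x by (cases "s x = 0") (simp_all add: \<sigma>_def)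
    show "\<mu> A = (LINT x|\<nu>. indicator A x *\<^sub>R \<sigma> x)" if A[measurable]: "A \<in> sets borel" for A
    proof -
      have [measurable]: "\<sigma> \<in> borel_measurable borel" unfolding \<sigma>_def by measurable
      have "(LINT x|\<nu>. indicator A x *\<^sub>R \<sigma> x) = (LINT x|M. norm (s x) *\<^sub>R (indicator A x *\<^sub>R \<sigma> x))"
        unfolding \<nu>_def by (subst integral_density) auto
      also have "\<dots> = (LINT x|M. indicator A x *\<^sub>R s x)"
        by (intro Bochner_Integration.integral_cong) (auto simp: \<sigma>_def)
      finally show ?thesis using \<mu>s[OF A] by simp
    qed
  qed (use s\<nu> \<nu>v in auto)
qed

text \<open>Vector measures are set functions of which only the values on Borel sets are known. This
  and the next two lemmas show that variation, Jordan parts and pairing depend on nothing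
  else.\<close>

lemma variation_cong:
  "(\<And>A. A \<in> sets borel \<Longrightarrow> \<mu> A = \<mu>' A) \<Longrightarrow> variation \<mu> = variation \<mu>'"
  unfolding variation_def by (intro ext SUP_cong suminf_cong) (auto simp: image_subset_iff)

lemma jordan_pos_cong:
  "(\<And>A. A \<in> sets borel \<Longrightarrow> m A = m' A) \<Longrightarrow> jordan_pos m = jordan_pos m'"
proof -
  assume "\<And>A. A \<in> sets borel \<Longrightarrow> m A = m' A"
  then have "(\<lambda>A. SUP B \<in> {B \<in> sets borel. B \<subseteq> A}. ennreal (m B)) =
      (\<lambda>A. SUP B \<in> {B \<in> sets borel. B \<subseteq> A}. ennreal (m' B))"
    by (intro ext SUP_cong) auto
  then show ?thesis by (simp add: jordan_pos_def)
qed

lemma pairing_cong: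
  assumes "\<And>A. A \<in> sets borel \<Longrightarrow> \<mu> A = \<mu>' A"
  shows "pairing \<mu> = pairing \<mu>'"
proof -
  have "jordan_pos (\<lambda>A. \<mu> A $ i) = jordan_pos (\<lambda>A. \<mu>' A $ i)"
    "jordan_pos (\<lambda>A. - (\<mu> A $ i)) = jordan_pos (\<lambda>A. - (\<mu>' A $ i))" for i
    by (rule jordan_pos_cong; simp add: assms)+
  then show ?thesis by (simp add: pairing_def[abs_def] signed_integral_def)
qed

lemma integrable_indicator_scaleR:
  fixes f :: "'a::topological_space \<Rightarrow> 'b::{banach, second_countable_topology}"
  assumes "sets M = sets borel" "integrable M f" "A \<in> sets borel"
  shows "integrable M (\<lambda>x. indicator A x *\<^sub>R f x)"
  by (rule integrable_bounded_scaleR[OF assms(1,2), of _ 1]) (use assms(3) in \<open>auto simp: indicator_def\<close>)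

lemma integral_indicator_sums:
  fixes f :: "'a::topological_space \<Rightarrow> 'b::{banach, second_countable_topology}"
  assumes M: "sets M = sets borel" "integrable M f"
    and E: "\<And>i::nat. E i \<in> sets borel" "disjoint_family E"
  shows "(\<lambda>i. \<integral>x. indicator (E i) x *\<^sub>R f x \<partial>M) sums (\<integral>x. indicator (\<Union>i. E i) x *\<^sub>R f x \<partial>M)"
proof -
  have [measurable]: "E i \<in> sets M" for i using M E by simp
  have [measurable]: "f \<in> borel_measurable M" using M by simp
  have ind: "(\<Sum>i<n. indicator (E i) x :: real) = indicator (\<Union>i<n. E i) x" for n x
    using E(2) by (intro indicator_UN_disjoint[symmetric]) (auto simp: disjoint_family_on_def)
  have "(\<lambda>n. \<integral>x. indicator (\<Union>i<n. E i) x *\<^sub>R f x \<partial>M) \<longlonglongrightarrow> (\<integral>x. indicator (\<Union>i. E i) x *\<^sub>R f x \<partial>M)"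
  proof (rule integral_dominated_convergence)
    show "integrable M (\<lambda>x. norm (f x))" using M by simp
    show "AE x in M. (\<lambda>n. indicator (\<Union>i<n. E i) x *\<^sub>R f x) \<longlonglongrightarrow> indicator (\<Union>i. E i) x *\<^sub>R f x"
      by (intro always_eventually allI tendsto_intros LIMSEQ_indicator_UN)
  qed (auto simp: indicator_def)
  moreover have "(\<integral>x. indicator (\<Union>i<n. E i) x *\<^sub>R f x \<partial>M) = (\<Sum>i<n. \<integral>x. indicator (E i) x *\<^sub>R f x \<partial>M)" for n
    unfolding ind[symmetric] scaleR_sum_left
    by (intro Bochner_Integration.integral_sum integrable_indicator_scaleR M E)
  ultimately show ?thesis by (simp add: sums_def)
qed

text \<open>
  All derivative measures that occur are of the form \<open>a d\<nu> + b dx\<close>, where \<open>\<nu>\<close> stems from the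
  given function \<open>u\<close>.
\<close>

definition two_measure ::
    "(real^'n) measure \<Rightarrow> (real^'n \<Rightarrow> real^'n) \<Rightarrow> (real^'n \<Rightarrow> real^'n) \<Rightarrow> (real^'n) set \<Rightarrow> real^'n"
  where "two_measure \<nu> a b A =
    (LINT x|\<nu>. indicator A x *\<^sub>R a x) + (LINT x|lborel. indicator A x *\<^sub>R b x)"

lemma norm_integral_indicator_le:
  fixes f :: "'a::topological_space \<Rightarrow> 'b::{banach, second_countable_topology}"
  assumes "sets M = sets borel" "integrable M f" "A \<in> sets borel"
  shows "ennreal (norm (\<integral>x. indicator A x *\<^sub>R f x \<partial>M)) \<le> (\<integral>\<^sup>+x. ennreal (norm (f x)) * indicator A x \<partial>M)"
proof -
  have "ennreal (norm (\<integral>x. indicator A x *\<^sub>R f x \<partial>M)) \<le> (\<integral>\<^sup>+x. ennreal (norm (indicator A x *\<^sub>R f x)) \<partial>M)"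
    by (rule integral_norm_bound_ennreal) (intro integrable_indicator_scaleR assms)
  also have "\<dots> = (\<integral>\<^sup>+x. ennreal (norm (f x)) * indicator A x \<partial>M)"
    by (intro nn_integral_cong) (auto simp: indicator_def)
  finally show ?thesis .
qed

lemma variation_two_measure_le:
  fixes \<nu> :: "(real^'n) measure"
  assumes \<nu>: "sets \<nu> = sets borel" and a: "integrable \<nu> a" and b: "integrable lborel b"
  shows "variation (two_measure \<nu> a b) A \<le>
    (\<integral>\<^sup>+x. ennreal (norm (a x)) * indicator A x \<partial>\<nu>) + (\<integral>\<^sup>+x. ennreal (norm (b x)) * indicator A x \<partial>lborel)"
  unfolding variation_def
proof (rule SUP_least)
  fix E :: "nat \<Rightarrow> (real^'n) set"
  assume "E \<in> {E. range E \<subseteq> sets borel \<and> disjoint_family E \<and> (\<Union>i. E i) = A}"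
  then have E: "range E \<subseteq> sets borel" "disjoint_family E" "A = (\<Union>i. E i)" by auto
  have Ei: "E i \<in> sets borel" for i using E by auto
  have *: "(\<Sum>i. \<integral>\<^sup>+x. ennreal (norm (f x)) * indicator (E i) x \<partial>M) =
      (\<integral>\<^sup>+x. ennreal (norm (f x)) * indicator (\<Union>i. E i) x \<partial>M)"
    if M: "sets M = sets borel" "integrable M f" for M and f :: "real^'n \<Rightarrow> real^'n"
  proof -
    have [measurable]: "f \<in> borel_measurable M" using M by simp
    have "(\<Sum>i. emeasure (density M (\<lambda>x. ennreal (norm (f x)))) (E i)) =
        emeasure (density M (\<lambda>x. ennreal (norm (f x)))) (\<Union>i. E i)"
      using E M by (intro suminf_emeasure) auto
    then show ?thesis
      using Ei M sets.countable_UN[of E UNIV M] by (simp add: emeasure_density image_subset_iff)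
  qed
  have "(\<Sum>i. ennreal (norm (two_measure \<nu> a b (E i)))) \<le>
      (\<Sum>i. (\<integral>\<^sup>+x. ennreal (norm (a x)) * indicator (E i) x \<partial>\<nu>) + (\<integral>\<^sup>+x. ennreal (norm (b x)) * indicator (E i) x \<partial>lborel))"
  proof (intro suminf_le summableI)
    fix i
    have "ennreal (norm (two_measure \<nu> a b (E i))) \<le>
        ennreal (norm (LINT x|\<nu>. indicator (E i) x *\<^sub>R a x)) + ennreal (norm (LINT x|lborel. indicator (E i) x *\<^sub>R b x))"
      unfolding two_measure_def by (simp flip: ennreal_plus add: norm_triangle_ineq ennreal_leI)
    also have "\<dots> \<le> (\<integral>\<^sup>+x. ennreal (norm (a x)) * indicator (E i) x \<partial>\<nu>) + (\<integral>\<^sup>+x. ennreal (norm (b x)) * indicator (E i) x \<partial>lborel)"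
      by (intro add_mono norm_integral_indicator_le \<nu> a b Ei sets_lborel)
    finally show "ennreal (norm (two_measure \<nu> a b (E i))) \<le> \<dots>" .
  qed
  also have "\<dots> = (\<Sum>i. (\<integral>\<^sup>+x. ennreal (norm (a x)) * indicator (E i) x \<partial>\<nu>)) + (\<Sum>i. (\<integral>\<^sup>+x. ennreal (norm (b x)) * indicator (E i) x \<partial>lborel))"
    by (rule suminf_add[symmetric]) auto
  also have "\<dots> = (\<integral>\<^sup>+x. ennreal (norm (a x)) * indicator A x \<partial>\<nu>) + (\<integral>\<^sup>+x. ennreal (norm (b x)) * indicator A x \<partial>lborel)"
    using *[OF \<nu> a] *[OF sets_lborel b] E(3) by simp
  finally show "(\<Sum>i. ennreal (norm (two_measure \<nu> a b (E i)))) \<le> \<dots>" .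
qed

lemma vector_measure_two_measure:
  fixes \<nu> :: "(real^'n) measure"
  assumes \<nu>: "sets \<nu> = sets borel" and a: "integrable \<nu> a" and b: "integrable lborel b"
  shows "vector_measure (two_measure \<nu> a b)"
  unfolding vector_measure_def
proof (intro conjI allI impI)
  fix E :: "nat \<Rightarrow> (real^'n) set" assume "range E \<subseteq> sets borel" "disjoint_family E"
  then show "(\<lambda>i. two_measure \<nu> a b (E i)) sums two_measure \<nu> a b (\<Union>i. E i)"
    unfolding two_measure_def by (intro sums_add integral_indicator_sums \<nu> a b) auto
next
  have "(\<integral>\<^sup>+x. ennreal (norm (a x)) \<partial>\<nu>) < \<infinity>" "(\<integral>\<^sup>+x. ennreal (norm (b x)) \<partial>lborel) < \<infinity>"
    using a b by (auto simp: integrable_iff_bounded)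
  then show "variation (two_measure \<nu> a b) UNIV < \<infinity>"
    using variation_two_measure_le[OF assms, of UNIV] by (auto simp: less_top[symmetric] top_unique)
qed

text \<open>The bridge from the componentwise signed integrals in \<open>pairing\<close> to ordinary
  vector integrals, for every bounded Borel field and not only for test fields; the field produced
  by \<open>S_op\<close> is only known to be of this kind.\<close>

lemma pairing_two_measure:
  fixes \<nu> :: "(real^'n) measure"
  assumes \<nu>: "sets \<nu> = sets borel" and a: "integrable \<nu> a" and b: "integrable lborel b"
    and g: "g \<in> borel_measurable borel" "\<And>x. norm (g x) \<le> B"
  shows "pairing (two_measure \<nu> a b) g = (LINT x|\<nu>. g x \<bullet> a x) + (LINT x|lborel. g x \<bullet> b x)"
proof -
  have gi: "(\<lambda>x. g x $ i) \<in> borel_measurable borel" "\<bar>g x $ i\<bar> \<le> B" for i x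
    using g(1) borel_measurable_continuous_onI[OF continuous_on_component[OF continuous_on_id]]
    by (auto intro: measurable_compose order_trans[OF component_le_norm_cart g(2)])
  have int: "integrable M (\<lambda>x. f x $ i)" if "integrable M f" for M :: "(real^'n) measure" and f :: "real^'n \<Rightarrow> real^'n" and i
    by (rule integrable_bounded_linear[OF bounded_linear_vec_nth that])
  have "signed_integral (\<lambda>A. two_measure \<nu> a b A $ i) (\<lambda>x. g x $ i) =
      (LINT x|\<nu>. g x $ i * a x $ i) + (LINT x|lborel. g x $ i * b x $ i)" for i
  proof (rule signed_integral_eq)
    show "bounded_signed (\<lambda>A. two_measure \<nu> a b A $ i)"
      by (rule bounded_signed_component[OF vector_measure_two_measure[OF \<nu> a b]])
    fix A :: "(real^'n) set" assume A: "A \<in> sets borel"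
    have *: "(LINT x|M. indicator A x *\<^sub>R f x) $ i = (LINT x|M. indicator A x * f x $ i)"
      if "sets M = sets borel" "integrable M f" for M :: "(real^'n) measure" and f :: "real^'n \<Rightarrow> real^'n"
      using integral_bounded_linear[OF bounded_linear_vec_nth integrable_indicator_scaleR[OF that A], of i] by simp
    show "two_measure \<nu> a b A $ i = (LINT x|\<nu>. indicator A x * a x $ i) + (LINT x|lborel. indicator A x * b x $ i)"
      using *[OF \<nu> a] *[OF _ b] by (simp add: two_measure_def)
  qed (use \<nu> a b int gi in auto)
  moreover have "(LINT x|M. g x \<bullet> f x) = (\<Sum>i\<in>UNIV. LINT x|M. g x $ i * f x $ i)"
    if "sets M = sets borel" "integrable M f" for M :: "(real^'n) measure" and f :: "real^'n \<Rightarrow> real^'n"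
    unfolding inner_vec_def inner_real_def
    using integrable_bounded_scaleR[OF that(1) int[OF that(2)] gi]
    by (intro Bochner_Integration.integral_sum) auto
  ultimately show ?thesis
    using \<nu> a b by (simp add: pairing_def sum.distrib)
qed

section \<open>Mollification\<close>

text \<open>The convolution of the vector measure a dN with \<psi>, as a function. For N =
  \<open>lborel\<close> it is the usual convolution of functions, for N = \<nu> it is the
  mollification of the singular part of a derivative.\<close>

definition conv :: "(real^'n \<Rightarrow> real) \<Rightarrow> (real^'n) measure \<Rightarrow> (real^'n \<Rightarrow> 'b::euclidean_space) \<Rightarrow> real^'n \<Rightarrow> 'b"
  where "conv \<psi> N a x = (LINT y|N. \<psi> (x - y) *\<^sub>R a y)"

lemma lborel_reflect: "(lborel :: 'a::euclidean_space measure) = distr lborel borel (\<lambda>y. x - y)"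
  by (subst lborel_affine[of "-1" x]) (simp_all add: density_1)

lemma integral_reflect:
  fixes f :: "'a::euclidean_space \<Rightarrow> 'b::{banach, second_countable_topology}"
  assumes [measurable]: "f \<in> borel_measurable borel"
  shows "(LINT y|lborel. f (x - y)) = (LINT y|lborel. f y)"
  by (subst (2) lborel_reflect[of x], subst integral_distr) auto

lemma integrable_reflect:
  fixes f :: "'a::euclidean_space \<Rightarrow> 'b::{banach, second_countable_topology}"
  assumes "integrable lborel f"
  shows "integrable lborel (\<lambda>y. f (x - y))"
proof -
  have [measurable]: "f \<in> borel_measurable borel" using assms by simp
  have "integrable (distr lborel borel (\<lambda>y. x - y)) f"
    using assms by (simp flip: lborel_reflect)
  then show ?thesis by (subst (asm) integrable_distr_eq) auto
qed

lemma integrable_borel_measurable: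
  "sets N = sets borel \<Longrightarrow> integrable N f \<Longrightarrow> f \<in> borel_measurable borel"
  using borel_measurable_integrable[of N f] measurable_cong_sets[of N borel borel borel] by simp

text \<open>Of radial symmetry only evenness is kept: it makes convolution a self-adjoint
  operation.\<close>

locale kernel =
  fixes \<psi> :: "real^'n \<Rightarrow> real" and \<epsilon> :: real
  assumes smooth: "Cc_infinity \<psi>"
    and nonneg: "\<And>x. 0 \<le> \<psi> x"
    and even: "\<And>x. \<psi> (- x) = \<psi> x"
    and integral_1: "(LINT x|lborel. \<psi> x) = 1"
    and support: "\<And>x. \<psi> x \<noteq> 0 \<Longrightarrow> norm x \<le> \<epsilon>"
begin

lemma cont: "continuous_on UNIV \<psi>"
  using smooth by (rule Cc_infinity_continuous)

lemma meas[measurable]: "\<psi> \<in> borel_measurable borel"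
  by (rule borel_measurable_continuous_onI[OF cont])

lemma bounded_kernel: obtains B where "B > 0" "\<And>x. \<bar>\<psi> x\<bar> \<le> B"
  using compact_supp_bounded[OF cont Cc_infinity_compact[OF smooth]] by auto

lemma integrable_kernel: "integrable lborel \<psi>"
  by (rule compact_supp_integrable[OF cont Cc_infinity_compact[OF smooth]])

lemma even': "\<psi> (x - y) = \<psi> (y - x)"
  using even[of "x - y"] by simp

lemma nn_integral_1: "(\<integral>\<^sup>+y. ennreal (\<psi> y) \<partial>lborel) = 1"
  using nn_integral_eq_integral[OF integrable_kernel] nonneg integral_1 by simp

lemma nn_integral_shift_1: "(\<integral>\<^sup>+x. ennreal (\<psi> (x + s)) \<partial>lborel) = 1"
  using nn_integral_translate[of "\<lambda>x. ennreal (\<psi> x)" s] nn_integral_1 by simp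

lemma integral_reflect_1: "(LINT y|lborel. \<psi> (x - y)) = 1"
  using integral_reflect[of \<psi> x] integral_1 by simp

lemma integrable_conv:
  fixes a :: "real^'n \<Rightarrow> 'b::euclidean_space"
  assumes "sets N = sets borel" "integrable N a"
  shows "integrable N (\<lambda>y. \<psi> (x - y) *\<^sub>R a y)"
proof -
  obtain B where "B > 0" "\<And>x. \<bar>\<psi> x\<bar> \<le> B" using bounded_kernel by blast
  then show ?thesis by (intro integrable_bounded_scaleR[OF assms, of _ B]) auto
qed

lemma integrable_conv_bounded:
  fixes \<rho> :: "real^'n \<Rightarrow> 'b::euclidean_space"
  assumes [measurable]: "\<rho> \<in> borel_measurable borel" and B: "\<And>x. norm (\<rho> x) \<le> B"
  shows "integrable lborel (\<lambda>y. \<psi> (x - y) *\<^sub>R \<rho> y)"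
proof (rule Bochner_Integration.integrable_bound)
  show "integrable lborel (\<lambda>y. \<psi> (x - y) * B)"
    using integrable_reflect[OF integrable_kernel] by simp
  show "AE y in lborel. norm (\<psi> (x - y) *\<^sub>R \<rho> y) \<le> norm (\<psi> (x - y) * B)"
    using B nonneg order_trans[OF norm_ge_zero B] by (auto simp: abs_mult intro!: always_eventually mult_left_mono)
qed measurable

lemma borel_measurable_conv:
  fixes a :: "real^'n \<Rightarrow> 'b::euclidean_space"
  assumes "sigma_finite_measure N" and [measurable_cong]: "sets N = sets borel"
    and [measurable]: "a \<in> borel_measurable borel"
  shows "conv \<psi> N a \<in> borel_measurable borel"
proof -
  interpret sigma_finite_measure N by fact
  show ?thesis unfolding conv_def by measurable
qed

text \<open>A localised form of Young's inequality: by Fubini, the mass of the convolution seen in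
  the window A + s comes from points within \<epsilon> of that window. The shift \<open>s\<close> is
  there for translations along a segment.\<close>

lemma nn_integral_conv_le:
  fixes a :: "real^'n \<Rightarrow> 'b::euclidean_space"
  assumes sf: "sigma_finite_measure N" and N[measurable_cong]: "sets N = sets borel"
    and a: "integrable N a" and [measurable]: "A \<in> sets borel" "V \<in> sets borel"
    and AV: "\<And>x y. x \<in> A \<Longrightarrow> norm (y - (x + s)) \<le> \<epsilon> \<Longrightarrow> y \<in> V"
  shows "(\<integral>\<^sup>+x. ennreal (norm (conv \<psi> N a (x + s))) * indicator A x \<partial>lborel) \<le>
    (\<integral>\<^sup>+y. ennreal (norm (a y)) * indicator V y \<partial>N)"
proof -
  interpret N: sigma_finite_measure N by fact
  interpret pair_sigma_finite N "lborel :: (real^'n) measure" ..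
  have [measurable]: "a \<in> borel_measurable borel"
    by (rule integrable_borel_measurable[OF N a])
  have "(\<integral>\<^sup>+x. ennreal (norm (conv \<psi> N a (x + s))) * indicator A x \<partial>lborel) \<le>
      (\<integral>\<^sup>+x. (\<integral>\<^sup>+y. ennreal (\<psi> (x + s - y) * norm (a y)) * indicator A x \<partial>N) \<partial>lborel)"
  proof (rule nn_integral_mono)
    fix x
    have "ennreal (norm (conv \<psi> N a (x + s))) \<le> (\<integral>\<^sup>+y. ennreal (norm (\<psi> (x + s - y) *\<^sub>R a y)) \<partial>N)"
      unfolding conv_def by (rule integral_norm_bound_ennreal[OF integrable_conv[OF N a]])
    then show "ennreal (norm (conv \<psi> N a (x + s))) * indicator A x \<le>
        (\<integral>\<^sup>+y. ennreal (\<psi> (x + s - y) * norm (a y)) * indicator A x \<partial>N)"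
      using nonneg by (simp add: indicator_def)
  qed
  also have "\<dots> = (\<integral>\<^sup>+y. (\<integral>\<^sup>+x. ennreal (\<psi> (x + s - y) * norm (a y)) * indicator A x \<partial>lborel) \<partial>N)"
    by (rule Fubini') measurable
  also have "\<dots> \<le> (\<integral>\<^sup>+y. ennreal (norm (a y)) * indicator V y \<partial>N)"
  proof (rule nn_integral_mono)
    fix y
    have "(\<integral>\<^sup>+x. ennreal (\<psi> (x + s - y) * norm (a y)) * indicator A x \<partial>lborel) \<le>
        (\<integral>\<^sup>+x. (ennreal (norm (a y)) * indicator V y) * ennreal (\<psi> (x + (s - y))) \<partial>lborel)"
    proof (rule nn_integral_mono)
      fix x
      show "ennreal (\<psi> (x + s - y) * norm (a y)) * indicator A x \<le>
          (ennreal (norm (a y)) * indicator V y) * ennreal (\<psi> (x + (s - y)))"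
      proof (cases "x \<in> A \<and> \<psi> (x + s - y) \<noteq> 0")
        case True
        then have "norm (y - (x + s)) \<le> \<epsilon>" using support norm_minus_commute by metis
        then have "y \<in> V" using AV True by blast
        then show ?thesis using True nonneg
          by (simp add: ennreal_mult mult.commute add_diff_eq)
      qed auto
    qed
    also have "\<dots> = ennreal (norm (a y)) * indicator V y"
      by (subst nn_integral_cmult) (simp_all add: nn_integral_shift_1)
    finally show "(\<integral>\<^sup>+x. ennreal (\<psi> (x + s - y) * norm (a y)) * indicator A x \<partial>lborel) \<le>
        ennreal (norm (a y)) * indicator V y" .
  qed
  finally show ?thesis .
qed

lemma
  fixes a :: "real^'n \<Rightarrow> 'b::euclidean_space"
  assumes sf: "sigma_finite_measure N" and N[measurable_cong]: "sets N = sets borel"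
    and a: "integrable N a"
  shows nn_integral_conv_le_UNIV:
      "(\<integral>\<^sup>+x. ennreal (norm (conv \<psi> N a x)) \<partial>lborel) \<le> (\<integral>\<^sup>+y. ennreal (norm (a y)) \<partial>N)"
    and integrable_conv_lborel: "integrable lborel (conv \<psi> N a)"
proof -
  show *: "(\<integral>\<^sup>+x. ennreal (norm (conv \<psi> N a x)) \<partial>lborel) \<le> (\<integral>\<^sup>+y. ennreal (norm (a y)) \<partial>N)"
    using nn_integral_conv_le[OF sf N a, of UNIV UNIV 0] by simp
  have [measurable]: "a \<in> borel_measurable borel"
    by (rule integrable_borel_measurable[OF N a])
  show "integrable lborel (conv \<psi> N a)"
    using * a borel_measurable_conv[OF sf N \<open>a \<in> borel_measurable borel\<close>] by (auto simp: integrable_iff_bounded intro: le_less_trans)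
qed

lemma norm_conv_bounded:
  fixes \<rho> :: "real^'n \<Rightarrow> 'b::euclidean_space"
  assumes "\<rho> \<in> borel_measurable borel" and B: "\<And>x. norm (\<rho> x) \<le> B"
  shows "norm (conv \<psi> lborel \<rho> x) \<le> B"
proof -
  have "norm (conv \<psi> lborel \<rho> x) \<le> (LINT y|lborel. norm (\<psi> (x - y) *\<^sub>R \<rho> y))"
    unfolding conv_def by (rule integral_norm_bound)
  also have "\<dots> \<le> (LINT y|lborel. \<psi> (x - y) * B)"
    using integrable_norm[OF integrable_conv_bounded[OF assms, of x]] integrable_reflect[OF integrable_kernel] nonneg B
    by (intro integral_mono) (auto intro: mult_left_mono)
  also have "\<dots> = B" by (simp add: integral_reflect_1)
  finally show ?thesis .
qed

lemma norm_conv_diff_le: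
  fixes \<rho> :: "real^'n \<Rightarrow> 'b::euclidean_space"
  assumes int: "integrable lborel (\<lambda>y. \<psi> (x - y) *\<^sub>R \<rho> y)"
    and e: "\<And>y. norm (y - x) \<le> \<epsilon> \<Longrightarrow> norm (\<rho> y - \<rho> x) \<le> e"
  shows "norm (conv \<psi> lborel \<rho> x - \<rho> x) \<le> e"
proof -
  have ik: "integrable lborel (\<lambda>y. \<psi> (x - y) *\<^sub>R \<rho> x)"
    using integrable_reflect[OF integrable_kernel] by simp
  have "conv \<psi> lborel \<rho> x - \<rho> x = (LINT y|lborel. \<psi> (x - y) *\<^sub>R \<rho> y) - (LINT y|lborel. \<psi> (x - y) *\<^sub>R \<rho> x)"
    using integrable_reflect[OF integrable_kernel] by (simp add: conv_def integral_reflect_1)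
  also have "\<dots> = (LINT y|lborel. \<psi> (x - y) *\<^sub>R (\<rho> y - \<rho> x))"
    using Bochner_Integration.integral_diff[OF int ik] by (simp add: scaleR_diff_right)
  finally have eq: "conv \<psi> lborel \<rho> x - \<rho> x = (LINT y|lborel. \<psi> (x - y) *\<^sub>R (\<rho> y - \<rho> x))" .
  have "norm (LINT y|lborel. \<psi> (x - y) *\<^sub>R (\<rho> y - \<rho> x)) \<le> (LINT y|lborel. norm (\<psi> (x - y) *\<^sub>R (\<rho> y - \<rho> x)))"
    by (rule integral_norm_bound)
  also have "\<dots> \<le> (LINT y|lborel. \<psi> (x - y) * e)"
  proof (rule integral_mono)
    show "integrable lborel (\<lambda>y. norm (\<psi> (x - y) *\<^sub>R (\<rho> y - \<rho> x)))"
      using Bochner_Integration.integrable_diff[OF int ik] by (intro integrable_norm) (simp add: scaleR_diff_right)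
    show "integrable lborel (\<lambda>y. \<psi> (x - y) * e)"
      using integrable_reflect[OF integrable_kernel] by simp
    show "norm (\<psi> (x - y) *\<^sub>R (\<rho> y - \<rho> x)) \<le> \<psi> (x - y) * e" for y
    proof (cases "\<psi> (x - y) = 0")
      case False
      then have "norm (y - x) \<le> \<epsilon>" using support norm_minus_commute by metis
      then show ?thesis using e nonneg by (auto intro!: mult_left_mono)
    qed simp
  qed
  also have "\<dots> = e" by (simp add: integral_reflect_1)
  finally show ?thesis by (simp add: eq)
qed

text \<open>Fubini and the symmetry of \<psi>(x - y). Absolute integrability of the double integral
  holds because \<rho> is bounded, \<open>a\<close> is integrable and \<psi> has mass one.\<close>

lemma integral_inner_conv:
  fixes a :: "real^'n \<Rightarrow> 'b::euclidean_space"
  assumes sf: "sigma_finite_measure N" and N[measurable_cong]: "sets N = sets borel"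
    and a: "integrable N a" and \<rho>[measurable]: "\<rho> \<in> borel_measurable borel" and B: "\<And>x. norm (\<rho> x) \<le> B"
  shows "(LINT x|lborel. \<rho> x \<bullet> conv \<psi> N a x) = (LINT y|N. conv \<psi> lborel \<rho> y \<bullet> a y)"
proof -
  interpret N: sigma_finite_measure N by fact
  interpret pair_sigma_finite N "lborel :: (real^'n) measure" ..
  have [measurable]: "a \<in> borel_measurable borel"
    by (rule integrable_borel_measurable[OF N a])
  have B0: "0 \<le> B" using order_trans[OF norm_ge_zero B] .
  let ?f = "\<lambda>y x. \<psi> (x - y) * (\<rho> x \<bullet> a y)"
  have int: "integrable (N \<Otimes>\<^sub>M lborel) (case_prod ?f)"
    unfolding integrable_iff_bounded
  proof
    show m: "case_prod ?f \<in> borel_measurable (N \<Otimes>\<^sub>M lborel)" by measurable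
    have "(\<integral>\<^sup>+p. ennreal (norm (case_prod ?f p)) \<partial>(N \<Otimes>\<^sub>M lborel)) =
        (\<integral>\<^sup>+y. (\<integral>\<^sup>+x. ennreal (norm (?f y x)) \<partial>lborel) \<partial>N)"
      by (subst lborel.nn_integral_fst[symmetric]) auto
    also have "\<dots> \<le> (\<integral>\<^sup>+y. (\<integral>\<^sup>+x. ennreal (B * norm (a y)) * ennreal (\<psi> (x + (- y))) \<partial>lborel) \<partial>N)"
    proof (intro nn_integral_mono)
      fix x y
      have "\<bar>\<rho> x \<bullet> a y\<bar> \<le> B * norm (a y)"
        by (rule order_trans[OF Cauchy_Schwarz_ineq2 mult_right_mono[OF B norm_ge_zero]])
      then have "norm (?f y x) \<le> (B * norm (a y)) * \<psi> (x + (- y))"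
        using nonneg[of "x - y"] mult_left_mono[of "\<bar>\<rho> x \<bullet> a y\<bar>" "B * norm (a y)" "\<psi> (x - y)"]
        by (simp add: abs_mult mult.commute)
      then show "ennreal (norm (?f y x)) \<le> ennreal (B * norm (a y)) * ennreal (\<psi> (x + (- y)))"
        using B0 nonneg by (subst ennreal_mult[symmetric]) (auto intro: ennreal_leI)
    qed
    also have "\<dots> = (\<integral>\<^sup>+y. ennreal (B * norm (a y)) \<partial>N)"
      by (intro nn_integral_cong, subst nn_integral_cmult) (simp_all add: nn_integral_shift_1 del: add_uminus_conv_diff)
    also have "\<dots> < \<infinity>"
    proof -
      have "integrable N (\<lambda>y. B * norm (a y))" using a by simp
      then have "(\<integral>\<^sup>+y. ennreal (norm (B * norm (a y))) \<partial>N) < \<infinity>"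
        unfolding integrable_iff_bounded by blast
      then show ?thesis using B0 by (simp only: real_norm_def abs_mult abs_of_nonneg abs_norm_cancel)
    qed
    finally show "(\<integral>\<^sup>+p. ennreal (norm (case_prod ?f p)) \<partial>(N \<Otimes>\<^sub>M lborel)) < \<infinity>" .
  qed
  have "(LINT x|lborel. \<rho> x \<bullet> conv \<psi> N a x) = (LINT x|lborel. (LINT y|N. ?f y x))"
  proof (intro Bochner_Integration.integral_cong refl)
    fix x
    have "\<rho> x \<bullet> conv \<psi> N a x = (LINT y|N. \<rho> x \<bullet> (\<psi> (x - y) *\<^sub>R a y))"
      unfolding conv_def by (rule integral_inner_right[symmetric]) (rule integrable_conv[OF N a])
    then show "\<rho> x \<bullet> conv \<psi> N a x = (LINT y|N. ?f y x)" by simp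
  qed
  also have "\<dots> = (LINT y|N. (LINT x|lborel. ?f y x))"
    by (rule Fubini_integral[OF int])
  also have "\<dots> = (LINT y|N. conv \<psi> lborel \<rho> y \<bullet> a y)"
  proof (intro Bochner_Integration.integral_cong refl)
    fix y
    have "conv \<psi> lborel \<rho> y \<bullet> a y = (LINT x|lborel. (\<psi> (y - x) *\<^sub>R \<rho> x) \<bullet> a y)"
      unfolding conv_def by (rule integral_inner_left[symmetric]) (rule integrable_conv_bounded[OF \<rho> B])
    then show "(LINT x|lborel. ?f y x) = conv \<psi> lborel \<rho> y \<bullet> a y" by (simp add: even'[of y])
  qed
  finally show ?thesis .
qed

end

section \<open>Scaled mollifiers and approximation in L^1\<close>

lemma integral_lebesgue_lborel:
  fixes f :: "'a::euclidean_space \<Rightarrow> 'b::{banach, second_countable_topology}"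
  shows "f \<in> borel_measurable borel \<Longrightarrow> (LINT x|lebesgue. f x) = (LINT x|lborel. f x)"
  by (rule integral_completion) simp

lemma kernel_mollifier_scaled:
  fixes \<phi> :: "real^'n \<Rightarrow> real"
  assumes \<phi>: "mollifier \<phi>" and \<epsilon>: "\<epsilon> > 0"
  shows "kernel (mollifier_scaled \<phi> \<epsilon>) \<epsilon>"
proof
  let ?\<psi> = "mollifier_scaled \<phi> \<epsilon>"
  have \<phi>': "C_infinity \<phi>" "\<And>x. \<phi> x \<ge> 0" "\<And>x y. norm x = norm y \<Longrightarrow> \<phi> x = \<phi> y"
    "supp \<phi> \<subseteq> cball 0 1" "(LINT x|lebesgue. \<phi> x) = 1"
    using \<phi> unfolding mollifier_def by blast+
  have "compact (supp \<phi>)"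
    using \<phi>'(4) by (rule compact_closed_subset[OF compact_cball closed_supp])
  then have cc: "Cc_infinity \<phi>" using \<phi>'(1) by (simp add: Cc_infinity_def)
  have [measurable]: "\<phi> \<in> borel_measurable borel"
    by (intro borel_measurable_continuous_onI Cc_infinity_continuous cc)
  have "Cc_infinity (\<lambda>x. inverse (\<epsilon> ^ CARD('n)) * \<phi> (0 + inverse \<epsilon> *\<^sub>R x))"
    by (intro Cc_infinity_linear[OF bounded_linear_mult_right] Cc_infinity_affine cc) (use \<epsilon> in auto)
  then show "Cc_infinity ?\<psi>" by (simp add: mollifier_scaled_def[abs_def])
  show "0 \<le> ?\<psi> x" for x using \<epsilon> \<phi>'(2) by (simp add: mollifier_scaled_def)
  show "?\<psi> (- x) = ?\<psi> x" for x
    using \<phi>'(3)[of "inverse \<epsilon> *\<^sub>R (- x)" "inverse \<epsilon> *\<^sub>R x"] by (simp add: mollifier_scaled_def)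
  show "norm x \<le> \<epsilon>" if "?\<psi> x \<noteq> 0" for x
  proof -
    have "\<phi> (inverse \<epsilon> *\<^sub>R x) \<noteq> 0" using that by (auto simp: mollifier_scaled_def)
    then have "inverse \<epsilon> *\<^sub>R x \<in> cball 0 1" using \<phi>'(4) not_in_supp by blast
    then show ?thesis using \<epsilon> by (simp add: field_simps)
  qed
  have "(LINT x|lborel. ?\<psi> x) = (LINT x|lborel. \<bar>\<epsilon>\<bar> ^ CARD('n) * ?\<psi> (0 + \<epsilon> *\<^sub>R x))"
    using \<epsilon>
    by (subst lborel_affine[of \<epsilon> 0])
      (simp_all add: integral_density integral_distr mollifier_scaled_def[abs_def] ennreal_power)
  also have "\<dots> = (LINT x|lborel. \<phi> x)"
    using \<epsilon> by (intro Bochner_Integration.integral_cong) (auto simp: mollifier_scaled_def)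
  also have "\<dots> = 1" using \<phi>'(5) by (simp add: integral_lebesgue_lborel)
  finally show "(LINT x|lborel. ?\<psi> x) = 1" .
qed

text \<open>For an indicator, a Urysohn function between a closed subset C and an open superset W of
  A errs only on W - A and A - C, which regularity of Lebesgue measure makes small. Induction over
  integrable functions does the rest.\<close>

lemma L1_density:
  fixes u :: "'a::euclidean_space \<Rightarrow> real"
  assumes "integrable lborel u" "e > 0"
  shows "\<exists>g. continuous_on UNIV g \<and> integrable lborel g \<and> (LINT x|lborel. \<bar>u x - g x\<bar>) < e"
  using assms
proof (induction u arbitrary: e rule: integrable_induct)
  case (base A c)
  have A: "A \<in> sets borel" using base by simp
  \<comment> \<open>The two small sets cost at most 2 |c| d = e - 2 d, which is below e; the summand
    1 covers c = 0.\<close>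
  define d where "d = e / (2 * (\<bar>c\<bar> + 1))"
  have d: "d > 0" using base by (simp add: d_def)
  obtain W where W: "open W" "A \<subseteq> W" "W - A \<in> lmeasurable" "emeasure lebesgue (W - A) < ennreal d"
    using sets_lebesgue_outer_open[of A d] A d by auto
  obtain C where C: "closed C" "C \<subseteq> A" "A - C \<in> lmeasurable" "emeasure lebesgue (A - C) < ennreal d"
    using sets_lebesgue_inner_closed[of A d] A d by auto
  obtain f :: "'a \<Rightarrow> real" where f: "continuous_on UNIV f" "\<And>x. f x \<in> closed_segment 1 0"
    "\<And>x. x \<in> C \<Longrightarrow> f x = 1" "\<And>x. x \<in> - W \<Longrightarrow> f x = 0"
    using Urysohn[of C "- W" 1 0] C W by auto
  have f01: "0 \<le> f x" "f x \<le> 1" for x using f(2)[of x] by (auto simp: closed_segment_eq_real_ivl)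
  have [measurable]: "f \<in> borel_measurable borel" "A \<in> sets borel" "W \<in> sets borel" "C \<in> sets borel"
    using A W C borel_measurable_continuous_onI[OF f(1)] by auto
  have e1: "emeasure lborel (W - A) < ennreal d" "emeasure lborel (A - C) < ennreal d"
    using W(4) C(4) by auto
  have iW: "integrable lborel (indicator (W - A) :: 'a \<Rightarrow> real)" "integrable lborel (indicator (A - C) :: 'a \<Rightarrow> real)"
    using e1 by (auto intro!: integrable_real_indicator less_trans[OF _ ennreal_less_top])
  have iA: "integrable lborel (indicator A :: 'a \<Rightarrow> real)"
    using base by (intro integrable_real_indicator) auto
  have bd: "\<bar>indicator A x - f x\<bar> \<le> indicator (W - A) x + indicator (A - C) x" for x
    using f01[of x] f(3,4)[of x] C(2) W(2) by (auto simp: indicator_def)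
  have dif: "integrable lborel (\<lambda>x. indicator A x - f x)"
    by (rule Bochner_Integration.integrable_bound[OF Bochner_Integration.integrable_add[OF iW]])
      (use bd in \<open>auto intro!: always_eventually order_trans[OF bd abs_ge_self]\<close>)
  have fi: "integrable lborel f"
    using Bochner_Integration.integrable_diff[OF iA dif] by simp
  have "(LINT x|lborel. \<bar>indicator A x *\<^sub>R c - c * f x\<bar>) = \<bar>c\<bar> * (LINT x|lborel. \<bar>indicator A x - f x\<bar>)"
    by (subst integral_mult_right_zero[symmetric]) (simp add: abs_mult[symmetric] right_diff_distrib mult.commute)
  also have "\<dots> \<le> \<bar>c\<bar> * (LINT x|lborel. indicator (W - A) x + indicator (A - C) x)"
    using dif iW bd by (intro mult_left_mono integral_mono) auto
  also have "\<dots> \<le> \<bar>c\<bar> * (d + d)"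
  proof (intro mult_left_mono)
    have "measure lborel (W - A) \<le> d" "measure lborel (A - C) \<le> d"
      using e1 d by (auto simp: measure_def intro!: enn2real_leI)
    then show "(LINT x|lborel. indicator (W - A) x + indicator (A - C) x) \<le> d + d"
      using iW by simp
  qed simp
  also have "\<dots> < e"
  proof -
    have "\<bar>c\<bar> + 1 > 0" by (rule add_nonneg_pos) auto
    then have "2 * (\<bar>c\<bar> + 1) \<noteq> 0" by simp
    then have "d * (2 * (\<bar>c\<bar> + 1)) = e" using d_def nonzero_eq_divide_eq by blast
    then show ?thesis using d by (simp add: algebra_simps)
  qed
  finally show ?case using f fi by (intro exI[of _ "\<lambda>x. c * f x"]) (auto intro!: continuous_intros)
next
  case (add f g)
  obtain f' g' where f': "continuous_on UNIV f'" "integrable lborel f'" "(LINT x|lborel. \<bar>f x - f' x\<bar>) < e/2"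
    and g': "continuous_on UNIV g'" "integrable lborel g'" "(LINT x|lborel. \<bar>g x - g' x\<bar>) < e/2"
    using add.IH(1)[of "e/2"] add.IH(2)[of "e/2"] add.prems by auto
  have "(LINT x|lborel. \<bar>f x + g x - (f' x + g' x)\<bar>) \<le> (LINT x|lborel. \<bar>f x - f' x\<bar> + \<bar>g x - g' x\<bar>)"
    using f' g' add.hyps by (intro integral_mono) auto
  also have "\<dots> < e" using f' g' add.hyps by simp
  finally show ?case using f' g'
    by (intro exI[of _ "\<lambda>x. f' x + g' x"]) (auto intro!: continuous_intros)
next
  case (lim f s)
  have [measurable]: "f \<in> borel_measurable borel" "s i \<in> borel_measurable borel" for i
    using lim.hyps by (auto dest!: borel_measurable_integrable)
  have "(\<lambda>i. LINT x|lborel. \<bar>f x - s i x\<bar>) \<longlonglongrightarrow> (LINT x|(lborel :: 'a measure). 0)"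
  proof (rule integral_dominated_convergence)
    show "integrable lborel (\<lambda>x. 3 * \<bar>f x\<bar>)" using lim.hyps by simp
    show "AE x in lborel. (\<lambda>i. \<bar>f x - s i x\<bar>) \<longlonglongrightarrow> 0"
    proof (intro always_eventually allI)
      fix x
      have "(\<lambda>i. \<bar>f x - s i x\<bar>) \<longlonglongrightarrow> \<bar>f x - f x\<bar>"
        by (intro tendsto_intros lim.hyps(2)) simp
      then show "(\<lambda>i. \<bar>f x - s i x\<bar>) \<longlonglongrightarrow> 0" by simp
    qed
    show "AE x in lborel. norm \<bar>f x - s i x\<bar> \<le> 3 * \<bar>f x\<bar>" for i
    proof (intro always_eventually allI)
      fix x
      show "norm \<bar>f x - s i x\<bar> \<le> 3 * \<bar>f x\<bar>" using lim.hyps(3)[of x i] by auto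
    qed
  qed auto
  then have "\<forall>\<^sub>F i in sequentially. (LINT x|lborel. \<bar>f x - s i x\<bar>) < e / 2"
    using lim.prems by (auto dest!: order_tendstoD(2)[of _ _ _ "e/2"])
  then obtain i where i: "(LINT x|lborel. \<bar>f x - s i x\<bar>) < e / 2"
    by (auto simp: eventually_sequentially)
  obtain g where g: "continuous_on UNIV g" "integrable lborel g" "(LINT x|lborel. \<bar>s i x - g x\<bar>) < e/2"
    using lim.IH[of "e/2" i] lim.prems by auto
  have "(LINT x|lborel. \<bar>f x - g x\<bar>) \<le> (LINT x|lborel. \<bar>f x - s i x\<bar> + \<bar>s i x - g x\<bar>)"
    using g lim.hyps by (intro integral_mono) auto
  also have "\<dots> < e" using i g lim.hyps by simp
  finally show ?case using g by blast
qed

text \<open>The threshold is uniform over all kernels of small support. Replacing u by a continuous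
  g costs e/3 twice, since convolution does not increase L^1 norms; the last third comes from
  uniform continuity of g on the ball of radius R + 1, which contains all points within \<delta> of
  the ball of radius R as \<delta> is at most 1.\<close>

lemma mollification_L1:
  fixes u :: "real^'n \<Rightarrow> real"
  assumes u: "integrable lborel u" and e: "e > 0"
  obtains \<delta> where "\<delta> > 0" "\<And>(\<psi> :: real^'n \<Rightarrow> real) \<epsilon>. kernel \<psi> \<epsilon> \<Longrightarrow> \<epsilon> \<le> \<delta> \<Longrightarrow>
    (\<integral>\<^sup>+x. ennreal \<bar>conv \<psi> lborel u x - u x\<bar> * indicator (cball 0 R) x \<partial>lborel) \<le> ennreal e"
proof -
  obtain g where g: "continuous_on UNIV g" "integrable lborel g" "(LINT x|lborel. \<bar>u x - g x\<bar>) < e/3"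
    using L1_density[OF u, of "e/3"] e by auto
  define m where "m = measure lborel (cball (0::real^'n) R)"
  have m0: "m \<ge> 0" by (simp add: m_def)
  define e' where "e' = e / (3 * (m + 1))"
  have e': "e' > 0" "e' * m \<le> e/3"
    using e m0 by (auto simp: e'_def field_simps)
  have "uniformly_continuous_on (cball 0 (R + 1)) g"
    by (rule compact_uniformly_continuous) (use g(1) continuous_on_subset in auto)
  then obtain d where d: "d > 0" "\<And>x y. x \<in> cball 0 (R + 1) \<Longrightarrow> y \<in> cball 0 (R + 1) \<Longrightarrow> dist y x < d \<Longrightarrow> dist (g y) (g x) < e'"
    using e' unfolding uniformly_continuous_on_def by metis
  define \<delta> where "\<delta> = min 1 (d / 2)"
  have [measurable]: "u \<in> borel_measurable borel" "g \<in> borel_measurable borel"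
    using u borel_measurable_continuous_onI[OF g(1)] by auto
  show ?thesis
  proof
    show "\<delta> > 0" using d by (simp add: \<delta>_def)
    fix \<psi> :: "real^'n \<Rightarrow> real" and \<epsilon> assume "kernel \<psi> \<epsilon>" and \<epsilon>: "\<epsilon> \<le> \<delta>"
    then interpret kernel \<psi> \<epsilon> by simp
    have sf: "sigma_finite_measure (lborel :: (real^'n) measure)" ..
    have [measurable]: "cball (0 :: real^'n) R \<in> sets borel" by simp
    have [measurable]: "conv \<psi> lborel (\<lambda>x. u x - g x) \<in> borel_measurable borel"
      by (rule borel_measurable_conv[OF sf]) simp_all
    have [measurable]: "conv \<psi> lborel u \<in> borel_measurable borel"
      by (rule borel_measurable_conv[OF sf]) simp_all
    have bd: "\<bar>conv \<psi> lborel u x - u x\<bar> \<le> \<bar>conv \<psi> lborel (\<lambda>x. u x - g x) x\<bar> + e' + \<bar>u x - g x\<bar>"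
      if x: "x \<in> cball 0 R" for x
    proof -
      have "conv \<psi> lborel (\<lambda>x. u x - g x) x = conv \<psi> lborel u x - conv \<psi> lborel g x"
        unfolding conv_def scaleR_diff_right
        by (intro Bochner_Integration.integral_diff integrable_conv u g sets_lborel)
      moreover have "norm (conv \<psi> lborel g x - g x) \<le> e'"
      proof (rule norm_conv_diff_le)
        show "integrable lborel (\<lambda>y. \<psi> (x - y) *\<^sub>R g y)" by (intro integrable_conv g sets_lborel)
        fix y assume y: "norm (y - x) \<le> \<epsilon>"
        then have "norm y \<le> norm x + 1" using \<epsilon> norm_triangle_ineq2[of y x] by (simp add: \<delta>_def)
        moreover have "dist y x < d" using y \<epsilon> d by (simp add: \<delta>_def dist_norm)
        ultimately have "dist (g y) (g x) < e'" using x by (intro d) auto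
        then show "norm (g y - g x) \<le> e'" by (simp add: dist_norm)
      qed
      ultimately show ?thesis by (simp only: real_norm_def)
    qed
    have "(\<integral>\<^sup>+x. ennreal \<bar>conv \<psi> lborel u x - u x\<bar> * indicator (cball 0 R) x \<partial>lborel) \<le>
      (\<integral>\<^sup>+x. ennreal (norm (conv \<psi> lborel (\<lambda>x. u x - g x) x)) + ennreal e' * indicator (cball 0 R) x + ennreal \<bar>u x - g x\<bar> \<partial>lborel)"
    proof (rule nn_integral_mono)
      fix x
      show "ennreal \<bar>conv \<psi> lborel u x - u x\<bar> * indicator (cball 0 R) x \<le>
        ennreal (norm (conv \<psi> lborel (\<lambda>x. u x - g x) x)) + ennreal e' * indicator (cball 0 R) x + ennreal \<bar>u x - g x\<bar>"
        using bd[of x] e' by (cases "x \<in> cball 0 R") (auto simp flip: ennreal_plus intro!: ennreal_leI)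
    qed
    also have "\<dots> = (\<integral>\<^sup>+x. ennreal (norm (conv \<psi> lborel (\<lambda>x. u x - g x) x)) \<partial>lborel) + ennreal e' * emeasure lborel (cball (0::real^'n) R)
        + (\<integral>\<^sup>+x. ennreal \<bar>u x - g x\<bar> \<partial>lborel)"
      by (simp add: nn_integral_add nn_integral_cmult_indicator)
    also have "\<dots> \<le> ennreal (e/3) + ennreal (e/3) + ennreal (e/3)"
    proof (intro add_mono)
      have ug: "integrable lborel (\<lambda>x. u x - g x)" using u g by simp
      have *: "(\<integral>\<^sup>+x. ennreal (norm (u x - g x)) \<partial>lborel) \<le> ennreal (e/3)"
        using g(3) ug by (subst nn_integral_eq_integral) (auto intro!: ennreal_leI)
      then show "(\<integral>\<^sup>+x. ennreal \<bar>u x - g x\<bar> \<partial>lborel) \<le> ennreal (e/3)" by simp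
      show "(\<integral>\<^sup>+x. ennreal (norm (conv \<psi> lborel (\<lambda>x. u x - g x) x)) \<partial>lborel) \<le> ennreal (e/3)"
        by (rule order_trans[OF nn_integral_conv_le_UNIV[OF sf _ ug] *]) simp
      have "emeasure lborel (cball (0::real^'n) R) = ennreal m"
        unfolding m_def using emeasure_lborel_cball_finite[of "0 :: real^'n" R] by (intro emeasure_eq_ennreal_measure) simp
      then show "ennreal e' * emeasure lborel (cball (0::real^'n) R) \<le> ennreal (e/3)"
        using e' m0 by (simp flip: ennreal_mult add: ennreal_leI)
    qed
    also have "\<dots> = ennreal e" using e by (simp flip: ennreal_plus)
    finally show "(\<integral>\<^sup>+x. ennreal \<bar>conv \<psi> lborel u x - u x\<bar> * indicator (cball 0 R) x \<partial>lborel) \<le> ennreal e" .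
  qed
qed

text \<open>Testing a weak derivative with the field \<psi>(x - \<cdot>) q produces the directional
  derivative of the convolution at x in direction q; this is its divergence.\<close>

lemma divergence_reflect:
  fixes f :: "real^'n \<Rightarrow> real"
  assumes "\<And>x. f differentiable (at x)"
  shows "divergence (\<lambda>y. f (x - y) *\<^sub>R q) y = - (gradient f (x - y) \<bullet> q)"
proof -
  have d: "(\<lambda>y. f (x + (- 1) *\<^sub>R y)) differentiable (at y)" for y
    using has_derivative_compose_affine[OF assms] by (rule differentiableI)
  have "partial_deriv i (\<lambda>y. (f (x - y) *\<^sub>R q) $ i) y = - (partial_deriv i f (x - y) * q $ i)" for i
    using partial_deriv_linear[OF bounded_linear_mult_left[of "q $ i"] d, of i y]
      partial_deriv_affine[OF assms, of i x "-1" y] by simp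
  then show ?thesis by (simp add: divergence_def gradient_def inner_vec_def sum_negf)
qed

section \<open>Translation and Poincare estimates\<close>

text \<open>A function of bounded variation with Du = \<sigma> d\<nu>. As |\<sigma>| is only bounded
  by 1, \<nu> dominates |Du|, and all estimates are stated with \<nu>.\<close>

locale bv_pair =
  fixes u :: "real^'n \<Rightarrow> real" and \<nu> :: "(real^'n) measure" and \<sigma> :: "real^'n \<Rightarrow> real^'n"
  assumes integrable_u: "integrable lborel u"
    and finite_\<nu>: "finite_measure \<nu>" and sets_\<nu>: "sets \<nu> = sets borel"
    and meas_\<sigma>: "\<sigma> \<in> borel_measurable borel" and norm_\<sigma>: "\<And>x. norm (\<sigma> x) \<le> 1"
    and weak: "\<And>g. Cc_infinity g \<Longrightarrow>
      (LINT x|lborel. u x * divergence g x) = - (LINT x|\<nu>. g x \<bullet> \<sigma> x)"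
begin

interpretation \<nu>: finite_measure \<nu> by (rule finite_\<nu>)

lemma meas_u[measurable]: "u \<in> borel_measurable borel"
  using integrable_u by simp

lemma sf_\<nu>: "sigma_finite_measure \<nu>" ..

lemma integrable_\<sigma>: "integrable \<nu> \<sigma>"
proof (rule \<nu>.integrable_const_bound)
  show "\<sigma> \<in> borel_measurable \<nu>" using meas_\<sigma> measurable_cong_sets[OF sets_\<nu> refl] by blast
qed (use norm_\<sigma> in auto)

text \<open>Testing with \<psi>(x - \<cdot>) q identifies q \<bullet> (\<psi> * Du)(x) with the
  integral of u against the directional derivative of \<psi>. What is left is the Taylor remainder
  of \<psi> integrated against u, so the mollified function itself is never differentiated.\<close>

lemma mollified_taylor:
  assumes "kernel \<psi> \<epsilon>"
    and C: "\<And>x q. \<bar>\<psi> (x + q) - \<psi> x - gradient \<psi> x \<bullet> q\<bar> \<le> C * (norm q)\<^sup>2"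
  shows "\<bar>conv \<psi> lborel u (x + q) - conv \<psi> lborel u x - q \<bullet> conv \<psi> \<nu> \<sigma> x\<bar> \<le>
    C * (norm q)\<^sup>2 * (LINT y|lborel. \<bar>u y\<bar>)"
proof -
  interpret kernel \<psi> \<epsilon> by fact
  let ?G = "\<lambda>y. gradient \<psi> (x - y) \<bullet> q"
  have "Cc_infinity (\<lambda>y. \<psi> (x + (- 1) *\<^sub>R y) *\<^sub>R q)"
    by (intro Cc_infinity_scaleR Cc_infinity_affine smooth C_infinity_const) simp
  then have "(LINT y|lborel. u y * divergence (\<lambda>y. \<psi> (x - y) *\<^sub>R q) y) = - (LINT y|\<nu>. (\<psi> (x - y) *\<^sub>R q) \<bullet> \<sigma> y)"
    using weak[of "\<lambda>y. \<psi> (x + (- 1) *\<^sub>R y) *\<^sub>R q"] by simp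
  then have "(LINT y|lborel. u y * ?G y) = (LINT y|\<nu>. q \<bullet> (\<psi> (x - y) *\<^sub>R \<sigma> y))"
    by (simp add: divergence_reflect Cc_infinity_differentiable[OF smooth])
  also have "\<dots> = q \<bullet> conv \<psi> \<nu> \<sigma> x"
    unfolding conv_def by (rule integral_inner_right) (rule integrable_conv[OF sets_\<nu> integrable_\<sigma>])
  finally have eq: "(LINT y|lborel. u y * ?G y) = q \<bullet> conv \<psi> \<nu> \<sigma> x" .
  have cg: "continuous_on UNIV (gradient \<psi>)"
    using smooth by (intro continuous_on_gradient) (simp add: Cc_infinity_def)
  obtain B where B: "\<And>x. norm (gradient \<psi> x) \<le> B"
    using compact_supp_bounded[OF cg compact_supp_gradient[OF Cc_infinity_compact[OF smooth]]] by blast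
  have Gm: "?G \<in> borel_measurable borel"
    using cg by (intro borel_measurable_continuous_onI continuous_intros continuous_on_compose2[OF cg]) auto
  have Gb: "\<bar>?G y\<bar> \<le> B * norm q" for y
    by (rule order_trans[OF Cauchy_Schwarz_ineq2 mult_right_mono[OF B norm_ge_zero]])
  have i1: "integrable lborel (\<lambda>y. u y * ?G y)"
    using integrable_bounded_scaleR[OF sets_lborel integrable_u Gm Gb] by (simp add: mult.commute)
  have i2: "integrable lborel (\<lambda>y. \<psi> (x + q - y) *\<^sub>R u y)" "integrable lborel (\<lambda>y. \<psi> (x - y) *\<^sub>R u y)"
    by (intro integrable_conv integrable_u sets_lborel)+
  have "conv \<psi> lborel u (x + q) - conv \<psi> lborel u x - q \<bullet> conv \<psi> \<nu> \<sigma> x =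
      (LINT y|lborel. (\<psi> (x - y + q) - \<psi> (x - y) - ?G y) * u y)"
  proof -
    have "(LINT y|lborel. (\<psi> (x - y + q) - \<psi> (x - y) - ?G y) * u y) =
        (LINT y|lborel. (\<psi> (x + q - y) *\<^sub>R u y - \<psi> (x - y) *\<^sub>R u y) - u y * ?G y)"
      by (simp add: algebra_simps)
    also have "\<dots> = conv \<psi> lborel u (x + q) - conv \<psi> lborel u x - q \<bullet> conv \<psi> \<nu> \<sigma> x"
      using Bochner_Integration.integral_diff[OF Bochner_Integration.integrable_diff[OF i2] i1]
        Bochner_Integration.integral_diff[OF i2] by (simp only: eq conv_def)
    finally show ?thesis by (rule sym)
  qed
  then have "\<bar>conv \<psi> lborel u (x + q) - conv \<psi> lborel u x - q \<bullet> conv \<psi> \<nu> \<sigma> x\<bar> =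
      \<bar>LINT y|lborel. (\<psi> (x - y + q) - \<psi> (x - y) - ?G y) * u y\<bar>"
    by (rule arg_cong)
  also have "\<dots> \<le> (LINT y|lborel. \<bar>(\<psi> (x - y + q) - \<psi> (x - y) - ?G y) * u y\<bar>)"
    by (rule integral_abs_bound)
  also have "\<dots> \<le> (LINT y|lborel. C * (norm q)\<^sup>2 * \<bar>u y\<bar>)"
  proof (rule integral_mono)
    have "integrable lborel (\<lambda>y. (\<psi> (x - y + q) - \<psi> (x - y) - ?G y) * u y)"
      using Bochner_Integration.integrable_diff[OF Bochner_Integration.integrable_diff[OF i2] i1] by (simp add: algebra_simps)
    then show "integrable lborel (\<lambda>y. \<bar>(\<psi> (x - y + q) - \<psi> (x - y) - ?G y) * u y\<bar>)" by (rule integrable_abs)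
    show "integrable lborel (\<lambda>y. C * (norm q)\<^sup>2 * \<bar>u y\<bar>)" using integrable_u by simp
    show "\<bar>(\<psi> (x - y + q) - \<psi> (x - y) - ?G y) * u y\<bar> \<le> C * (norm q)\<^sup>2 * \<bar>u y\<bar>" for y
      unfolding abs_mult by (intro mult_right_mono C) simp
  qed
  also have "\<dots> = C * (norm q)\<^sup>2 * (LINT y|lborel. \<bar>u y\<bar>)" by simp
  finally show ?thesis .
qed

text \<open>The first order term of \<open>mollified_taylor\<close>, integrated over A, costs at
  most the step length times the mass of \<nu> near a translate of A along the segment. The set
  \<open>V\<close> is assumed to contain the \<epsilon>-neighbourhoods of all these translates, so
  every step has the same bound.\<close>

lemma mollified_translation:
  assumes k: "kernel \<psi> \<epsilon>" and A[measurable]: "A \<in> sets borel" "emeasure lborel A < \<infinity>" and V: "V \<in> sets borel"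
    and AV: "\<And>x y t. x \<in> A \<Longrightarrow> 0 \<le> t \<Longrightarrow> t \<le> 1 \<Longrightarrow> norm (y - (x + t *\<^sub>R q)) \<le> \<epsilon> \<Longrightarrow> y \<in> V"
  shows "(\<integral>\<^sup>+x. ennreal \<bar>conv \<psi> lborel u (x + q) - conv \<psi> lborel u x\<bar> * indicator A x \<partial>lborel) \<le>
    ennreal (norm q * measure \<nu> V)" (is "?I \<le> _")
proof -
  interpret kernel \<psi> \<epsilon> by fact
  obtain C where C: "C \<ge> 0" "\<And>x q. \<bar>\<psi> (x + q) - \<psi> x - gradient \<psi> x \<bullet> q\<bar> \<le> C * (norm q)\<^sup>2"
    using Cc_infinity_taylor[OF smooth] by metis
  let ?U = "conv \<psi> lborel u" and ?D = "conv \<psi> \<nu> \<sigma>"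
  define L where "L = (LINT y|lborel. \<bar>u y\<bar>)"
  have L: "L \<ge> 0" by (simp add: L_def)
  have [measurable]: "?D \<in> borel_measurable borel"
    by (rule borel_measurable_conv[OF sf_\<nu> sets_\<nu> meas_\<sigma>])
  define m where "m = measure \<nu> V"
  define \<alpha> where "\<alpha> = measure lborel A"
  have \<alpha>: "emeasure lborel A = ennreal \<alpha>"
    unfolding \<alpha>_def using A(2) by (intro emeasure_eq_ennreal_measure) auto
  have m0: "m \<ge> 0" "\<alpha> \<ge> 0" by (auto simp: m_def \<alpha>_def)
  have Dle: "(\<integral>\<^sup>+x. ennreal (norm (?D (x + t *\<^sub>R q))) * indicator A x \<partial>lborel) \<le> ennreal m"
    if "0 \<le> t" "t \<le> 1" for t
  proof -
    have "(\<integral>\<^sup>+x. ennreal (norm (?D (x + t *\<^sub>R q))) * indicator A x \<partial>lborel) \<le> (\<integral>\<^sup>+y. ennreal (norm (\<sigma> y)) * indicator V y \<partial>\<nu>)"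
      by (rule nn_integral_conv_le[OF sf_\<nu> sets_\<nu> integrable_\<sigma> A(1) V]) (use AV that in blast)
    also have "\<dots> \<le> (\<integral>\<^sup>+y. indicator V y \<partial>\<nu>)"
      using norm_\<sigma> by (intro nn_integral_mono) (auto simp: indicator_def)
    also have "\<dots> = ennreal m" using V sets_\<nu> by (simp add: m_def \<nu>.emeasure_eq_measure)
    finally show ?thesis .
  qed
  \<comment> \<open>Split the translation by \<open>q\<close> into \<open>N + 1\<close> equal steps; the second order errors sum up to \<open>O(1/N)\<close>.\<close>
  have main: "?I \<le> ennreal (norm q * m + C * (norm q)\<^sup>2 * L * \<alpha> * inverse (real (Suc N)))" for N
  proof -
    let ?n = "Suc N"
    define p where "p = inverse (real ?n) *\<^sub>R q"
    have np: "norm p = inverse (real ?n) * norm q" by (simp add: p_def)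
    define c where "c = C * (norm p)\<^sup>2 * L"
    have c0: "c \<ge> 0" using C L by (simp add: c_def)
    have step: "\<bar>?U (x + q) - ?U x\<bar> \<le> (\<Sum>k<?n. norm p * norm (?D (x + (real k * inverse (real ?n)) *\<^sub>R q)) + c)" for x
    proof -
      define f where "f k = ?U (x + real k *\<^sub>R p)" for k
      have "f ?n = ?U (x + q)" "f 0 = ?U x" by (auto simp: f_def p_def)
      then have "\<bar>?U (x + q) - ?U x\<bar> = \<bar>\<Sum>k<?n. f (Suc k) - f k\<bar>" by (simp only: sum_lessThan_telescope)
      also have "\<dots> \<le> (\<Sum>k<?n. \<bar>f (Suc k) - f k\<bar>)" by (rule sum_abs)
      also have "\<dots> \<le> (\<Sum>k<?n. norm p * norm (?D (x + (real k * inverse (real ?n)) *\<^sub>R q)) + c)"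
      proof (rule sum_mono)
        fix k
        have "\<bar>?U (x + real k *\<^sub>R p + p) - ?U (x + real k *\<^sub>R p) - p \<bullet> ?D (x + real k *\<^sub>R p)\<bar> \<le> c"
          unfolding c_def L_def by (rule mollified_taylor[OF k C(2)])
        moreover have "\<bar>p \<bullet> ?D (x + real k *\<^sub>R p)\<bar> \<le> norm p * norm (?D (x + real k *\<^sub>R p))"
          by (rule Cauchy_Schwarz_ineq2)
        moreover have "f (Suc k) = ?U (x + real k *\<^sub>R p + p)" by (simp add: f_def algebra_simps)
        moreover have "real k *\<^sub>R p = (real k * inverse (real ?n)) *\<^sub>R q" by (simp add: p_def)
        ultimately show "\<bar>f (Suc k) - f k\<bar> \<le> norm p * norm (?D (x + (real k * inverse (real ?n)) *\<^sub>R q)) + c"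
          unfolding f_def by (auto simp only:)
      qed
      finally show ?thesis .
    qed
    have "?I \<le> (\<integral>\<^sup>+x. (\<Sum>k<?n. ennreal (norm p) * (ennreal (norm (?D (x + (real k * inverse (real ?n)) *\<^sub>R q))) * indicator A x)
        + ennreal c * indicator A x) \<partial>lborel)"
    proof (rule nn_integral_mono)
      fix x
      show "ennreal \<bar>?U (x + q) - ?U x\<bar> * indicator A x \<le>
        (\<Sum>k<?n. ennreal (norm p) * (ennreal (norm (?D (x + (real k * inverse (real ?n)) *\<^sub>R q))) * indicator A x) + ennreal c * indicator A x)"
      proof (cases "x \<in> A")
        case True
        have "(\<Sum>k<?n. ennreal (norm p) * ennreal (norm (?D (x + (real k * inverse (real ?n)) *\<^sub>R q))) + ennreal c) =
          ennreal (\<Sum>k<?n. norm p * norm (?D (x + (real k * inverse (real ?n)) *\<^sub>R q)) + c)"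
          using c0 by (subst sum_ennreal[symmetric]) (auto simp: ennreal_mult ennreal_plus intro!: sum.cong)
        then show ?thesis using True ennreal_leI[OF step[of x]] by (simp only: indicator_simps mult_1_right)
      qed simp
    qed
    also have "\<dots> = (\<Sum>k<?n. ennreal (norm p) * (\<integral>\<^sup>+x. ennreal (norm (?D (x + (real k * inverse (real ?n)) *\<^sub>R q))) * indicator A x \<partial>lborel) + ennreal c * ennreal \<alpha>)"
      by (subst nn_integral_sum, measurable, intro sum.cong refl, subst nn_integral_add, measurable,
          subst nn_integral_cmult, measurable) (simp add: nn_integral_cmult_indicator \<alpha>)
    also have "\<dots> \<le> (\<Sum>k<?n. ennreal (norm p) * ennreal m + ennreal c * ennreal \<alpha>)"
    proof (intro sum_mono add_mono mult_left_mono Dle order_refl)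
      fix k assume "k \<in> {..<?n}"
      then show "real k * inverse (real ?n) \<le> 1" by (simp add: field_simps)
    qed auto
    also have "\<dots> = (\<Sum>k<?n. ennreal (norm p * m + c * \<alpha>))"
      using c0 m0 by (simp add: ennreal_mult ennreal_plus)
    also have "\<dots> = ennreal (real ?n * (norm p * m + c * \<alpha>))"
      using c0 m0 by (subst sum_ennreal) auto
    also have "real ?n * (norm p * m + c * \<alpha>) = norm q * m + C * (norm q)\<^sup>2 * L * \<alpha> * inverse (real ?n)"
    proof -
      have i: "real ?n * inverse (real ?n) = 1" by simp
      have "real ?n * (norm p * m + c * \<alpha>) =
          (real ?n * inverse (real ?n)) * (norm q * m + C * (norm q)\<^sup>2 * L * \<alpha> * inverse (real ?n))"
        unfolding c_def np power2_eq_square by (simp only: ac_simps distrib_left)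
      then show ?thesis by (simp only: i mult_1)
    qed
    finally show ?thesis .
  qed
  have "(\<lambda>N. ennreal (norm q * m + C * (norm q)\<^sup>2 * L * \<alpha> * inverse (real (Suc N)))) \<longlonglongrightarrow>
      ennreal (norm q * m + C * (norm q)\<^sup>2 * L * \<alpha> * 0)"
    by (intro tendsto_intros tendsto_ennrealI LIMSEQ_inverse_real_of_nat)
  then have "?I \<le> ennreal (norm q * m + C * (norm q)\<^sup>2 * L * \<alpha> * 0)"
    by (rule LIMSEQ_le_const) (use main in blast)
  then show ?thesis by (simp add: m_def)
qed

text \<open>Passage to the limit in \<open>mollified_translation\<close>. The kernel must be narrow
  enough both to stay inside \<open>V\<close> and to approximate u in L^1 on a ball containing A and
  A + q.\<close>

lemma translation_estimate:
  assumes \<phi>: "mollifier (\<phi> :: real^'n \<Rightarrow> real)" and A[measurable]: "A \<in> sets borel" and A': "bounded A" and V: "V \<in> sets borel"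
    and \<delta>0: "\<delta>0 > 0"
    and AV: "\<And>x y t. x \<in> A \<Longrightarrow> 0 \<le> t \<Longrightarrow> t \<le> 1 \<Longrightarrow> norm (y - (x + t *\<^sub>R q)) \<le> \<delta>0 \<Longrightarrow> y \<in> V"
  shows "(\<integral>\<^sup>+x. ennreal \<bar>u (x + q) - u x\<bar> * indicator A x \<partial>lborel) \<le> ennreal (norm q * measure \<nu> V)"
proof (rule ennreal_le_epsilon)
  fix e :: real assume e: "e > 0"
  obtain R where R: "\<And>x. x \<in> A \<Longrightarrow> norm x \<le> R" using A' by (auto simp: bounded_iff)
  obtain \<delta> where \<delta>: "\<delta> > 0" "\<And>(\<psi> :: real^'n \<Rightarrow> real) \<epsilon>. kernel \<psi> \<epsilon> \<Longrightarrow> \<epsilon> \<le> \<delta> \<Longrightarrow>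
    (\<integral>\<^sup>+x. ennreal \<bar>conv \<psi> lborel u x - u x\<bar> * indicator (cball 0 (R + norm q)) x \<partial>lborel) \<le> ennreal (e/2)"
    using mollification_L1[OF integrable_u, of "e/2" "R + norm q"] e by auto
  define \<epsilon> where "\<epsilon> = min \<delta> \<delta>0"
  define \<psi> where "\<psi> = mollifier_scaled \<phi> \<epsilon>"
  have k: "kernel \<psi> \<epsilon>" unfolding \<psi>_def by (rule kernel_mollifier_scaled[OF \<phi>]) (use \<delta> \<delta>0 in \<open>simp add: \<epsilon>_def\<close>)
  interpret kernel \<psi> \<epsilon> by (rule k)
  let ?U = "conv \<psi> lborel u" and ?B = "cball 0 (R + norm q) :: (real^'n) set"
  have [measurable]: "?B \<in> sets borel" by simp
  have [measurable]: "?U \<in> borel_measurable borel"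
    by (rule borel_measurable_conv) (auto intro: lborel.sigma_finite_measure_axioms)
  have fin: "emeasure lborel A < \<infinity>" using A' by (rule emeasure_bounded_finite)
  have L1: "(\<integral>\<^sup>+x. ennreal \<bar>?U x - u x\<bar> * indicator ?B x \<partial>lborel) \<le> ennreal (e/2)"
    by (rule \<delta>(2)[OF k]) (simp add: \<epsilon>_def)
  have L1': "(\<integral>\<^sup>+x. ennreal \<bar>?U (x + q) - u (x + q)\<bar> * indicator ?B (x + q) \<partial>lborel) \<le> ennreal (e/2)"
    using L1 nn_integral_translate[of "\<lambda>x. ennreal \<bar>?U x - u x\<bar> * indicator ?B x" q] by simp
  have "(\<integral>\<^sup>+x. ennreal \<bar>u (x + q) - u x\<bar> * indicator A x \<partial>lborel) \<le>
      (\<integral>\<^sup>+x. ennreal \<bar>?U (x + q) - ?U x\<bar> * indicator A x + (ennreal \<bar>?U (x + q) - u (x + q)\<bar> * indicator ?B (x + q)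
        + ennreal \<bar>?U x - u x\<bar> * indicator ?B x) \<partial>lborel)"
  proof (rule nn_integral_mono)
    fix x
    show "ennreal \<bar>u (x + q) - u x\<bar> * indicator A x \<le> ennreal \<bar>?U (x + q) - ?U x\<bar> * indicator A x +
      (ennreal \<bar>?U (x + q) - u (x + q)\<bar> * indicator ?B (x + q) + ennreal \<bar>?U x - u x\<bar> * indicator ?B x)"
    proof (cases "x \<in> A")
      case True
      have "x \<in> ?B" "x + q \<in> ?B" using R[OF True] norm_triangle_ineq[of x q] by (auto intro: add_increasing2)
      moreover have "\<bar>u (x + q) - u x\<bar> \<le> \<bar>?U (x + q) - ?U x\<bar> + (\<bar>?U (x + q) - u (x + q)\<bar> + \<bar>?U x - u x\<bar>)" by simp
      ultimately show ?thesis using True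
        by (simp flip: ennreal_plus del: abs_triangle_ineq4)
    qed simp
  qed
  also have "\<dots> = (\<integral>\<^sup>+x. ennreal \<bar>?U (x + q) - ?U x\<bar> * indicator A x \<partial>lborel) +
      ((\<integral>\<^sup>+x. ennreal \<bar>?U (x + q) - u (x + q)\<bar> * indicator ?B (x + q) \<partial>lborel)
        + (\<integral>\<^sup>+x. ennreal \<bar>?U x - u x\<bar> * indicator ?B x \<partial>lborel))"
    by (simp add: nn_integral_add)
  also have "\<dots> \<le> ennreal (norm q * measure \<nu> V) + (ennreal (e/2) + ennreal (e/2))"
    by (intro add_mono mollified_translation[OF k A fin V] L1 L1') (use AV in \<open>auto simp: \<epsilon>_def\<close>)
  also have "ennreal (e/2) + ennreal (e/2) = ennreal e" using e by (simp flip: ennreal_plus)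
  finally show "(\<integral>\<^sup>+x. ennreal \<bar>u (x + q) - u x\<bar> * indicator A x \<partial>lborel) \<le> ennreal (norm q * measure \<nu> V) + ennreal e" .
qed

text \<open>With y = x + q and Fubini, the inner integral for fixed q is a translation estimate over
  those x in E with x + q in P. Convexity keeps the whole segment in P, and only differences q in H
  contribute.\<close>

lemma double_integral_estimate:
  assumes \<phi>: "mollifier (\<phi> :: real^'n \<Rightarrow> real)" and P[measurable]: "P \<in> sets borel" and P': "convex P" "bounded P"
    and E[measurable]: "E \<in> sets borel" and EP: "E \<subseteq> P" and V: "V \<in> sets borel" and \<delta>0: "\<delta>0 > 0"
    and PV: "\<And>x y. x \<in> P \<Longrightarrow> norm (y - x) \<le> \<delta>0 \<Longrightarrow> y \<in> V"
    and H[measurable]: "H \<in> sets borel" and PH: "\<And>x y. x \<in> P \<Longrightarrow> y \<in> P \<Longrightarrow> y - x \<in> H"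
    and HD: "\<And>q. q \<in> H \<Longrightarrow> norm q \<le> D"
  shows "(\<integral>\<^sup>+y. (\<integral>\<^sup>+x. ennreal \<bar>u y - u x\<bar> * indicator E x \<partial>lborel) * indicator P y \<partial>lborel) \<le>
    ennreal (D * measure \<nu> V) * emeasure lborel H"
proof -
  have "(\<integral>\<^sup>+y. (\<integral>\<^sup>+x. ennreal \<bar>u y - u x\<bar> * indicator E x \<partial>lborel) * indicator P y \<partial>lborel) =
      (\<integral>\<^sup>+y. (\<integral>\<^sup>+x. ennreal \<bar>u y - u x\<bar> * indicator E x * indicator P y \<partial>lborel) \<partial>lborel)"
    by (simp add: nn_integral_multc)
  also have "\<dots> = (\<integral>\<^sup>+x. (\<integral>\<^sup>+y. ennreal \<bar>u y - u x\<bar> * indicator E x * indicator P y \<partial>lborel) \<partial>lborel)"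
    by (rule lborel_pair.Fubini') measurable
  also have "\<dots> = (\<integral>\<^sup>+x. (\<integral>\<^sup>+q. ennreal \<bar>u (x + q) - u x\<bar> * indicator E x * indicator P (x + q) \<partial>lborel) \<partial>lborel)"
  proof (rule nn_integral_cong)
    fix x
    show "(\<integral>\<^sup>+y. ennreal \<bar>u y - u x\<bar> * indicator E x * indicator P y \<partial>lborel) =
      (\<integral>\<^sup>+q. ennreal \<bar>u (x + q) - u x\<bar> * indicator E x * indicator P (x + q) \<partial>lborel)"
      using nn_integral_translate[of "\<lambda>y. ennreal \<bar>u y - u x\<bar> * indicator E x * indicator P y" x]
      by (simp add: add.commute)
  qed
  also have "\<dots> = (\<integral>\<^sup>+q. (\<integral>\<^sup>+x. ennreal \<bar>u (x + q) - u x\<bar> * indicator E x * indicator P (x + q) \<partial>lborel) \<partial>lborel)"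
    by (rule lborel_pair.Fubini') measurable
  also have "\<dots> \<le> (\<integral>\<^sup>+q. ennreal (D * measure \<nu> V) * indicator H q \<partial>lborel)"
  proof (rule nn_integral_mono)
    fix q
    define A where "A = {x \<in> E. x + q \<in> P}"
    have [measurable]: "A \<in> sets borel" unfolding A_def by measurable
    have eq: "(\<integral>\<^sup>+x. ennreal \<bar>u (x + q) - u x\<bar> * indicator E x * indicator P (x + q) \<partial>lborel) =
        (\<integral>\<^sup>+x. ennreal \<bar>u (x + q) - u x\<bar> * indicator A x \<partial>lborel)"
      by (intro nn_integral_cong) (auto simp: A_def indicator_def)
    show "(\<integral>\<^sup>+x. ennreal \<bar>u (x + q) - u x\<bar> * indicator E x * indicator P (x + q) \<partial>lborel) \<le>
        ennreal (D * measure \<nu> V) * indicator H q"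
    proof (cases "q \<in> H")
      case True
      have "(\<integral>\<^sup>+x. ennreal \<bar>u (x + q) - u x\<bar> * indicator A x \<partial>lborel) \<le> ennreal (norm q * measure \<nu> V)"
      proof (rule translation_estimate[OF \<phi> _ _ V \<delta>0])
        show "bounded A" by (rule bounded_subset[OF P'(2)]) (use EP in \<open>auto simp: A_def\<close>)
        fix x y t assume x: "x \<in> A" and t: "(0::real) \<le> t" "t \<le> 1" and y: "norm (y - (x + t *\<^sub>R q)) \<le> \<delta>0"
        have "(1 - t) *\<^sub>R x + t *\<^sub>R (x + q) \<in> P"
          using x t EP by (intro convexD[OF P'(1)]) (auto simp: A_def)
        then have "x + t *\<^sub>R q \<in> P" by (simp add: algebra_simps)
        then show "y \<in> V" using PV y by blast
      qed simp
      also have "\<dots> \<le> ennreal (D * measure \<nu> V)"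
        by (intro ennreal_leI mult_right_mono HD True) simp
      finally show ?thesis using True by (simp add: eq)
    next
      case False
      then have "A = {}" using PH[of _ "_ + q"] EP by (force simp: A_def)
      then show ?thesis by (simp add: eq)
    qed
  qed
  also have "\<dots> = ennreal (D * measure \<nu> V) * emeasure lborel H"
    by (simp add: nn_integral_cmult_indicator)
  finally show ?thesis .
qed

text \<open>As c is the mean of u over E, |E| |u(y) - c| is at most the integral of |u(y) - u(x)|
  over x in E; integrating over y in P leads to the double integral. The freedom in E is what lets
  one statement serve for means and for vanishing on a set.\<close>

lemma poincare:
  assumes \<phi>: "mollifier (\<phi> :: real^'n \<Rightarrow> real)" and P[measurable]: "P \<in> sets borel" and P': "convex P" "bounded P"
    and E[measurable]: "E \<in> sets borel" and EP: "E \<subseteq> P" and V: "V \<in> sets borel" and \<delta>0: "\<delta>0 > 0"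
    and PV: "\<And>x y. x \<in> P \<Longrightarrow> norm (y - x) \<le> \<delta>0 \<Longrightarrow> y \<in> V"
    and H[measurable]: "H \<in> sets borel" and PH: "\<And>x y. x \<in> P \<Longrightarrow> y \<in> P \<Longrightarrow> y - x \<in> H"
    and HD: "\<And>q. q \<in> H \<Longrightarrow> norm q \<le> D"
    and c: "(LINT x|lborel. indicator E x * u x) = c * measure lborel E"
  shows "emeasure lborel E * (\<integral>\<^sup>+y. ennreal \<bar>u y - c\<bar> * indicator P y \<partial>lborel) \<le>
    ennreal (D * measure \<nu> V) * emeasure lborel H"
proof -
  have fE: "emeasure lborel E < \<infinity>" using bounded_subset[OF P'(2) EP] by (rule emeasure_bounded_finite)
  then have mE: "emeasure lborel E = ennreal (measure lborel E)"
    by (intro emeasure_eq_ennreal_measure) auto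
  have iE: "integrable lborel (\<lambda>x. indicator E x * u x)"
    using integrable_indicator_scaleR[OF sets_lborel integrable_u E] by simp
  have iE1: "integrable lborel (\<lambda>x. indicator E x * k)" for k :: real
    using integrable_real_indicator[of E lborel] fE by simp
  have "emeasure lborel E * (\<integral>\<^sup>+y. ennreal \<bar>u y - c\<bar> * indicator P y \<partial>lborel) =
      (\<integral>\<^sup>+y. ennreal (measure lborel E * \<bar>u y - c\<bar>) * indicator P y \<partial>lborel)"
    unfolding mE by (subst nn_integral_cmult[symmetric]) (simp_all add: ennreal_mult mult.assoc)
  also have "\<dots> \<le> (\<integral>\<^sup>+y. (\<integral>\<^sup>+x. ennreal \<bar>u y - u x\<bar> * indicator E x \<partial>lborel) * indicator P y \<partial>lborel)"
  proof (intro nn_integral_mono mult_right_mono)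
    fix y
    have i: "integrable lborel (\<lambda>x. indicator E x * u y - indicator E x * u x)"
      by (intro Bochner_Integration.integrable_diff iE iE1)
    have "measure lborel E * (u y - c) = (LINT x|lborel. indicator E x * u y - indicator E x * u x)"
      using Bochner_Integration.integral_diff[OF iE1[of "u y"] iE] c by (simp add: right_diff_distrib mult.commute)
    then have "measure lborel E * \<bar>u y - c\<bar> = \<bar>LINT x|lborel. indicator E x * u y - indicator E x * u x\<bar>"
      by (metis abs_mult abs_of_nonneg measure_nonneg)
    then have "ennreal (measure lborel E * \<bar>u y - c\<bar>) \<le> (\<integral>\<^sup>+x. ennreal (norm (indicator E x * u y - indicator E x * u x)) \<partial>lborel)"
      using integral_norm_bound_ennreal[OF i] by simp
    also have "\<dots> = (\<integral>\<^sup>+x. ennreal \<bar>u y - u x\<bar> * indicator E x \<partial>lborel)"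
      by (intro nn_integral_cong) (auto simp: indicator_def)
    finally show "ennreal (measure lborel E * \<bar>u y - c\<bar>) \<le> (\<integral>\<^sup>+x. ennreal \<bar>u y - u x\<bar> * indicator E x \<partial>lborel)" .
  qed simp
  also have "\<dots> \<le> ennreal (D * measure \<nu> V) * emeasure lborel H"
    by (rule double_integral_estimate) fact+
  finally show ?thesis .
qed

end

text \<open>
  Testing with \<open>\<psi>(x - \<cdot>) e\<^sub>i\<close> and integrating against \<open>g(x) dx\<close> replaces smooth test fields by
  \<open>\<psi> * g\<close> with \<open>g\<close> continuous, so that smoothness of convolutions is never needed.
\<close>

lemma deriv_measure_unique:
  fixes \<phi> :: "real^'n \<Rightarrow> real" and M1 M2 :: "(real^'n) measure" and f1 f2 :: "real^'n \<Rightarrow> real^'n"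
  assumes \<phi>: "mollifier \<phi>"
    and M1: "sigma_finite_measure M1" "sets M1 = sets borel" "integrable M1 f1"
    and M2: "sigma_finite_measure M2" "sets M2 = sets borel" "integrable M2 f2"
    and eq: "\<And>g. Cc_infinity g \<Longrightarrow> (LINT x|M1. g x \<bullet> f1 x) = (LINT x|M2. g x \<bullet> f2 x)"
    and A: "A \<in> sets borel"
  shows "(LINT x|M1. indicator A x *\<^sub>R f1 x) = (LINT x|M2. indicator A x *\<^sub>R f2 x)"
proof (rule vec_eq_iff[THEN iffD2], rule allI)
  fix i
  define M where "M k = (if k = 0 then M1 else M2)" for k :: nat
  define f where "f k = (if k = 0 then (\<lambda>x. f1 x $ i) else (\<lambda>x. - (f2 x $ i)))" for k :: nat
  have int: "integrable M1 (\<lambda>x. f1 x $ i)" "integrable M2 (\<lambda>x. f2 x $ i)"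
    by (auto intro!: integrable_bounded_linear[OF bounded_linear_vec_nth] M1 M2)
  interpret measure_combination "{0, 1::nat}" M f
    by unfold_locales (auto simp: M_def f_def M1 M2 int)
  have comb_eq: "comb g = (LINT x|M1. g x * f1 x $ i) - (LINT x|M2. g x * f2 x $ i)" for g
    unfolding comb_def by (simp add: M_def f_def)
  have "comb (indicator A) = 0"
  proof (rule comb_indicator_eq_0[OF _ A])
    fix g :: "real^'n \<Rightarrow> real" assume g: "continuous_on UNIV g" "\<And>x. \<bar>g x\<bar> \<le> 1"
    have gm: "g \<in> borel_measurable borel" by (rule borel_measurable_continuous_onI[OF g(1)])
    have gb: "norm (g x) \<le> 1" for x using g(2) by simp
    define \<psi> where "\<psi> m = mollifier_scaled \<phi> (inverse (real (Suc m)))" for m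
    have k: "kernel (\<psi> m) (inverse (real (Suc m)))" for m
      unfolding \<psi>_def by (rule kernel_mollifier_scaled[OF \<phi>]) simp
    have "comb (conv (\<psi> m) lborel g) = 0" for m
    proof -
      interpret kernel "\<psi> m" "inverse (real (Suc m))" by (rule k)
      have "conv (\<psi> m) M1 (\<lambda>x. f1 x $ i) x = conv (\<psi> m) M2 (\<lambda>x. f2 x $ i) x" for x
      proof -
        have "Cc_infinity (\<lambda>y. \<psi> m (x + (- 1) *\<^sub>R y) *\<^sub>R (axis i 1 :: real^'n))"
          by (intro Cc_infinity_scaleR Cc_infinity_affine smooth C_infinity_const) simp
        from eq[OF this] show ?thesis by (simp add: conv_def inner_axis' )
      qed
      then have "(LINT x|lborel. g x \<bullet> conv (\<psi> m) M1 (\<lambda>x. f1 x $ i) x) = (LINT x|lborel. g x \<bullet> conv (\<psi> m) M2 (\<lambda>x. f2 x $ i) x)"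
        by simp
      then show ?thesis
        using integral_inner_conv[OF M1(1,2) int(1) gm gb] integral_inner_conv[OF M2(1,2) int(2) gm gb]
        unfolding comb_eq by simp
    qed
    moreover have "(\<lambda>m. comb (conv (\<psi> m) lborel g)) \<longlonglongrightarrow> comb g"
    proof (rule comb_limit)
      show "conv (\<psi> m) lborel g \<in> borel_measurable borel" for m
        by (rule kernel.borel_measurable_conv[OF k lborel.sigma_finite_measure_axioms sets_lborel gm])
      show "\<bar>conv (\<psi> m) lborel g x\<bar> \<le> 1" for m x
        using kernel.norm_conv_bounded[OF k gm gb] by simp
      show "(\<lambda>m. conv (\<psi> m) lborel g x) \<longlonglongrightarrow> g x" for x
      proof (rule LIMSEQ_I)
        fix e :: real assume e: "e > 0"
        have "isCont g x" using g(1) by (simp add: continuous_on_eq_continuous_at)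
        then obtain d where d: "d > 0" "\<And>y. dist y x < d \<Longrightarrow> dist (g y) (g x) < e / 2"
          using e unfolding continuous_at_eps_delta by (metis half_gt_zero)
        obtain N where N: "inverse (real (Suc N)) < d" using reals_Archimedean[OF d(1)] by blast
        show "\<exists>no. \<forall>m\<ge>no. norm (conv (\<psi> m) lborel g x - g x) < e"
        proof (intro exI allI impI)
          fix m assume m: "N \<le> m"
          have "norm (conv (\<psi> m) lborel g x - g x) \<le> e / 2"
          proof (rule kernel.norm_conv_diff_le[OF k kernel.integrable_conv_bounded[OF k gm gb]])
            fix y assume "norm (y - x) \<le> inverse (real (Suc m))"
            also have "\<dots> \<le> inverse (real (Suc N))" using m by (intro le_imp_inverse_le) auto
            finally have "dist y x < d" using N by (simp add: dist_norm)
            then show "norm (g y - g x) \<le> e / 2" using d(2) by (simp add: dist_norm less_imp_le)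
          qed
          then show "norm (conv (\<psi> m) lborel g x - g x) < e" using e by simp
        qed
      qed
    qed
    ultimately show "comb g = 0" by (simp add: LIMSEQ_const_iff)
  qed
  then show "(LINT x|M1. indicator A x *\<^sub>R f1 x) $ i = (LINT x|M2. indicator A x *\<^sub>R f2 x) $ i"
    using integral_bounded_linear[OF bounded_linear_vec_nth integrable_indicator_scaleR[OF M1(2,3) A], of i]
      integral_bounded_linear[OF bounded_linear_vec_nth integrable_indicator_scaleR[OF M2(2,3) A], of i]
    unfolding comb_eq by simp
qed

section \<open>Exterior corkscrew condition\<close>

text \<open>Move from the boundary point p by r/2 against the direction e, away from the epigraph. A
  perturbation v changes the height by at most |v| and the height of the graph by at most 2 L |v|,
  so a small ball around the new point stays below the graph.\<close>

lemma lipschitz_boundary_local_corkscrew: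
  fixes \<Omega> :: "(real^'n) set"
  assumes "open \<Omega>" "lipschitz_boundary \<Omega>" "x \<in> frontier \<Omega>"
  shows "\<exists>s>0. \<exists>\<kappa>>0. \<forall>p \<in> frontier \<Omega> \<inter> ball x s. \<forall>r. 0 < r \<and> r \<le> s \<longrightarrow>
    (\<exists>q. ball q (\<kappa> * r) \<subseteq> ball p r - \<Omega>)"
proof -
  obtain s e L and \<gamma> :: "real^'n \<Rightarrow> real" where s: "s > 0" and e: "norm e = 1"
    and L: "L-lipschitz_on {y. y \<bullet> e = 0} \<gamma>"
    and chart: "\<Omega> \<inter> ball x s = {y. y \<bullet> e > \<gamma> (y - (y \<bullet> e) *\<^sub>R e)} \<inter> ball x s"
    using assms(2,3) unfolding lipschitz_boundary_def by blast
  have L0: "L \<ge> 0" by (rule lipschitz_on_nonneg[OF L])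
  have ee: "e \<bullet> e = 1" using e by (simp add: norm_eq_1)
  \<comment> \<open>Chosen so that (1 + 2 L) |v| is at most r/2 whenever |v| is below \<kappa>
    r.\<close>
  define \<kappa> where "\<kappa> = inverse (2 * (1 + 2 * L))"
  have \<kappa>: "\<kappa> > 0" "\<kappa> \<le> 1/2" "(1 + 2 * L) * \<kappa> = 1/2" using L0 by (auto simp: \<kappa>_def field_simps)
  show ?thesis
  proof (intro exI conjI ballI allI impI)
    \<comment> \<open>Half the chart radius: p is within s/2 of x and r is at most s/2, so the ball
      around p stays in the chart.\<close>
    show "s / 2 > 0" "\<kappa> > 0" using s \<kappa> by auto
    fix p r assume p: "p \<in> frontier \<Omega> \<inter> ball x (s / 2)" and r: "0 < r \<and> r \<le> s / 2"
    have "p \<notin> \<Omega>" using p assms(1) frontier_disjoint_eq[of \<Omega>] by blast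
    moreover have "p \<in> ball x s" using p s by auto
    ultimately have pg: "p \<bullet> e \<le> \<gamma> (p - (p \<bullet> e) *\<^sub>R e)" using chart by fastforce
    show "ball (p - (r / 2) *\<^sub>R e) (\<kappa> * r) \<subseteq> ball p r - \<Omega>"
    proof
      fix y assume "y \<in> ball (p - (r / 2) *\<^sub>R e) (\<kappa> * r)"
      define v where "v = y - (p - (r / 2) *\<^sub>R e)"
      have v: "norm v < \<kappa> * r" 
        using \<open>y \<in> _\<close> by (simp add: v_def dist_norm norm_minus_commute)
      have y: "y = p - (r / 2) *\<^sub>R e + v" by (simp add: v_def)
      have "norm (y - p) = norm (v - (r / 2) *\<^sub>R e)" by (simp add: y)
      also have "\<dots> \<le> norm v + norm ((r / 2) *\<^sub>R e)" by (rule norm_triangle_ineq4)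
      also have "\<dots> < \<kappa> * r + r / 2" using v r e by simp
      also have "\<dots> \<le> r" using mult_right_mono[OF \<kappa>(2), of r] r by linarith
      finally have yp: "norm (y - p) < r" .
      then have "y \<in> ball p r" by (simp add: dist_norm norm_minus_commute)
      have "norm (y - x) \<le> norm (y - p) + norm (p - x)" using norm_triangle_ineq[of "y - p" "p - x"] by simp
      also have "norm (p - x) < s / 2" using p by (simp add: dist_norm norm_minus_commute)
      finally have "y \<in> ball x s" using yp r by (simp add: dist_norm norm_minus_commute)
      have ve: "\<bar>v \<bullet> e\<bar> \<le> norm v" using Cauchy_Schwarz_ineq2[of v e] e by simp
      let ?p = "p - (p \<bullet> e) *\<^sub>R e" and ?y = "y - (y \<bullet> e) *\<^sub>R e"
      have "?y - ?p = v - (v \<bullet> e) *\<^sub>R e" by (simp add: y inner_add_left inner_diff_left ee algebra_simps)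
      also have "norm \<dots> \<le> norm v + norm ((v \<bullet> e) *\<^sub>R e)" by (rule norm_triangle_ineq4)
      also have "\<dots> \<le> 2 * norm v" using ve e by simp
      finally have "norm (?y - ?p) \<le> 2 * norm v" .
      moreover have "dist (\<gamma> ?y) (\<gamma> ?p) \<le> L * dist ?y ?p"
        by (rule lipschitz_onD[OF L]) (auto simp: inner_diff_left ee)
      ultimately have "\<bar>\<gamma> ?y - \<gamma> ?p\<bar> \<le> L * (2 * norm v)"
        using L0 by (simp add: dist_norm) (meson mult_left_mono order_trans)
      moreover have "y \<bullet> e = p \<bullet> e - r / 2 + v \<bullet> e" by (simp add: y inner_add_left inner_diff_left ee)
      moreover have "(1 + 2 * L) * norm v \<le> r / 2"
      proof -
        have "(1 + 2 * L) * norm v \<le> (1 + 2 * L) * (\<kappa> * r)" using v L0 by (intro mult_left_mono) auto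
        also have "\<dots> = r / 2" using \<kappa>(3) by (simp add: mult.assoc[symmetric])
        finally show ?thesis .
      qed
      moreover have "(1 + 2 * L) * norm v = norm v + L * (2 * norm v)" by (simp add: algebra_simps)
      ultimately have "y \<bullet> e \<le> \<gamma> ?y" using pg ve by linarith
      moreover have "y \<in> \<Omega> \<inter> ball x s \<longleftrightarrow> y \<in> {y. y \<bullet> e > \<gamma> (y - (y \<bullet> e) *\<^sub>R e)} \<inter> ball x s"
        by (simp only: chart)
      ultimately have "y \<notin> \<Omega>" using \<open>y \<in> ball x s\<close> by (simp del: mem_ball)
      then show "y \<in> ball p r - \<Omega>" using \<open>y \<in> ball p r\<close> by blast
    qed
  qed
qed

text \<open>Compactness of the frontier makes the local constants uniform up to a scale s0. For
  larger radii up to a multiple of the size of \<Omega> the ball found at scale s0 is reused, and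
  beyond that \<Omega> is too small to fill the ball.\<close>

lemma lipschitz_boundary_frontier_corkscrew:
  fixes \<Omega> :: "(real^'n) set"
  assumes "open \<Omega>" "bounded \<Omega>" "lipschitz_boundary \<Omega>"
  shows "\<exists>\<kappa>>0. \<forall>p \<in> frontier \<Omega>. \<forall>r>0. \<exists>q. ball q (\<kappa> * r) \<subseteq> ball p r - \<Omega>"
proof (cases "frontier \<Omega> = {}")
  case False
  obtain s \<kappa> where s: "\<And>x. x \<in> frontier \<Omega> \<Longrightarrow> s x > 0" and \<kappa>: "\<And>x. x \<in> frontier \<Omega> \<Longrightarrow> \<kappa> x > 0"
    and cs: "\<And>x p r. x \<in> frontier \<Omega> \<Longrightarrow> p \<in> frontier \<Omega> \<inter> ball x (s x) \<Longrightarrow> 0 < r \<Longrightarrow> r \<le> s x \<Longrightarrow>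
      \<exists>q. ball q (\<kappa> x * r) \<subseteq> ball p r - \<Omega>"
    using lipschitz_boundary_local_corkscrew[OF assms(1,3)] by metis
  have "compact (frontier \<Omega>)" using assms(2) by (rule compact_frontier_bounded)
  then obtain X where X: "X \<subseteq> frontier \<Omega>" "finite X" "frontier \<Omega> \<subseteq> (\<Union>x\<in>X. ball x (s x))"
    by (rule compactE_image[of _ "frontier \<Omega>" "\<lambda>x. ball x (s x)"]) (use s in auto)
  then have "X \<noteq> {}" using False by auto
  define s0 where "s0 = Min (s ` X)"
  define \<kappa>0 where "\<kappa>0 = Min (\<kappa> ` X)"
  have pos: "s0 > 0" "\<kappa>0 > 0" using X \<open>X \<noteq> {}\<close> s \<kappa> by (auto simp: s0_def \<kappa>0_def)
  have le: "s0 \<le> s x" "\<kappa>0 \<le> \<kappa> x" if "x \<in> X" for x using X that by (auto simp: s0_def \<kappa>0_def)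
  have small: "\<exists>q. ball q (\<kappa>0 * r) \<subseteq> ball p r - \<Omega>" if p: "p \<in> frontier \<Omega>" and r: "0 < r" "r \<le> s0" for p r
  proof -
    obtain x where x: "x \<in> X" "p \<in> ball x (s x)" using X p by blast
    obtain q where "ball q (\<kappa> x * r) \<subseteq> ball p r - \<Omega>"
      using cs[of x p r] x X p r le[of x] by auto
    moreover have "ball q (\<kappa>0 * r) \<subseteq> ball q (\<kappa> x * r)"
      using le[OF x(1)] r by (intro subset_ball mult_right_mono) auto
    ultimately show ?thesis by blast
  qed
  obtain D where D: "D > 0" "\<And>x. x \<in> closure \<Omega> \<Longrightarrow> norm x \<le> D"
    using bounded_closure[OF assms(2)] bounded_pos by metis
  \<comment> \<open>One entry per range of r: 1/4 for r above 8 D, \<kappa>0 for r up to s0, and the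
    last one in between, where \<kappa>1 r must not exceed \<kappa>0 s0.\<close>
  define \<kappa>1 where "\<kappa>1 = min (1/4) (min \<kappa>0 (\<kappa>0 * s0 / (8 * D)))"
  show ?thesis
  proof (rule exI[of _ \<kappa>1], intro conjI ballI allI impI)
    show "\<kappa>1 > 0" using pos D by (simp add: \<kappa>1_def)
    fix p and r :: real assume p: "p \<in> frontier \<Omega>" and r: "r > 0"
    have pD: "norm p \<le> D" using p D(2) by (auto simp: frontier_def)
    consider "r \<le> s0" | "s0 < r" "r \<le> 8 * D" | "8 * D < r" by linarith
    then show "\<exists>q. ball q (\<kappa>1 * r) \<subseteq> ball p r - \<Omega>"
    proof cases
      case 1
      obtain q where "ball q (\<kappa>0 * r) \<subseteq> ball p r - \<Omega>" using small[OF p r 1] by blast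
      moreover have "ball q (\<kappa>1 * r) \<subseteq> ball q (\<kappa>0 * r)"
        using r by (intro subset_ball mult_right_mono) (auto simp: \<kappa>1_def)
      ultimately show ?thesis by blast
    next
      case 2
      obtain q where q: "ball q (\<kappa>0 * s0) \<subseteq> ball p s0 - \<Omega>" using small[OF p pos(1)] by blast
      have "\<kappa>1 * r \<le> \<kappa>0 * s0 / (8 * D) * r" using r by (intro mult_right_mono) (auto simp: \<kappa>1_def)
      also have "\<dots> \<le> \<kappa>0 * s0 / (8 * D) * (8 * D)" using 2 pos D by (intro mult_left_mono) auto
      also have "\<dots> = \<kappa>0 * s0" using D by simp
      finally have "ball q (\<kappa>1 * r) \<subseteq> ball q (\<kappa>0 * s0)" by (rule subset_ball)
      moreover have "ball p s0 \<subseteq> ball p r" using 2 by (intro subset_ball) auto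
      ultimately show ?thesis using q by blast
    next
      case 3
      obtain v :: "real^'n" where v: "norm v = 1" using norm_axis_1 by blast
      have "ball (p + (r / 2) *\<^sub>R v) (\<kappa>1 * r) \<subseteq> ball p r - \<Omega>"
      proof
        fix y assume y: "y \<in> ball (p + (r / 2) *\<^sub>R v) (\<kappa>1 * r)"
        define w where "w = y - (p + (r / 2) *\<^sub>R v)"
        have w: "norm w < r / 4"
        proof -
          have "norm w < \<kappa>1 * r" using y by (simp add: w_def dist_norm norm_minus_commute)
          also have "\<dots> \<le> 1/4 * r" using r by (intro mult_right_mono) (auto simp: \<kappa>1_def)
          finally show ?thesis by simp
        qed
        have yp: "y - p = (r / 2) *\<^sub>R v + w" by (simp add: w_def)
        have "norm (y - p) \<le> r / 2 + norm w"
          unfolding yp using norm_triangle_ineq[of "(r / 2) *\<^sub>R v" w] v r by simp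
        then have "y \<in> ball p r" using w r by (simp add: dist_norm norm_minus_commute)
        have "norm (y - p) \<ge> r / 2 - norm w"
          unfolding yp using norm_diff_ineq[of "(r / 2) *\<^sub>R v" w] v r by simp
        then have "norm (y - p) > 2 * D" using w 3 by linarith
        then have "norm y > D" using norm_triangle_ineq4[of y p] pD by linarith
        then have "y \<notin> \<Omega>" using D(2)[of y] closure_subset by force
        then show "y \<in> ball p r - \<Omega>" using \<open>y \<in> ball p r\<close> by blast
      qed
      then show ?thesis by blast
    qed
  qed
qed (auto intro: exI[of _ 1])

text \<open>From boundary points to all exterior points: either the ball of radius r/2 around p
  already avoids \<Omega>, or, being connected, it meets the frontier, and the condition is used at
  such a point with radius r/2.\<close>

lemma lipschitz_boundary_corkscrew:
  fixes \<Omega> :: "(real^'n) set"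
  assumes "open \<Omega>" "bounded \<Omega>" "lipschitz_boundary \<Omega>"
  shows "\<exists>\<kappa>>0. \<forall>p r. p \<notin> \<Omega> \<longrightarrow> r > 0 \<longrightarrow> (\<exists>q. ball q (\<kappa> * r) \<subseteq> ball p r - \<Omega>)"
proof -
  obtain \<kappa> where \<kappa>: "\<kappa> > 0"
    and cs: "\<And>p r. p \<in> frontier \<Omega> \<Longrightarrow> r > 0 \<Longrightarrow> \<exists>q. ball q (\<kappa> * r) \<subseteq> ball p r - \<Omega>"
    using lipschitz_boundary_frontier_corkscrew[OF assms] by auto
  show ?thesis
  proof (rule exI[of _ "min (1/2) (\<kappa> / 2)"], intro conjI allI impI)
    show "min (1/2) (\<kappa> / 2) > 0" using \<kappa> by simp
    fix p and r :: real assume p: "p \<notin> \<Omega>" and r: "r > 0"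
    show "\<exists>q. ball q (min (1/2) (\<kappa> / 2) * r) \<subseteq> ball p r - \<Omega>"
    proof (cases "ball p (r / 2) \<inter> \<Omega> = {}")
      case True
      have "min (1/2) (\<kappa> / 2) * r \<le> 1/2 * r" using r by (intro mult_right_mono) auto
      then have "ball p (min (1/2) (\<kappa> / 2) * r) \<subseteq> ball p (r / 2)" by (intro subset_ball) simp
      moreover have "ball p (r / 2) \<subseteq> ball p r" using r by (intro subset_ball) simp
      ultimately show ?thesis using True by blast
    next
      case False
      have "ball p (r / 2) \<inter> frontier \<Omega> \<noteq> {}"
      proof (rule connected_Int_frontier)
        have "p \<in> ball p (r / 2) - \<Omega>" using p r by simp
        then show "ball p (r / 2) - \<Omega> \<noteq> {}" by blast
      qed (use False in auto)
      then obtain p' where p': "p' \<in> frontier \<Omega>" "p' \<in> ball p (r / 2)" by auto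
      obtain q where q: "ball q (\<kappa> * (r / 2)) \<subseteq> ball p' (r / 2) - \<Omega>" using cs[OF p'(1), of "r / 2"] r by auto
      have "min (1/2) (\<kappa> / 2) * r \<le> \<kappa> / 2 * r" using r by (intro mult_right_mono) auto
      then have "ball q (min (1/2) (\<kappa> / 2) * r) \<subseteq> ball q (\<kappa> * (r / 2))" by (intro subset_ball) simp
      moreover have "ball p' (r / 2) \<subseteq> ball p r"
      proof
        fix y assume "y \<in> ball p' (r / 2)"
        then show "y \<in> ball p r" using p'(2) dist_triangle[of p y p'] by simp
      qed
      ultimately show ?thesis using q by blast
    qed
  qed
qed

section \<open>Cubes: measure, diameter and enlargement\<close>

lemma cube_eq_box: "cube z r = box (z - (\<chi> i. r / 2)) (z + (\<chi> i. r / 2))"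
proof -
  have *: "\<bar>a - b\<bar> < c \<longleftrightarrow> b - c < a \<and> a < b + c" for a b c :: real by linarith
  show ?thesis unfolding set_eq_iff cube_def mem_box_cart mem_Collect_eq * by simp
qed

lemma
  shows open_cube: "open (cube z r)" and convex_cube: "convex (cube z r)"
    and bounded_cube: "bounded (cube z r)" and borel_cube[measurable]: "cube z r \<in> sets borel"
  by (simp_all add: cube_eq_box convex_box open_box)

lemma measure_cube: "r \<ge> 0 \<Longrightarrow> measure lborel (cube (z :: real^'n) r) = r ^ CARD('n)"
proof -
  assume r: "r \<ge> 0"
  have "(z + (\<chi> i. r / 2) - (z - (\<chi> i. r / 2))) \<bullet> b = r" if "b \<in> Basis" for b :: "real^'n"
    using that by (auto simp: Basis_vec_def inner_axis inner_diff_left inner_add_left)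
  moreover have "(z - (\<chi> i. r / 2)) \<bullet> b \<le> (z + (\<chi> i. r / 2)) \<bullet> b" if "b \<in> Basis" for b :: "real^'n"
    using that r by (auto simp: Basis_vec_def inner_axis inner_diff_left inner_add_left)
  ultimately show ?thesis
    unfolding cube_eq_box by (simp add: measure_lborel_box_eq)
qed

lemma emeasure_cube: "r \<ge> 0 \<Longrightarrow> emeasure lborel (cube (z :: real^'n) r) = ennreal (r ^ CARD('n))"
  using emeasure_eq_ennreal_measure[of lborel "cube z r"] emeasure_bounded_finite[OF bounded_cube, of z r] measure_cube[of r z]
  by (simp add: less_top)

lemma norm_le_of_cube: "q \<in> cube 0 r \<Longrightarrow> norm (q :: real^'n) \<le> CARD('n) * (r / 2)"
proof -
  assume "q \<in> cube 0 r"
  then have "(\<Sum>i\<in>UNIV. \<bar>q $ i\<bar>) \<le> (\<Sum>i\<in>(UNIV :: 'n set). r / 2)"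
    by (intro sum_mono) (auto simp: cube_def less_imp_le)
  then show ?thesis using norm_le_l1_cart[of q] by simp
qed

lemma cube_thicken:
  assumes "x \<in> cube z r" "norm (y - x) \<le> (s - r) / 2"
  shows "y \<in> cube z s"
  unfolding cube_def
proof (clarify)
  fix i
  have "\<bar>y $ i - x $ i\<bar> \<le> (s - r) / 2" using component_le_norm_cart[of "y - x" i] assms(2) by simp
  moreover have "\<bar>x $ i - z $ i\<bar> < r / 2" using assms(1) by (simp add: cube_def)
  moreover have "\<bar>y $ i - z $ i\<bar> \<le> \<bar>y $ i - x $ i\<bar> + \<bar>x $ i - z $ i\<bar>" by simp
  ultimately show "\<bar>y $ i - z $ i\<bar> < s / 2" unfolding diff_divide_distrib by linarith
qed

lemma cube_mono: "r \<le> s \<Longrightarrow> cube z r \<subseteq> cube z s"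
  using cube_thicken[of _ z r _ s] by (intro subsetI) auto

section \<open>Convolution as an average of translations\<close>

context kernel
begin

lemma conv_alt:
  fixes \<rho> :: "real^'n \<Rightarrow> 'b::euclidean_space"
  assumes [measurable]: "\<rho> \<in> borel_measurable borel"
  shows "conv \<psi> lborel \<rho> y = (LINT s|lborel. \<psi> s *\<^sub>R \<rho> (y + s))"
  using integral_translate[of "\<lambda>x. \<psi> (y - x) *\<^sub>R \<rho> x" y]
  by (simp add: conv_def even add.commute)

lemma integral_conv_shift:
  fixes a :: "real^'n \<Rightarrow> 'b::euclidean_space"
  assumes sf: "sigma_finite_measure N" and N[measurable_cong]: "sets N = sets borel"
    and a: "integrable N a" and \<rho>[measurable]: "\<rho> \<in> borel_measurable borel" and B: "\<And>x. norm (\<rho> x) \<le> B"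
  shows "(LINT y|N. conv \<psi> lborel \<rho> y \<bullet> a y) = (LINT s|lborel. \<psi> s * (LINT y|N. \<rho> (y + s) \<bullet> a y))"
proof -
  interpret N: sigma_finite_measure N by fact
  interpret pair_sigma_finite "lborel :: (real^'n) measure" N ..
  have [measurable]: "a \<in> borel_measurable borel"
    by (rule integrable_borel_measurable[OF N a])
  have B0: "0 \<le> B" using order_trans[OF norm_ge_zero B] .
  let ?f = "\<lambda>s y. \<psi> s * (\<rho> (y + s) \<bullet> a y)"
  have Ba: "integrable N (\<lambda>y. B * norm (a y))" using a by simp
  have fin: "(\<integral>\<^sup>+y. ennreal (B * norm (a y)) \<partial>N) < \<infinity>"
  proof -
    have "(\<integral>\<^sup>+y. ennreal (norm (B * norm (a y))) \<partial>N) < \<infinity>"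
      using Ba unfolding integrable_iff_bounded by blast
    then show ?thesis using B0 by (simp only: real_norm_def abs_mult abs_of_nonneg abs_norm_cancel)
  qed
  have int: "integrable (lborel \<Otimes>\<^sub>M N) (case_prod ?f)"
    unfolding integrable_iff_bounded
  proof
    show m: "case_prod ?f \<in> borel_measurable (lborel \<Otimes>\<^sub>M N)" by measurable
    have "(\<integral>\<^sup>+p. ennreal (norm (case_prod ?f p)) \<partial>(lborel \<Otimes>\<^sub>M N)) =
        (\<integral>\<^sup>+s. (\<integral>\<^sup>+y. ennreal (norm (?f s y)) \<partial>N) \<partial>lborel)"
      by (subst N.nn_integral_fst[symmetric]) auto
    also have "\<dots> \<le> (\<integral>\<^sup>+s. (\<integral>\<^sup>+y. ennreal (\<psi> s) * ennreal (B * norm (a y)) \<partial>N) \<partial>lborel)"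
    proof (intro nn_integral_mono)
      fix s y
      have "\<bar>\<rho> (y + s) \<bullet> a y\<bar> \<le> B * norm (a y)"
        by (rule order_trans[OF Cauchy_Schwarz_ineq2 mult_right_mono[OF B norm_ge_zero]])
      then have "norm (?f s y) \<le> \<psi> s * (B * norm (a y))"
        using nonneg[of s] by (simp add: abs_mult mult_left_mono)
      then show "ennreal (norm (?f s y)) \<le> ennreal (\<psi> s) * ennreal (B * norm (a y))"
        using B0 nonneg by (subst ennreal_mult[symmetric]) (auto intro: ennreal_leI)
    qed
    also have "\<dots> = (\<integral>\<^sup>+y. ennreal (B * norm (a y)) \<partial>N)"
      by (simp add: nn_integral_cmult nn_integral_multc nn_integral_1)
    also note fin
    finally show "(\<integral>\<^sup>+p. ennreal (norm (case_prod ?f p)) \<partial>(lborel \<Otimes>\<^sub>M N)) < \<infinity>" .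
  qed
  have "(LINT y|N. conv \<psi> lborel \<rho> y \<bullet> a y) = (LINT y|N. (LINT s|lborel. ?f s y))"
  proof (intro Bochner_Integration.integral_cong refl)
    fix y
    have i: "integrable lborel (\<lambda>s. \<psi> s *\<^sub>R \<rho> (y + s))"
      using integrable_translate[OF integrable_conv_bounded[OF \<rho> B, of y], of y] by (simp add: even add.commute)
    show "conv \<psi> lborel \<rho> y \<bullet> a y = (LINT s|lborel. ?f s y)"
      using integral_inner_left[of "a y" lborel "\<lambda>s. \<psi> s *\<^sub>R \<rho> (y + s)"] i
      by (simp add: conv_alt[OF \<rho>])
  qed
  also have "\<dots> = (LINT s|lborel. (LINT y|N. ?f s y))"
    by (rule Fubini_integral[OF int])
  finally show ?thesis by simp
qed

text \<open>Minkowski's inequality: \<psi> * F - F is the \<psi>-average of the differences F(x + q)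
  - F(x), and only |q| at most \<epsilon> carries weight.\<close>

lemma nn_integral_conv_diff_le:
  fixes F :: "real^'n \<Rightarrow> 'b::euclidean_space"
  assumes F: "integrable lborel F"
    and b: "\<And>q. norm q \<le> \<epsilon> \<Longrightarrow> (\<integral>\<^sup>+x. ennreal (norm (F (x + q) - F x)) \<partial>lborel) \<le> b"
  shows "(\<integral>\<^sup>+x. ennreal (norm (conv \<psi> lborel F x - F x)) \<partial>lborel) \<le> b"
proof -
  have [measurable]: "F \<in> borel_measurable borel" using F by simp
  have "(\<integral>\<^sup>+x. ennreal (norm (conv \<psi> lborel F x - F x)) \<partial>lborel) \<le>
      (\<integral>\<^sup>+x. (\<integral>\<^sup>+q. ennreal (\<psi> q) * ennreal (norm (F (x + q) - F x)) \<partial>lborel) \<partial>lborel)"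
  proof (rule nn_integral_mono)
    fix x
    have i1: "integrable lborel (\<lambda>s. \<psi> s *\<^sub>R F (x + s))"
      using integrable_translate[OF integrable_conv[OF sets_lborel F, of x], of x] by (simp add: even add.commute)
    have i2: "integrable lborel (\<lambda>s. \<psi> s *\<^sub>R F x)" using integrable_kernel by simp
    have i: "integrable lborel (\<lambda>s. \<psi> s *\<^sub>R (F (x + s) - F x))"
      using Bochner_Integration.integrable_diff[OF i1 i2] by (simp add: scaleR_diff_right)
    have "conv \<psi> lborel F x - F x = (LINT s|lborel. \<psi> s *\<^sub>R F (x + s)) - (LINT s|lborel. \<psi> s *\<^sub>R F x)"
      using integrable_kernel by (simp add: conv_alt integral_1)
    also have "\<dots> = (LINT s|lborel. \<psi> s *\<^sub>R (F (x + s) - F x))"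
      using Bochner_Integration.integral_diff[OF i1 i2] by (simp add: scaleR_diff_right)
    finally have "ennreal (norm (conv \<psi> lborel F x - F x)) \<le> (\<integral>\<^sup>+s. ennreal (norm (\<psi> s *\<^sub>R (F (x + s) - F x))) \<partial>lborel)"
      using integral_norm_bound_ennreal[OF i] by simp
    then show "ennreal (norm (conv \<psi> lborel F x - F x)) \<le> (\<integral>\<^sup>+q. ennreal (\<psi> q) * ennreal (norm (F (x + q) - F x)) \<partial>lborel)"
      using nonneg by (simp add: ennreal_mult)
  qed
  also have "\<dots> = (\<integral>\<^sup>+q. (\<integral>\<^sup>+x. ennreal (\<psi> q) * ennreal (norm (F (x + q) - F x)) \<partial>lborel) \<partial>lborel)"
    by (rule lborel_pair.Fubini') measurable
  also have "\<dots> \<le> (\<integral>\<^sup>+q. ennreal (\<psi> q) * b \<partial>lborel)"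
  proof (rule nn_integral_mono)
    fix q
    have "(\<integral>\<^sup>+x. ennreal (\<psi> q) * ennreal (norm (F (x + q) - F x)) \<partial>lborel) =
        ennreal (\<psi> q) * (\<integral>\<^sup>+x. ennreal (norm (F (x + q) - F x)) \<partial>lborel)"
      by (rule nn_integral_cmult) measurable
    also have "\<dots> \<le> ennreal (\<psi> q) * b"
      using b[of q] support[of q] by (cases "\<psi> q = 0") (auto intro: mult_left_mono)
    finally show "(\<integral>\<^sup>+x. ennreal (\<psi> q) * ennreal (norm (F (x + q) - F x)) \<partial>lborel) \<le> ennreal (\<psi> q) * b" .
  qed
  also have "\<dots> = b" by (simp add: nn_integral_multc nn_integral_1)
  finally show ?thesis .
qed

end

lemma divergence_continuous_bounded:
  assumes "Cc_infinity g" shows "continuous_on UNIV (divergence g)" "\<exists>B. \<forall>x. norm (divergence g x) \<le> B"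
proof -
  have ci: "Cc_infinity (partial_deriv i (\<lambda>y. g y $ i))" for i
    by (intro Cc_infinity_partial Cc_infinity_linear[OF bounded_linear_vec_nth] assms)
  then show "continuous_on UNIV (divergence g)"
    unfolding divergence_def by (intro continuous_on_sum Cc_infinity_continuous)
  have "\<exists>B. \<forall>x. norm (partial_deriv i (\<lambda>y. g y $ i) x) \<le> B" for i
    using compact_supp_bounded[OF Cc_infinity_continuous[OF ci] Cc_infinity_compact[OF ci]] by metis
  then obtain B where "\<And>i x. norm (partial_deriv i (\<lambda>y. g y $ i) x) \<le> B i" by metis
  then have "norm (divergence g x) \<le> (\<Sum>i\<in>UNIV. B i)" for x
    unfolding divergence_def by (intro order_trans[OF norm_sum] sum_mono) auto
  then show "\<exists>B. \<forall>x. norm (divergence g x) \<le> B" by blast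
qed

lemma divergence_translate:
  assumes "Cc_infinity g" shows "divergence (\<lambda>x. g (x + s)) y = divergence g (y + s)"
proof -
  have "partial_deriv i (\<lambda>x. g (x + s) $ i) y = partial_deriv i (\<lambda>x. g x $ i) (y + s)" for i
    using partial_deriv_affine[of "\<lambda>x. g x $ i" s 1 y i]
      Cc_infinity_differentiable[OF Cc_infinity_linear[OF bounded_linear_vec_nth assms]]
    by (simp add: add.commute)
  then show ?thesis by (simp add: divergence_def)
qed

section \<open>Weak derivatives\<close>

text \<open>The statement that Dv is a d\<nu> + b dx, expressed by ordinary integrals alone. It is
  stable under differences, convolution and series, and is translated into
  \<open>has_deriv_measure\<close> only at the end.\<close>

definition weak_deriv ::
    "(real^'n) measure \<Rightarrow> (real^'n \<Rightarrow> real) \<Rightarrow> (real^'n \<Rightarrow> real^'n) \<Rightarrow> (real^'n \<Rightarrow> real^'n) \<Rightarrow> bool"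
  where "weak_deriv \<nu> v a b \<longleftrightarrow> integrable lborel v \<and> integrable \<nu> a \<and> integrable lborel b \<and>
    (\<forall>g. Cc_infinity g \<longrightarrow> (LINT x|lborel. v x * divergence g x) =
      - ((LINT x|\<nu>. g x \<bullet> a x) + (LINT x|lborel. g x \<bullet> b x)))"

lemma test_field_bounded:
  fixes g :: "real^'n \<Rightarrow> 'b::euclidean_space"
  assumes "Cc_infinity g"
  obtains B where "g \<in> borel_measurable borel" "\<And>x. norm (g x) \<le> B"
  using compact_supp_bounded[OF Cc_infinity_continuous[OF assms] Cc_infinity_compact[OF assms]]
    borel_measurable_continuous_onI[OF Cc_infinity_continuous[OF assms]] by metis

lemma integrable_inner_bounded:
  fixes f :: "real^'n \<Rightarrow> 'b::euclidean_space"
  assumes M: "sets M = sets borel" and f: "integrable M f"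
    and g[measurable]: "g \<in> borel_measurable borel" and B: "\<And>x. norm (g x) \<le> B"
  shows "integrable M (\<lambda>x. g x \<bullet> f x)"
proof (rule Bochner_Integration.integrable_bound)
  show "integrable M (\<lambda>x. B * norm (f x))" using f by simp
  have [measurable_cong]: "sets M = sets borel" by fact
  have [measurable]: "f \<in> borel_measurable borel" by (rule integrable_borel_measurable[OF M f])
  show "(\<lambda>x. g x \<bullet> f x) \<in> borel_measurable M" by measurable
  have "norm (g x \<bullet> f x) \<le> norm (B * norm (f x))" for x
    using order_trans[OF Cauchy_Schwarz_ineq2 mult_right_mono[OF B norm_ge_zero]]
    by (simp add: order_trans[OF _ abs_ge_self])
  then show "AE x in M. norm (g x \<bullet> f x) \<le> norm (B * norm (f x))" by simp
qed

lemma norm_integral_inner_le: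
  fixes f :: "real^'n \<Rightarrow> 'b::euclidean_space"
  assumes M: "sets M = sets borel" and f: "integrable M f"
    and g: "g \<in> borel_measurable borel" and B: "\<And>x. norm (g x) \<le> B"
  shows "\<bar>LINT x|M. g x \<bullet> f x\<bar> \<le> B * (LINT x|M. norm (f x))"
proof -
  have "\<bar>LINT x|M. g x \<bullet> f x\<bar> \<le> (LINT x|M. \<bar>g x \<bullet> f x\<bar>)" by (rule integral_abs_bound)
  also have "\<dots> \<le> (LINT x|M. B * norm (f x))"
    using integrable_inner_bounded[OF assms] f
      order_trans[OF Cauchy_Schwarz_ineq2 mult_right_mono[OF B norm_ge_zero]]
    by (intro integral_mono) auto
  finally show ?thesis by simp
qed

text \<open>Convolution moves the whole derivative, including its \<nu>-part, into the Lebesgue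
  density. The proof averages the weak identity for the translated test fields g(\<cdot> +
  s).\<close>

lemma (in kernel) weak_deriv_conv:
  fixes \<nu> :: "(real^'n) measure"
  assumes \<nu>: "sigma_finite_measure \<nu>" "sets \<nu> = sets borel" and v: "weak_deriv \<nu> v a b"
  shows "weak_deriv \<nu> (conv \<psi> lborel v) (\<lambda>x. 0) (\<lambda>x. conv \<psi> \<nu> a x + conv \<psi> lborel b x)"
  unfolding weak_deriv_def
proof (intro conjI allI impI)
  note l = lborel.sigma_finite_measure_axioms sets_lborel
  have vab: "integrable lborel v" "integrable \<nu> a" "integrable lborel b" using v by (auto simp: weak_deriv_def)
  have iconv: "integrable lborel (conv \<psi> \<nu> a)" "integrable lborel (conv \<psi> lborel b)"
    by (rule integrable_conv_lborel[OF \<nu> vab(2)], rule integrable_conv_lborel[OF l vab(3)])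
  show "integrable lborel (conv \<psi> lborel v)" by (rule integrable_conv_lborel[OF l vab(1)])
  show "integrable lborel (\<lambda>x. conv \<psi> \<nu> a x + conv \<psi> lborel b x)" using iconv by simp
  fix g :: "real^'n \<Rightarrow> real^'n" assume g: "Cc_infinity g"
  obtain B where B: "g \<in> borel_measurable borel" "\<And>x. norm (g x) \<le> B" using test_field_bounded[OF g] by blast
  obtain B' where B': "divergence g \<in> borel_measurable borel" "\<And>x. norm (divergence g x) \<le> B'"
    using divergence_continuous_bounded[OF g] borel_measurable_continuous_onI by blast
  have shift: "(LINT y|lborel. v y * divergence g (y + s)) =
      - ((LINT y|\<nu>. g (y + s) \<bullet> a y) + (LINT y|lborel. g (y + s) \<bullet> b y))" for s
    using v Cc_infinity_translate[OF g, of s] divergence_translate[OF g] unfolding weak_deriv_def by auto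
  have int: "integrable lborel (\<lambda>s. \<psi> s * (LINT y|N. g (y + s) \<bullet> f y))"
    if N: "sigma_finite_measure N" and [measurable_cong]: "sets N = sets borel" and f: "integrable N f" for N f
  proof -
    interpret sigma_finite_measure N by (rule N)
    note [measurable] = B(1) integrable_borel_measurable[OF that(2) f]
    have s[measurable]: "(\<lambda>s. LINT y|N. g (y + s) \<bullet> f y) \<in> borel_measurable borel" by measurable
    have "\<bar>LINT y|N. g (y + s) \<bullet> f y\<bar> \<le> B * (LINT x|N. norm (f x))" for s
      by (rule norm_integral_inner_le[OF that(2) f]) (use B in auto)
    then show ?thesis
      using integrable_bounded_scaleR[OF sets_lborel integrable_kernel s, of "B * (LINT x|N. norm (f x))"] by (simp add: mult.commute)
  qed
  have "(LINT x|lborel. conv \<psi> lborel v x * divergence g x) = (LINT x|lborel. divergence g x \<bullet> conv \<psi> lborel v x)"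
    by (simp add: mult.commute)
  also have "\<dots> = (LINT s|lborel. \<psi> s * (LINT y|lborel. divergence g (y + s) \<bullet> v y))"
    unfolding integral_inner_conv[OF l vab(1) B'] by (rule integral_conv_shift[OF l vab(1) B'])
  also have "\<dots> = (LINT s|lborel. - (\<psi> s * (LINT y|\<nu>. g (y + s) \<bullet> a y) + \<psi> s * (LINT y|lborel. g (y + s) \<bullet> b y)))"
    using shift by (simp add: mult.commute[of "divergence g _"] right_diff_distrib)
  also have "\<dots> = - ((LINT s|lborel. \<psi> s * (LINT y|\<nu>. g (y + s) \<bullet> a y)) + (LINT s|lborel. \<psi> s * (LINT y|lborel. g (y + s) \<bullet> b y)))"
    using int[OF \<nu> vab(2)] int[OF l vab(3)] by simp
  also have "\<dots> = - ((LINT x|lborel. g x \<bullet> conv \<psi> \<nu> a x) + (LINT x|lborel. g x \<bullet> conv \<psi> lborel b x))"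
    unfolding integral_inner_conv[OF \<nu> vab(2) B] integral_inner_conv[OF l vab(3) B]
      integral_conv_shift[OF \<nu> vab(2) B] integral_conv_shift[OF l vab(3) B] ..
  also have "\<dots> = - ((LINT x|\<nu>. g x \<bullet> 0) + (LINT x|lborel. g x \<bullet> (conv \<psi> \<nu> a x + conv \<psi> lborel b x)))"
    using integrable_inner_bounded[OF l(2) iconv(1) B] integrable_inner_bounded[OF l(2) iconv(2) B]
    by (simp add: inner_add_right)
  finally show "(LINT x|lborel. conv \<psi> lborel v x * divergence g x) =
    - ((LINT x|\<nu>. g x \<bullet> 0) + (LINT x|lborel. g x \<bullet> (conv \<psi> \<nu> a x + conv \<psi> lborel b x)))" .
qed simp

lemma weak_deriv_diff:
  assumes \<nu>: "sets \<nu> = sets borel" and 1: "weak_deriv \<nu> v a b" and 2: "weak_deriv \<nu> v' a' b'"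
  shows "weak_deriv \<nu> (\<lambda>x. v x - v' x) (\<lambda>x. a x - a' x) (\<lambda>x. b x - b' x)"
  unfolding weak_deriv_def
proof (intro conjI allI impI)
  have i: "integrable lborel v" "integrable \<nu> a" "integrable lborel b"
    and i': "integrable lborel v'" "integrable \<nu> a'" "integrable lborel b'"
    using 1 2 by (auto simp: weak_deriv_def)
  then show "integrable lborel (\<lambda>x. v x - v' x)" "integrable \<nu> (\<lambda>x. a x - a' x)" "integrable lborel (\<lambda>x. b x - b' x)"
    by auto
  fix g :: "real^'a \<Rightarrow> real^'a" assume g: "Cc_infinity g"
  obtain B where B: "g \<in> borel_measurable borel" "\<And>x. norm (g x) \<le> B" using test_field_bounded[OF g] by blast
  obtain B' where B': "divergence g \<in> borel_measurable borel" "\<And>x. norm (divergence g x) \<le> B'"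
    using divergence_continuous_bounded[OF g] borel_measurable_continuous_onI by blast
  note ii = integrable_inner_bounded[OF _ _ B] integrable_inner_bounded[OF _ _ B', simplified]
  have e: "(LINT x|lborel. v x * divergence g x) = - ((LINT x|\<nu>. g x \<bullet> a x) + (LINT x|lborel. g x \<bullet> b x))"
    "(LINT x|lborel. v' x * divergence g x) = - ((LINT x|\<nu>. g x \<bullet> a' x) + (LINT x|lborel. g x \<bullet> b' x))"
    using 1 2 g by (auto simp: weak_deriv_def)
  have "(LINT x|lborel. (v x - v' x) * divergence g x) = (LINT x|lborel. v x * divergence g x) - (LINT x|lborel. v' x * divergence g x)"
  proof -
    have "integrable lborel (\<lambda>x. v x * divergence g x)" "integrable lborel (\<lambda>x. v' x * divergence g x)"
      using ii(2)[OF sets_lborel i(1)] ii(2)[OF sets_lborel i'(1)] by (simp_all add: mult.commute)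
    then show ?thesis by (simp add: left_diff_distrib)
  qed
  also have "\<dots> = - (((LINT x|\<nu>. g x \<bullet> a x) - (LINT x|\<nu>. g x \<bullet> a' x)) + ((LINT x|lborel. g x \<bullet> b x) - (LINT x|lborel. g x \<bullet> b' x)))"
    unfolding e by simp
  also have "\<dots> = - ((LINT x|\<nu>. g x \<bullet> (a x - a' x)) + (LINT x|lborel. g x \<bullet> (b x - b' x)))"
    using ii(1)[OF \<nu> i(2)] ii(1)[OF \<nu> i'(2)] ii(1)[OF sets_lborel i(3)] ii(1)[OF sets_lborel i'(3)]
    by (simp add: inner_diff_right)
  finally show "(LINT x|lborel. (v x - v' x) * divergence g x) =
    - ((LINT x|\<nu>. g x \<bullet> (a x - a' x)) + (LINT x|lborel. g x \<bullet> (b x - b' x)))" .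
qed

lemma divergence_scaleR:
  fixes \<eta> :: "real^'n \<Rightarrow> real"
  assumes "Cc_infinity \<eta>" "Cc_infinity g"
  shows "divergence (\<lambda>y. \<eta> y *\<^sub>R g y) x = \<eta> x * divergence g x + gradient \<eta> x \<bullet> g x"
proof -
  have "partial_deriv i (\<lambda>y. (\<eta> y *\<^sub>R g y) $ i) x = \<eta> x * partial_deriv i (\<lambda>y. g y $ i) x + partial_deriv i \<eta> x * g x $ i" for i
    using partial_deriv_scaleR[of \<eta> x "\<lambda>y. g y $ i" i] Cc_infinity_differentiable[OF assms(1)]
      Cc_infinity_differentiable[OF Cc_infinity_linear[OF bounded_linear_vec_nth assms(2)]] by simp
  then show ?thesis
    by (simp add: divergence_def gradient_def inner_vec_def sum.distrib sum_distrib_left)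
qed

lemma integral_divergence_eq_0:
  assumes "Cc_infinity g" shows "(LINT x|lborel. divergence g x) = 0"
proof -
  have ci: "Cc_infinity (\<lambda>y. g y $ i)" for i
    by (intro Cc_infinity_linear[OF bounded_linear_vec_nth] assms)
  then have "integrable lborel (partial_deriv i (\<lambda>y. g y $ i))" for i
    by (intro compact_supp_integrable Cc_infinity_continuous Cc_infinity_compact Cc_infinity_partial)
  then show ?thesis unfolding divergence_def
    using integral_partial_deriv_eq_0[OF ci] by (subst Bochner_Integration.integral_sum) auto
qed

text \<open>The product rule, obtained by testing Du with \<eta> g. The constant c is admissible
  because the divergence of \<eta> g has integral zero.\<close>

lemma (in bv_pair) weak_deriv_cutoff:
  assumes \<eta>: "Cc_infinity \<eta>"
  shows "weak_deriv \<nu> (\<lambda>x. \<eta> x * (u x - c)) (\<lambda>x. \<eta> x *\<^sub>R \<sigma> x) (\<lambda>x. (u x - c) *\<^sub>R gradient \<eta> x)"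
  unfolding weak_deriv_def
proof (intro conjI allI impI)
  obtain B where B: "\<eta> \<in> borel_measurable borel" "\<And>x. norm (\<eta> x) \<le> B" using test_field_bounded[OF \<eta>] by blast
  have cg: "continuous_on UNIV (gradient \<eta>)"
    using \<eta> by (intro continuous_on_gradient) (simp add: Cc_infinity_def)
  have sg: "compact (supp (gradient \<eta>))" by (rule compact_supp_gradient[OF Cc_infinity_compact[OF \<eta>]])
  obtain G where G: "\<And>x. norm (gradient \<eta> x) \<le> G"
    using compact_supp_bounded[OF cg sg] by blast
  have [measurable]: "gradient \<eta> \<in> borel_measurable borel" by (rule borel_measurable_continuous_onI[OF cg])
  have i\<eta>: "integrable lborel \<eta>" by (rule compact_supp_integrable[OF Cc_infinity_continuous[OF \<eta>] Cc_infinity_compact[OF \<eta>]])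
  have ig: "integrable lborel (gradient \<eta>)" by (rule compact_supp_integrable[OF cg sg])
  have iu\<eta>: "integrable lborel (\<lambda>x. \<eta> x * u x)"
    using integrable_inner_bounded[OF sets_lborel integrable_u B] by simp
  show "integrable lborel (\<lambda>x. \<eta> x * (u x - c))"
    using iu\<eta> i\<eta> by (simp add: right_diff_distrib)
  show "integrable \<nu> (\<lambda>x. \<eta> x *\<^sub>R \<sigma> x)"
    by (rule integrable_bounded_scaleR[OF sets_\<nu> integrable_\<sigma> B(1)]) (use B(2) in simp)
  have iug: "integrable lborel (\<lambda>x. u x *\<^sub>R gradient \<eta> x)"
  proof (rule Bochner_Integration.integrable_bound)
    show "integrable lborel (\<lambda>x. G * u x)" using integrable_u by simp
    show "AE x in lborel. norm (u x *\<^sub>R gradient \<eta> x) \<le> norm (G * u x)"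
    proof (intro always_eventually allI)
      fix x
      show "norm (u x *\<^sub>R gradient \<eta> x) \<le> norm (G * u x)"
        using mult_left_mono[OF G[of x], of "\<bar>u x\<bar>"] order_trans[OF norm_ge_zero G[of x]]
        by (simp add: abs_mult mult.commute)
    qed
  qed measurable
  show "integrable lborel (\<lambda>x. (u x - c) *\<^sub>R gradient \<eta> x)"
    using iug ig by (simp add: scaleR_diff_left)
  fix g :: "real^'n \<Rightarrow> real^'n" assume g: "Cc_infinity g"
  obtain Bg where Bg: "g \<in> borel_measurable borel" "\<And>x. norm (g x) \<le> Bg" using test_field_bounded[OF g] by blast
  obtain B' where B': "divergence g \<in> borel_measurable borel" "\<And>x. norm (divergence g x) \<le> B'"
    using divergence_continuous_bounded[OF g] borel_measurable_continuous_onI by blast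
  have \<eta>g: "Cc_infinity (\<lambda>y. \<eta> y *\<^sub>R g y)"
    using \<eta> g by (intro Cc_infinity_scaleR) (simp_all add: Cc_infinity_def)
  have j1: "integrable lborel (\<lambda>x. \<eta> x * divergence g x)"
    using integrable_inner_bounded[OF sets_lborel i\<eta> B'] by (simp add: mult.commute)
  have j2: "integrable lborel (\<lambda>x. gradient \<eta> x \<bullet> g x)"
    using integrable_inner_bounded[OF sets_lborel ig Bg] by (simp add: inner_commute)
  have j3: "integrable lborel (\<lambda>x. \<eta> x * u x * divergence g x)"
    using integrable_inner_bounded[OF sets_lborel iu\<eta> B'] by (simp add: mult.commute)
  have j4: "integrable lborel (\<lambda>x. u x * (gradient \<eta> x \<bullet> g x))"
    using integrable_inner_bounded[OF sets_lborel iug Bg] by (simp add: inner_commute)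
  have "0 = (LINT x|lborel. \<eta> x * divergence g x + gradient \<eta> x \<bullet> g x)"
    using integral_divergence_eq_0[OF \<eta>g] by (simp add: divergence_scaleR[OF \<eta> g])
  then have e0: "(LINT x|lborel. \<eta> x * divergence g x) = - (LINT x|lborel. gradient \<eta> x \<bullet> g x)"
    using j1 j2 by simp
  have "(LINT x|lborel. u x * (\<eta> x * divergence g x + gradient \<eta> x \<bullet> g x)) = - (LINT x|\<nu>. (\<eta> x *\<^sub>R g x) \<bullet> \<sigma> x)"
    using weak[OF \<eta>g] by (simp add: divergence_scaleR[OF \<eta> g])
  moreover have "(LINT x|lborel. u x * (\<eta> x * divergence g x + gradient \<eta> x \<bullet> g x)) =
      (LINT x|lborel. \<eta> x * u x * divergence g x + u x * (gradient \<eta> x \<bullet> g x))"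
    by (simp add: algebra_simps)
  ultimately have e1: "(LINT x|lborel. \<eta> x * u x * divergence g x) =
      - (LINT x|\<nu>. (\<eta> x *\<^sub>R g x) \<bullet> \<sigma> x) - (LINT x|lborel. u x * (gradient \<eta> x \<bullet> g x))"
    using j3 j4 by simp
  have "(LINT x|lborel. \<eta> x * (u x - c) * divergence g x) =
      (LINT x|lborel. \<eta> x * u x * divergence g x - c * (\<eta> x * divergence g x))"
    by (simp add: algebra_simps)
  also have "\<dots> = (LINT x|lborel. \<eta> x * u x * divergence g x) - c * (LINT x|lborel. \<eta> x * divergence g x)"
    using j1 j3 by simp
  also have "\<dots> = - ((LINT x|\<nu>. g x \<bullet> (\<eta> x *\<^sub>R \<sigma> x)) +
      ((LINT x|lborel. u x * (gradient \<eta> x \<bullet> g x)) - c * (LINT x|lborel. gradient \<eta> x \<bullet> g x)))"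
    unfolding e0 e1 by simp
  also have "(LINT x|lborel. u x * (gradient \<eta> x \<bullet> g x)) - c * (LINT x|lborel. gradient \<eta> x \<bullet> g x) =
      (LINT x|lborel. u x * (gradient \<eta> x \<bullet> g x) - c * (gradient \<eta> x \<bullet> g x))"
    using j2 j4 by simp
  also have "\<dots> = (LINT x|lborel. g x \<bullet> ((u x - c) *\<^sub>R gradient \<eta> x))"
    by (simp add: inner_commute left_diff_distrib)
  finally show "(LINT x|lborel. \<eta> x * (u x - c) * divergence g x) =
    - ((LINT x|\<nu>. g x \<bullet> (\<eta> x *\<^sub>R \<sigma> x)) + (LINT x|lborel. g x \<bullet> ((u x - c) *\<^sub>R gradient \<eta> x)))" .
qed

section \<open>Estimates on a single cube\<close>

text \<open>
  \<open>c\<close> is the mean of \<open>u\<close> over \<open>E\<close>, where \<open>E\<close> is either the whole cube or its part outside \<open>\<Omega>\<close>;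
  in the latter case \<open>c = 0\<close>.
\<close>

locale bv_cube = bv_pair u \<nu> \<sigma>
  for u :: "real^'n \<Rightarrow> real" and \<nu> \<sigma> +
  fixes \<phi> :: "real^'n \<Rightarrow> real" and z :: "real^'n" and r :: real and \<eta> :: "real^'n \<Rightarrow> real"
    and E :: "(real^'n) set" and c c0 k :: real
  assumes \<phi>: "mollifier \<phi>" and r: "r > 0" and \<eta>: "Cc_infinity \<eta>"
    and \<eta>_nonneg: "\<And>x. 0 \<le> \<eta> x" and \<eta>_le: "\<And>x. \<eta> x \<le> indicator (cube z (3/4 * r)) x"
    and grad_\<eta>: "\<And>x. norm (gradient \<eta> x) \<le> c0 / r"
    and hess_\<eta>: "\<And>i j x. \<bar>partial_deriv i (partial_deriv j \<eta>) x\<bar> \<le> c0 / r\<^sup>2"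
    and E[measurable]: "E \<in> sets borel" and E_sub: "E \<subseteq> cube z r"
    and mean: "(LINT x|lborel. indicator E x * u x) = c * measure lborel E"
    and k: "k > 0" and E_large: "k * r ^ CARD('n) \<le> measure lborel E" and c0: "c0 \<ge> 0"
begin

text \<open>The margins are all r/4: the gradient of \<eta> lives in Q, translates by |q| up to r/4
  stay in \<open>P\<close> = 3/2 Q, and a further r/4-neighbourhood, needed by the translation
  estimate, stays in \<open>V\<close> = 2Q.\<close>

definition V where "V = cube z (2 * r)"
definition P where "P = cube z (3/2 * r)"
definition F where "F x = (u x - c) *\<^sub>R gradient \<eta> x"
definition w where "w x = \<eta> x * (u x - c)"
text \<open>In the Poincare inequality on \<open>P\<close> the differences lie in a cube of side 3
  r, with norm at most n (3/2) r and volume (3 r)^n; division by |E|, at least k r^n, leaves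
  \<open>CP\<close> times r. In \<open>CF\<close> the first summand comes from differences of u, the
  second from differences of the gradient of \<eta>, where n^2 enters through
  \<open>grad_lipschitz\<close>.\<close>

definition CP where "CP = CARD('n) * (3/2) * 3 ^ CARD('n) / k"
definition CF where "CF = c0 + c0 * (CARD('n))\<^sup>2 * CP"

lemma borel_VP[measurable]: "V \<in> sets borel" "P \<in> sets borel"
  by (auto simp: V_def P_def)

lemma CP_nonneg: "CP \<ge> 0" using k by (simp add: CP_def)

lemma poincare_cube:
  "(\<integral>\<^sup>+y. ennreal \<bar>u y - c\<bar> * indicator P y \<partial>lborel) \<le> ennreal (CP * r * measure \<nu> V)" (is "?X \<le> _")
proof -
  let ?n = "CARD('n)"
  let ?D = "?n * (3/2 * r)"
  have "emeasure lborel E * ?X \<le> ennreal (?D * measure \<nu> V) * emeasure lborel (cube (0::real^'n) (3 * r))"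
  proof (rule poincare[OF \<phi> borel_VP(2) _ _ E _ borel_VP(1), of "r / 4"])
    show "convex P" "bounded P" by (auto simp: P_def convex_cube bounded_cube)
    show "E \<subseteq> P" using E_sub cube_mono[of r "3/2 * r" z] r by (auto simp: P_def)
    show "y \<in> V" if "x \<in> P" "norm (y - x) \<le> r / 4" for x y
      unfolding V_def by (rule cube_thicken[of x z "3/2 * r"]) (use that r in \<open>auto simp: P_def\<close>)
    show "y - x \<in> cube 0 (3 * r)" if "x \<in> P" "y \<in> P" for x y
      unfolding cube_def
    proof (clarify)
      fix i
      have "\<bar>x $ i - z $ i\<bar> < 3/2 * r / 2" "\<bar>y $ i - z $ i\<bar> < 3/2 * r / 2" using that by (auto simp: P_def cube_def)
      moreover have "\<bar>(y - x) $ i - 0 $ i\<bar> \<le> \<bar>y $ i - z $ i\<bar> + \<bar>x $ i - z $ i\<bar>" by simp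
      ultimately show "\<bar>(y - x) $ i - 0 $ i\<bar> < 3 * r / 2" by linarith
    qed
    show "norm q \<le> ?D" if "q \<in> cube 0 (3 * r)" for q :: "real^'n" using norm_le_of_cube[OF that] by simp
  qed (use r mean in auto)
  also have "emeasure lborel (cube (0::real^'n) (3 * r)) = ennreal ((3 * r) ^ ?n)" using r by (intro emeasure_cube) simp
  also have "ennreal (?D * measure \<nu> V) * ennreal ((3 * r) ^ ?n) = ennreal (?D * measure \<nu> V * (3 * r) ^ ?n)"
    using r by (intro ennreal_mult''[symmetric]) simp
  finally have le: "emeasure lborel E * ?X \<le> ennreal (?D * measure \<nu> V * (3 * r) ^ ?n)" .
  have "emeasure lborel E = ennreal (measure lborel E)"
    using bounded_subset[OF bounded_cube E_sub] emeasure_bounded_finite[of E] by (intro emeasure_eq_ennreal_measure) auto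
  then have le2: "ennreal (k * r ^ ?n) * ?X \<le> ennreal (?D * measure \<nu> V * (3 * r) ^ ?n)"
    using E_large by (intro order_trans[OF mult_right_mono le]) (auto intro: ennreal_leI)
  have kr: "k * r ^ ?n > 0" using k r by simp
  \<comment> \<open>The integral could a priori be infinite; the positive factor
    \<open>k * r ^ n\<close> in front of it both excludes this and allows the division.\<close>
  show ?thesis
  proof (cases ?X)
    case (real x)
    then have "k * r ^ ?n * x \<le> ?D * measure \<nu> V * (3 * r) ^ ?n"
      using le2 kr r by (simp add: ennreal_mult[symmetric] ennreal_le_iff)
    also have "\<dots> = k * r ^ ?n * (CP * r * measure \<nu> V)"
      using k by (simp add: CP_def power_mult_distrib)
    finally have "x \<le> CP * r * measure \<nu> V" using kr by (rule mult_left_le_imp_le)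
    then show ?thesis using real by (simp add: ennreal_leI)
  next
    case top
    then show ?thesis using le2 k r by (simp add: ennreal_mult_top top_unique)
  qed
qed

text \<open>The support is a closure and may reach the boundary of the open cube 3/4 Q; the closed
  cube of that size still lies in Q.\<close>

lemma supp_\<eta>: "supp \<eta> \<subseteq> cube z r"
proof -
  let ?K = "cbox (z - (\<chi> i. 3/8 * r)) (z + (\<chi> i. 3/8 * r))"
  have "supp \<eta> \<subseteq> ?K"
  proof (rule supp_subset[OF closed_cbox])
    fix x assume x: "x \<notin> ?K"
    have "x \<notin> cube z (3/4 * r)"
    proof
      assume "x \<in> cube z (3/4 * r)"
      then have "\<bar>x $ i - z $ i\<bar> < 3/8 * r" for i by (simp add: cube_def)
      then have "z $ i - 3/8 * r \<le> x $ i \<and> x $ i \<le> z $ i + 3/8 * r" for i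
        using abs_less_iff[of "x $ i - z $ i" "3/8 * r"] by (simp add: diff_less_eq less_diff_eq)
      then have "x \<in> ?K" unfolding mem_box_cart by simp
      then show False using x by blast
    qed
    then show "\<eta> x = 0" using \<eta>_nonneg[of x] \<eta>_le[of x] by simp
  qed
  also have "?K \<subseteq> cube z r"
  proof
    fix x assume "x \<in> ?K"
    then have *: "z $ i - 3/8 * r \<le> x $ i \<and> x $ i \<le> z $ i + 3/8 * r" for i unfolding mem_box_cart by simp
    have "\<bar>x $ i - z $ i\<bar> \<le> 3/8 * r" for i by (rule abs_leI) (use *[of i] in linarith)+
    then have "\<bar>x $ i - z $ i\<bar> < r / 2" for i by (rule le_less_trans) (use r in simp)
    then show "x \<in> cube z r" by (simp add: cube_def)
  qed
  finally show ?thesis .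
qed

lemma grad_support: "gradient \<eta> x \<noteq> 0 \<Longrightarrow> x \<in> cube z r"
  using supp_\<eta> gradient_not_in_supp by blast

text \<open>The factor n^2 arises from estimating the Euclidean norm by the l^1 norm twice, once for
  the Hessian rows and once for the gradient.\<close>

lemma grad_lipschitz: "norm (gradient \<eta> (x + q) - gradient \<eta> x) \<le> (CARD('n))\<^sup>2 * (c0 / r\<^sup>2) * norm q"
proof -
  let ?n = "CARD('n)"
  have comp: "\<bar>partial_deriv j \<eta> (x + q) - partial_deriv j \<eta> x\<bar> \<le> ?n * (c0 / r\<^sup>2) * norm q" for j
  proof (rule gradient_bound_imp_lipschitz)
    show "partial_deriv j \<eta> differentiable (at x)" for x
      by (intro Cc_infinity_differentiable Cc_infinity_partial \<eta>)
    show "norm (gradient (partial_deriv j \<eta>) x) \<le> ?n * (c0 / r\<^sup>2)" for x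
    proof -
      have "norm (gradient (partial_deriv j \<eta>) x) \<le> (\<Sum>i\<in>UNIV. \<bar>gradient (partial_deriv j \<eta>) x $ i\<bar>)"
        by (rule norm_le_l1_cart)
      also have "\<dots> \<le> (\<Sum>i\<in>(UNIV :: 'n set). c0 / r\<^sup>2)"
        by (intro sum_mono) (simp add: gradient_def hess_\<eta>)
      finally show ?thesis by simp
    qed
  qed
  have "norm (gradient \<eta> (x + q) - gradient \<eta> x) \<le> (\<Sum>j\<in>UNIV. \<bar>(gradient \<eta> (x + q) - gradient \<eta> x) $ j\<bar>)"
    by (rule norm_le_l1_cart)
  also have "\<dots> \<le> (\<Sum>j\<in>(UNIV :: 'n set). ?n * (c0 / r\<^sup>2) * norm q)"
    by (intro sum_mono) (use comp in \<open>simp add: gradient_def\<close>)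
  also have "\<dots> = (real ?n)\<^sup>2 * (c0 / r\<^sup>2) * norm q" by (simp add: power2_eq_square)
  finally show ?thesis by simp
qed

lemma cont_grad: "continuous_on UNIV (gradient \<eta>)"
  using \<eta> by (intro continuous_on_gradient) (simp add: Cc_infinity_def)

lemma meas_grad[measurable]: "gradient \<eta> \<in> borel_measurable borel"
  by (rule borel_measurable_continuous_onI[OF cont_grad])

lemma weak_deriv_w: "weak_deriv \<nu> w (\<lambda>x. \<eta> x *\<^sub>R \<sigma> x) F"
  using weak_deriv_cutoff[OF \<eta>, of c] by (simp add: w_def[abs_def] F_def[abs_def])

lemma integrable_F: "integrable lborel F" and integrable_w: "integrable lborel w"
  and integrable_\<eta>\<sigma>: "integrable \<nu> (\<lambda>x. \<eta> x *\<^sub>R \<sigma> x)"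
  using weak_deriv_w by (auto simp: weak_deriv_def)

lemma meas_F[measurable]: "F \<in> borel_measurable borel" using integrable_F by simp

text \<open>The factor c0 / r from the gradient of \<eta> cancels the r of the Poincare
  inequality.\<close>

lemma integral_norm_F: "(LINT x|lborel. norm (F x)) \<le> c0 * CP * measure \<nu> V"
proof -
  have "ennreal (LINT x|lborel. norm (F x)) = (\<integral>\<^sup>+x. ennreal (norm (F x)) \<partial>lborel)"
    using integrable_F by (simp add: nn_integral_eq_integral)
  also have "\<dots> \<le> (\<integral>\<^sup>+x. ennreal (c0 / r) * (ennreal \<bar>u x - c\<bar> * indicator P x) \<partial>lborel)"
  proof (rule nn_integral_mono)
    fix x
    show "ennreal (norm (F x)) \<le> ennreal (c0 / r) * (ennreal \<bar>u x - c\<bar> * indicator P x)"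
    proof (cases "gradient \<eta> x = 0")
      case False
      then have "x \<in> P" using grad_support cube_mono[of r "3/2 * r" z] r by (auto simp: P_def)
      moreover have "norm (F x) \<le> c0 / r * \<bar>u x - c\<bar>"
        unfolding F_def norm_scaleR
        using mult_left_mono[OF grad_\<eta>[of x], of "\<bar>u x - c\<bar>"] by (simp add: mult.commute)
      ultimately show ?thesis
        using c0 r by (simp add: ennreal_mult[symmetric] ennreal_leI del: times_divide_eq_left)
    qed (simp add: F_def)
  qed
  also have "\<dots> = ennreal (c0 / r) * (\<integral>\<^sup>+x. ennreal \<bar>u x - c\<bar> * indicator P x \<partial>lborel)"
    by (rule nn_integral_cmult) measurable
  also have "\<dots> \<le> ennreal (c0 / r) * ennreal (CP * r * measure \<nu> V)"
    by (rule mult_left_mono[OF poincare_cube]) simp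
  also have "\<dots> = ennreal (c0 * CP * measure \<nu> V)"
    using c0 r CP_nonneg by (simp add: ennreal_mult[symmetric])
  finally show ?thesis using c0 CP_nonneg by (simp add: ennreal_le_iff)
qed

text \<open>Discrete product rule: F(x + q) - F(x) is (u(x + q) - u(x)) times the gradient at x + q
  plus u(x) - c times the increment of the gradient. The first term is bounded by the translation
  estimate, the second by Poincare and the Lipschitz bound; both are of order |q| / r.\<close>

lemma translation_F:
  assumes q: "norm q \<le> r / 4"
  shows "(\<integral>\<^sup>+x. ennreal (norm (F (x + q) - F x)) \<partial>lborel) \<le> ennreal (CF * norm q / r * measure \<nu> V)"
proof -
  let ?n = "CARD('n)"
  \<comment> \<open>The first term lives where x + q lies in Q; for |q| up to r/4 such x lie in
    \<open>P\<close>.\<close>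
  define A where "A = {x. x + q \<in> cube z r}"
  have [measurable]: "A \<in> sets borel" unfolding A_def by measurable
  have A_sub: "x \<in> P" if "x \<in> A" for x
    unfolding P_def by (rule cube_thicken[of "x + q" z r]) (use that q r in \<open>auto simp: A_def\<close>)
  have trans: "(\<integral>\<^sup>+x. ennreal \<bar>u (x + q) - u x\<bar> * indicator A x \<partial>lborel) \<le> ennreal (norm q * measure \<nu> V)"
  proof (rule translation_estimate[OF \<phi> _ _ borel_VP(1), of _ "r / 4"])
    show "bounded A" by (rule bounded_subset[OF bounded_cube[of z "3/2 * r"]]) (use A_sub P_def in auto)
    fix x y t assume x: "x \<in> A" and t: "(0::real) \<le> t" "t \<le> 1" and y: "norm (y - (x + t *\<^sub>R q)) \<le> r / 4"
    have "(1 - t) *\<^sub>R x + t *\<^sub>R (x + q) \<in> P"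
      using x t A_sub[OF x] cube_mono[of r "3/2 * r" z] r
      by (intro convexD[OF convex_cube[of z "3/2 * r", folded P_def]]) (auto simp: A_def P_def)
    then have xt: "x + t *\<^sub>R q \<in> cube z (3/2 * r)" by (simp add: P_def algebra_simps)
    show "y \<in> V" unfolding V_def by (rule cube_thicken[OF xt]) (use y r in simp)
  qed (use r in auto)
  define K where "K = (real ?n)\<^sup>2 * (c0 / r\<^sup>2) * norm q"
  have K: "K \<ge> 0" using c0 by (simp add: K_def)
  have "(\<integral>\<^sup>+x. ennreal (norm (F (x + q) - F x)) \<partial>lborel) \<le>
      (\<integral>\<^sup>+x. ennreal (c0 / r) * (ennreal \<bar>u (x + q) - u x\<bar> * indicator A x) + ennreal K * (ennreal \<bar>u x - c\<bar> * indicator P x) \<partial>lborel)"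
  proof (rule nn_integral_mono)
    fix x
    have eq: "F (x + q) - F x = (u (x + q) - u x) *\<^sub>R gradient \<eta> (x + q) + (u x - c) *\<^sub>R (gradient \<eta> (x + q) - gradient \<eta> x)"
      by (simp add: F_def algebra_simps)
    have 1: "norm ((u (x + q) - u x) *\<^sub>R gradient \<eta> (x + q)) \<le> c0 / r * (\<bar>u (x + q) - u x\<bar> * indicator A x)"
    proof (cases "gradient \<eta> (x + q) = 0")
      case False
      then have "x \<in> A" using grad_support by (simp add: A_def)
      then show ?thesis using grad_\<eta>[of "x + q"] mult_left_mono[OF grad_\<eta>[of "x + q"], of "\<bar>u (x + q) - u x\<bar>"]
        by (simp add: mult.commute)
    qed (use c0 r in simp)
    have 2: "norm ((u x - c) *\<^sub>R (gradient \<eta> (x + q) - gradient \<eta> x)) \<le> K * (\<bar>u x - c\<bar> * indicator P x)"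
    proof (cases "gradient \<eta> (x + q) = gradient \<eta> x")
      case False
      then have "gradient \<eta> (x + q) \<noteq> 0 \<or> gradient \<eta> x \<noteq> 0" by auto
      then have "x \<in> P"
        using A_sub[of x] grad_support[of "x + q"] grad_support[of x] cube_mono[of r "3/2 * r" z] r
        by (auto simp: A_def P_def)
      then show ?thesis
        using mult_left_mono[OF grad_lipschitz[of x q], of "\<bar>u x - c\<bar>"] by (simp add: K_def mult.commute)
    qed (use K in simp)
    have "norm (F (x + q) - F x) \<le> c0 / r * (\<bar>u (x + q) - u x\<bar> * indicator A x) + K * (\<bar>u x - c\<bar> * indicator P x)"
      unfolding eq by (rule order_trans[OF norm_triangle_ineq add_mono[OF 1 2]])
    then have "ennreal (norm (F (x + q) - F x)) \<le> ennreal (c0 / r * (\<bar>u (x + q) - u x\<bar> * indicator A x) + K * (\<bar>u x - c\<bar> * indicator P x))"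
      by (rule ennreal_leI)
    also have "\<dots> = ennreal (c0 / r) * (ennreal \<bar>u (x + q) - u x\<bar> * indicator A x) + ennreal K * (ennreal \<bar>u x - c\<bar> * indicator P x)"
      using c0 r K by (simp add: ennreal_plus ennreal_mult indicator_def del: times_divide_eq_left)
    finally show "ennreal (norm (F (x + q) - F x)) \<le> \<dots>" .
  qed
  also have "\<dots> = ennreal (c0 / r) * (\<integral>\<^sup>+x. ennreal \<bar>u (x + q) - u x\<bar> * indicator A x \<partial>lborel)
      + ennreal K * (\<integral>\<^sup>+x. ennreal \<bar>u x - c\<bar> * indicator P x \<partial>lborel)"
    by (simp add: nn_integral_add nn_integral_cmult)
  also have "\<dots> \<le> ennreal (c0 / r) * ennreal (norm q * measure \<nu> V) + ennreal K * ennreal (CP * r * measure \<nu> V)"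
    by (intro add_mono mult_left_mono trans poincare_cube) auto
  also have "\<dots> = ennreal (c0 / r * (norm q * measure \<nu> V) + K * (CP * r * measure \<nu> V))"
    using c0 r K CP_nonneg by (simp add: ennreal_plus ennreal_mult del: times_divide_eq_left)
  also have "c0 / r * (norm q * measure \<nu> V) + K * (CP * r * measure \<nu> V) = CF * norm q / r * measure \<nu> V"
    using r by (simp add: K_def CF_def field_simps power2_eq_square)
  finally show ?thesis .
qed

text \<open>Self-adjointness moves the kernel from \<rho> to F, after which \<rho> enters only
  through its bound. The restriction of \<epsilon> to r/4 is the range of
  \<open>translation_F\<close>; it is satisfied by \<epsilon> = h r / 4 because h is at most
  1.\<close>

lemma commutator_estimate:
  assumes ker: "kernel \<psi> \<epsilon>" and \<epsilon>: "0 \<le> \<epsilon>" "\<epsilon> \<le> r / 4" and \<rho>: "\<rho> \<in> borel_measurable borel" "\<And>x. norm (\<rho> x) \<le> B"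
  shows "\<bar>(LINT x|lborel. \<rho> x \<bullet> F x) - (LINT x|lborel. conv \<psi> lborel \<rho> x \<bullet> F x)\<bar> \<le> B * (CF * \<epsilon> / r * measure \<nu> V)"
proof -
  interpret kernel \<psi> \<epsilon> by (rule ker)
  note l = lborel.sigma_finite_measure_axioms sets_lborel
  have CF0: "CF \<ge> 0" using c0 CP_nonneg by (simp add: CF_def)
  have B0: "0 \<le> B" using order_trans[OF norm_ge_zero \<rho>(2)] .
  have iconv: "integrable lborel (conv \<psi> lborel F)" by (rule integrable_conv_lborel[OF l integrable_F])
  have idf: "integrable lborel (\<lambda>x. conv \<psi> lborel F x - F x)" using iconv integrable_F by simp
  have "(\<integral>\<^sup>+x. ennreal (norm (conv \<psi> lborel F x - F x)) \<partial>lborel) \<le> ennreal (CF * \<epsilon> / r * measure \<nu> V)"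
  proof (rule nn_integral_conv_diff_le[OF integrable_F])
    fix q :: "real^'n" assume q: "norm q \<le> \<epsilon>"
    have "(\<integral>\<^sup>+x. ennreal (norm (F (x + q) - F x)) \<partial>lborel) \<le> ennreal (CF * norm q / r * measure \<nu> V)"
      using q \<epsilon> by (intro translation_F) simp
    also have "\<dots> \<le> ennreal (CF * \<epsilon> / r * measure \<nu> V)"
      using q CF0 r by (intro ennreal_leI mult_right_mono divide_right_mono mult_left_mono) auto
    finally show "(\<integral>\<^sup>+x. ennreal (norm (F (x + q) - F x)) \<partial>lborel) \<le> ennreal (CF * \<epsilon> / r * measure \<nu> V)" .
  qed
  then have L1: "(LINT x|lborel. norm (conv \<psi> lborel F x - F x)) \<le> CF * \<epsilon> / r * measure \<nu> V"
    using nn_integral_eq_integral[OF integrable_norm[OF idf]] CF0 r \<epsilon> by (simp add: ennreal_le_iff)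
  have "(LINT x|lborel. \<rho> x \<bullet> F x) - (LINT x|lborel. conv \<psi> lborel \<rho> x \<bullet> F x) =
      (LINT x|lborel. \<rho> x \<bullet> F x) - (LINT x|lborel. \<rho> x \<bullet> conv \<psi> lborel F x)"
    using integral_inner_conv[OF l integrable_F \<rho>] by simp
  also have "\<dots> = - (LINT x|lborel. \<rho> x \<bullet> (conv \<psi> lborel F x - F x))"
    using integrable_inner_bounded[OF l(2) integrable_F \<rho>] integrable_inner_bounded[OF l(2) iconv \<rho>]
    by (simp add: inner_diff_right)
  finally have "\<bar>(LINT x|lborel. \<rho> x \<bullet> F x) - (LINT x|lborel. conv \<psi> lborel \<rho> x \<bullet> F x)\<bar> =
      \<bar>LINT x|lborel. \<rho> x \<bullet> (conv \<psi> lborel F x - F x)\<bar>" by simp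
  also have "\<dots> \<le> B * (LINT x|lborel. norm (conv \<psi> lborel F x - F x))"
    by (rule norm_integral_inner_le[OF l(2) idf \<rho>])
  also have "\<dots> \<le> B * (CF * \<epsilon> / r * measure \<nu> V)" by (rule mult_left_mono[OF L1 B0])
  finally show ?thesis .
qed

end

section \<open>Series of weak derivatives\<close>

text \<open>Measurability of f is a conclusion here: subsets of null sets are Lebesgue measurable.
  It is applied to functions that are known only a.e., such as those involving the choice
  \<open>BV_sum\<close>.\<close>

lemma borel_measurable_lebesgue_cong_AE:
  assumes v: "v \<in> borel_measurable borel" and eq: "AE x in lebesgue. f x = v x"
  shows "f \<in> borel_measurable (lebesgue :: 'a::euclidean_space measure)"
proof (rule measurableI)
  fix S assume S: "S \<in> sets (borel :: 'b::topological_space measure)"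
  obtain N where N: "N \<in> null_sets lebesgue" "{x. f x \<noteq> v x} \<subseteq> N"
    using eq unfolding eventually_ae_filter by auto
  have "f -` S \<inter> space lebesgue = (v -` S - N) \<union> (f -` S \<inter> N)" using N by auto
  moreover have "v -` S \<in> sets lebesgue"
    using measurable_sets[OF v S] by simp
  moreover have "f -` S \<inter> N \<in> null_sets lebesgue"
    by (rule null_sets_completion_subset[OF _ N(1)]) auto
  ultimately show "f -` S \<inter> space lebesgue \<in> sets lebesgue"
    by (metis N(1) null_setsD2 sets.Diff sets.Un)
qed auto

lemma integral_lebesgue_cong_AE:
  fixes v :: "'a::euclidean_space \<Rightarrow> 'b::{banach, second_countable_topology}"
  assumes v: "v \<in> borel_measurable borel" and eq: "AE x in lebesgue. f x = v x"
  shows "(LINT x|lebesgue. f x) = (LINT x|lborel. v x)"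
proof -
  have "(LINT x|lebesgue. f x) = (LINT x|lebesgue. v x)"
    using borel_measurable_lebesgue_cong_AE[OF v eq] v eq by (intro integral_cong_AE) (auto intro: measurable_completion)
  then show ?thesis by (simp add: integral_lebesgue_lborel[OF v])
qed

lemma has_deriv_measure_two_measure:
  assumes \<nu>: "sets \<nu> = sets borel" and w: "weak_deriv \<nu> v a b" and eq: "AE x in lebesgue. f x = v x"
  shows "has_deriv_measure f (two_measure \<nu> a b)" and "BV f"
proof -
  have i: "integrable lborel v" "integrable \<nu> a" "integrable lborel b" using w by (auto simp: weak_deriv_def)
  have [measurable]: "v \<in> borel_measurable borel" using i(1) by simp
  show *: "has_deriv_measure f (two_measure \<nu> a b)"
    unfolding has_deriv_measure_def
  proof (intro conjI allI impI)
    show "vector_measure (two_measure \<nu> a b)" by (rule vector_measure_two_measure[OF \<nu> i(2,3)])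
    fix g :: "real^'a \<Rightarrow> real^'a" assume g: "Cc_infinity g"
    obtain B where B: "g \<in> borel_measurable borel" "\<And>x. norm (g x) \<le> B" using test_field_bounded[OF g] by blast
    have [measurable]: "divergence g \<in> borel_measurable borel"
      using divergence_continuous_bounded(1)[OF g] borel_measurable_continuous_onI by blast
    have "(LINT x|lebesgue. f x * divergence g x) = (LINT x|lborel. v x * divergence g x)"
      by (rule integral_lebesgue_cong_AE) (use eq in auto)
    then show "(LINT x|lebesgue. f x * divergence g x) = - pairing (two_measure \<nu> a b) g"
      using w g pairing_two_measure[OF \<nu> i(2,3) B] by (simp add: weak_deriv_def)
  qed
  have "integrable lebesgue f"
  proof (rule integrable_cong_AE_imp)
    show "integrable lebesgue v" using i(1) by (simp add: integrable_completion)
    show "f \<in> borel_measurable lebesgue" by (rule borel_measurable_lebesgue_cong_AE[OF _ eq]) simp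
    show "AE x in lebesgue. v x = f x" using eq by eventually_elim simp
  qed
  then show "BV f" using * unfolding BV_def by blast
qed

lemma pairing_polar:
  fixes \<mu> :: "(real^'n) set \<Rightarrow> real^'n"
  assumes \<nu>: "finite_measure \<nu>" "sets \<nu> = sets borel" "\<sigma> \<in> borel_measurable borel" "\<And>x. norm (\<sigma> x) \<le> 1"
    and \<mu>: "\<And>A. A \<in> sets borel \<Longrightarrow> \<mu> A = (LINT x|\<nu>. indicator A x *\<^sub>R \<sigma> x)"
    and g: "g \<in> borel_measurable borel" "\<And>x. norm (g x) \<le> B"
  shows "integrable \<nu> \<sigma>" "pairing \<mu> g = (LINT x|\<nu>. g x \<bullet> \<sigma> x)"
proof -
  interpret finite_measure \<nu> by (rule \<nu>(1))
  show i: "integrable \<nu> \<sigma>"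
  proof (rule integrable_const_bound)
    show "\<sigma> \<in> borel_measurable \<nu>" using \<nu>(3) measurable_cong_sets[OF \<nu>(2) refl] by blast
  qed (use \<nu>(4) in auto)
  have "pairing \<mu> = pairing (two_measure \<nu> \<sigma> (\<lambda>x. 0))"
    by (rule pairing_cong) (simp add: two_measure_def \<mu>)
  then show "pairing \<mu> g = (LINT x|\<nu>. g x \<bullet> \<sigma> x)"
    using pairing_two_measure[OF \<nu>(2) i _ g, of "\<lambda>x. 0"] by simp
qed

section \<open>Uniqueness of the derivative measure and bounds on the BV norm\<close>

text \<open>Polar representations turn both candidates into densities with respect to finite
  measures, to which \<open>deriv_measure_unique\<close> applies. It makes the choice in
  \<open>deriv_measure\<close> harmless: its variation and pairing can be read off from any
  representation.\<close>

lemma has_deriv_measure_unique: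
  fixes \<phi> f :: "real^'n \<Rightarrow> real"
  assumes \<phi>: "mollifier \<phi>" and \<mu>: "has_deriv_measure f \<mu>" "has_deriv_measure f \<mu>'" and A: "A \<in> sets borel"
  shows "\<mu> A = \<mu>' A"
proof -
  have vm: "vector_measure \<mu>" "vector_measure \<mu>'" using \<mu> by (auto simp: has_deriv_measure_def)
  obtain \<nu> \<sigma> where p: "finite_measure \<nu>" "sets \<nu> = sets borel" "\<sigma> \<in> borel_measurable borel" "\<And>x. norm (\<sigma> x) \<le> 1"
    "\<And>A. A \<in> sets borel \<Longrightarrow> \<mu> A = (LINT x|\<nu>. indicator A x *\<^sub>R \<sigma> x)"
    "\<And>A. A \<in> sets borel \<Longrightarrow> emeasure \<nu> A \<le> ennreal (2 * CARD('n)) * variation \<mu> A"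
    by (rule vector_measure_polar[OF vm(1)]) (rule that)
  obtain \<nu>' \<sigma>' where p': "finite_measure \<nu>'" "sets \<nu>' = sets borel" "\<sigma>' \<in> borel_measurable borel" "\<And>x. norm (\<sigma>' x) \<le> 1"
    "\<And>A. A \<in> sets borel \<Longrightarrow> \<mu>' A = (LINT x|\<nu>'. indicator A x *\<^sub>R \<sigma>' x)"
    "\<And>A. A \<in> sets borel \<Longrightarrow> emeasure \<nu>' A \<le> ennreal (2 * CARD('n)) * variation \<mu>' A"
    by (rule vector_measure_polar[OF vm(2)]) (rule that)
  interpret \<nu>: finite_measure \<nu> by (rule p(1))
  interpret \<nu>': finite_measure \<nu>' by (rule p'(1))
  have zero: "(\<lambda>x::real^'n. 0 :: real^'n) \<in> borel_measurable borel" "norm ((\<lambda>x::real^'n. 0 :: real^'n) x) \<le> 0" for x by auto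
  have "(LINT x|\<nu>. indicator A x *\<^sub>R \<sigma> x) = (LINT x|\<nu>'. indicator A x *\<^sub>R \<sigma>' x)"
  proof (rule deriv_measure_unique[OF \<phi> _ p(2) _ _ p'(2) _ _ A])
    show "sigma_finite_measure \<nu>" "sigma_finite_measure \<nu>'" ..
    show "integrable \<nu> \<sigma>" "integrable \<nu>' \<sigma>'" using pairing_polar(1)[OF p(1-5) zero] pairing_polar(1)[OF p'(1-5) zero] by auto
    fix g :: "real^'n \<Rightarrow> real^'n" assume g: "Cc_infinity g"
    obtain B where B: "g \<in> borel_measurable borel" "\<And>x. norm (g x) \<le> B" using test_field_bounded[OF g] by blast
    have "- pairing \<mu> g = - pairing \<mu>' g" using \<mu> g by (simp add: has_deriv_measure_def)
    then show "(LINT x|\<nu>. g x \<bullet> \<sigma> x) = (LINT x|\<nu>'. g x \<bullet> \<sigma>' x)"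
      using pairing_polar(2)[OF p(1-5) B] pairing_polar(2)[OF p'(1-5) B] by simp
  qed
  then show ?thesis using p(5)[OF A] p'(5)[OF A] by simp
qed

lemma has_deriv_measure_deriv_measure:
  "has_deriv_measure f \<mu> \<Longrightarrow> has_deriv_measure f (deriv_measure f)"
  unfolding deriv_measure_def by (rule someI[of "has_deriv_measure f"])

lemma
  fixes \<phi> f :: "real^'n \<Rightarrow> real"
  assumes \<phi>: "mollifier \<phi>" and \<mu>: "has_deriv_measure f \<mu>"
  shows variation_deriv_measure: "variation (deriv_measure f) = variation \<mu>"
    and pairing_deriv_measure: "pairing (deriv_measure f) = pairing \<mu>"
  using has_deriv_measure_unique[OF \<phi> has_deriv_measure_deriv_measure[OF \<mu>] \<mu>]
  by (auto intro: variation_cong pairing_cong)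

text \<open>An upper bound for the BV norm that is read off from a representation. It consists of
  plain L^1 norms, so it can be summed over the cubes.\<close>

definition weak_norm ::
    "(real^'n) measure \<Rightarrow> (real^'n \<Rightarrow> real) \<Rightarrow> (real^'n \<Rightarrow> real^'n) \<Rightarrow> (real^'n \<Rightarrow> real^'n) \<Rightarrow> real"
  where "weak_norm \<nu> v a b =
    (LINT x|lborel. norm (v x)) + (LINT x|\<nu>. norm (a x)) + (LINT x|lborel. norm (b x))"

lemma BV_norm_le_weak_norm:
  fixes \<phi> f :: "real^'n \<Rightarrow> real"
  assumes \<phi>: "mollifier \<phi>" and \<nu>: "sets \<nu> = sets borel" and w: "weak_deriv \<nu> v a b"
    and eq: "AE x in lebesgue. f x = v x"
  shows "BV_norm f \<le> ennreal (weak_norm \<nu> v a b)"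
proof -
  have i: "integrable lborel v" "integrable \<nu> a" "integrable lborel b" using w by (auto simp: weak_deriv_def)
  have [measurable]: "v \<in> borel_measurable borel" using i(1) by simp
  have 1: "(\<integral>\<^sup>+x. ennreal \<bar>f x\<bar> \<partial>lebesgue) = ennreal (LINT x|lborel. norm (v x))"
  proof -
    have "(\<integral>\<^sup>+x. ennreal \<bar>f x\<bar> \<partial>lebesgue) = (\<integral>\<^sup>+x. ennreal \<bar>v x\<bar> \<partial>lebesgue)"
      by (rule nn_integral_cong_AE) (use eq in \<open>eventually_elim, simp\<close>)
    also have "\<dots> = (\<integral>\<^sup>+x. ennreal \<bar>v x\<bar> \<partial>lborel)" by (simp add: nn_integral_completion)
    also have "\<dots> = ennreal (LINT x|lborel. norm (v x))"
      using nn_integral_eq_integral[OF integrable_norm[OF i(1)]] by simp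
    finally show ?thesis .
  qed
  have "variation (deriv_measure f) UNIV \<le> ennreal (LINT x|\<nu>. norm (a x)) + ennreal (LINT x|lborel. norm (b x))"
    unfolding variation_deriv_measure[OF \<phi> has_deriv_measure_two_measure(1)[OF \<nu> w eq]]
    using variation_two_measure_le[OF \<nu> i(2,3), of UNIV]
      nn_integral_eq_integral[OF integrable_norm[OF i(2)]] nn_integral_eq_integral[OF integrable_norm[OF i(3)]]
    by simp
  then show ?thesis
    unfolding BV_norm_def 1 weak_norm_def by (simp add: ennreal_plus add.assoc add_mono)
qed

section \<open>Absolutely convergent series in L^1 and unconditional convergence in BV\<close>

lemma AE_summable_norm:
  fixes f :: "nat \<Rightarrow> 'a \<Rightarrow> 'b::{banach, second_countable_topology}"
  assumes f: "\<And>n. integrable M (f n)" and s: "summable (\<lambda>n. \<integral>x. norm (f n x) \<partial>M)"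
  shows "AE x in M. summable (\<lambda>n. norm (f n x))"
proof -
  have [measurable]: "f n \<in> borel_measurable M" for n using f by simp
  have "(\<integral>\<^sup>+x. (\<Sum>n. ennreal (norm (f n x))) \<partial>M) = (\<Sum>n. \<integral>\<^sup>+x. ennreal (norm (f n x)) \<partial>M)"
    by (rule nn_integral_suminf) simp
  also have "\<dots> = (\<Sum>n. ennreal (\<integral>x. norm (f n x) \<partial>M))"
    using f by (intro suminf_cong nn_integral_eq_integral) auto
  also have "\<dots> \<noteq> \<infinity>" using s by (simp add: ennreal_suminf_neq_top)
  finally have "AE x in M. (\<Sum>n. ennreal (norm (f n x))) \<noteq> \<infinity>"
    by (intro nn_integral_PInf_AE) auto
  then show ?thesis by eventually_elim (auto intro: summable_suminf_not_top)
qed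

lemma integral_norm_suminf_le:
  fixes f :: "nat \<Rightarrow> 'a \<Rightarrow> 'b::{banach, second_countable_topology}"
  assumes f: "\<And>n. integrable M (f n)" and s: "summable (\<lambda>n. \<integral>x. norm (f n x) \<partial>M)"
  shows "(\<integral>x. norm (\<Sum>n. f n x) \<partial>M) \<le> (\<Sum>n. \<integral>x. norm (f n x) \<partial>M)"
proof -
  note ae = AE_summable_norm[OF f s]
  have "(\<integral>x. norm (\<Sum>n. f n x) \<partial>M) \<le> (\<integral>x. (\<Sum>n. norm (f n x)) \<partial>M)"
  proof (rule integral_mono_AE)
    show "integrable M (\<lambda>x. norm (\<Sum>n. f n x))" using integrable_suminf[OF f ae s] by simp
    show "integrable M (\<lambda>x. \<Sum>n. norm (f n x))"
      using integrable_suminf[of M "\<lambda>n x. norm (f n x)"] f ae s by simp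
    show "AE x in M. norm (\<Sum>n. f n x) \<le> (\<Sum>n. norm (f n x))"
      using ae by eventually_elim (rule summable_norm)
  qed
  also have "\<dots> = (\<Sum>n. \<integral>x. norm (f n x) \<partial>M)"
    using integral_suminf[of M "\<lambda>n x. norm (f n x)"] f ae s by simp
  finally show ?thesis .
qed

lemma integral_inner_sums:
  fixes f :: "nat \<Rightarrow> real^'n \<Rightarrow> 'b::euclidean_space"
  assumes M: "sets M = sets borel" and f: "\<And>n. integrable M (f n)"
    and s: "summable (\<lambda>n. \<integral>x. norm (f n x) \<partial>M)"
    and g: "g \<in> borel_measurable borel" "\<And>x. norm (g x) \<le> B"
  shows "(\<lambda>n. \<integral>x. g x \<bullet> f n x \<partial>M) sums (\<integral>x. g x \<bullet> (\<Sum>n. f n x) \<partial>M)"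
proof -
  note ae = AE_summable_norm[OF f s]
  have gf: "integrable M (\<lambda>x. g x \<bullet> f n x)" for n by (rule integrable_inner_bounded[OF M f g])
  have le: "norm (g x \<bullet> f n x) \<le> B * norm (f n x)" for n x
    using order_trans[OF Cauchy_Schwarz_ineq2 mult_right_mono[OF g(2) norm_ge_zero]] by simp
  have ae': "AE x in M. summable (\<lambda>n. norm (g x \<bullet> f n x))"
    using ae
  proof eventually_elim
    fix x assume "summable (\<lambda>n. norm (f n x))"
    then have "summable (\<lambda>n. B * norm (f n x))" by (rule summable_mult)
    then show "summable (\<lambda>n. norm (g x \<bullet> f n x))"
      by (rule summable_comparison_test'[where N=0]) (use le in simp)
  qed
  have s': "summable (\<lambda>n. \<integral>x. norm (g x \<bullet> f n x) \<partial>M)"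
  proof (rule summable_comparison_test'[of "\<lambda>n. B * (\<integral>x. norm (f n x) \<partial>M)" 0])
    show "summable (\<lambda>n. B * (\<integral>x. norm (f n x) \<partial>M))" using s by (rule summable_mult)
    fix n
    have "(\<integral>x. norm (g x \<bullet> f n x) \<partial>M) \<le> (\<integral>x. B * norm (f n x) \<partial>M)"
      using gf f le by (intro integral_mono) auto
    then show "norm (\<integral>x. norm (g x \<bullet> f n x) \<partial>M) \<le> B * (\<integral>x. norm (f n x) \<partial>M)" by simp
  qed
  have "(\<integral>x. (\<Sum>n. g x \<bullet> f n x) \<partial>M) = (\<integral>x. g x \<bullet> (\<Sum>n. f n x) \<partial>M)"
  proof (rule integral_cong_AE)
    show "(\<lambda>x. \<Sum>n. g x \<bullet> f n x) \<in> borel_measurable M" using gf by (intro borel_measurable_suminf) auto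
    have "g \<in> borel_measurable M" using g(1) measurable_cong_sets[OF M refl] by blast
    then show "(\<lambda>x. g x \<bullet> (\<Sum>n. f n x)) \<in> borel_measurable M"
      using f by (intro borel_measurable_inner borel_measurable_suminf) auto
    show "AE x in M. (\<Sum>n. g x \<bullet> f n x) = g x \<bullet> (\<Sum>n. f n x)"
      using ae by eventually_elim
        (rule bounded_linear.suminf[OF bounded_linear_inner_right, symmetric], rule summable_norm_cancel)
  qed
  then show ?thesis using sums_integral[OF gf ae' s'] by simp
qed

lemma weak_deriv_suminf:
  fixes v :: "nat \<Rightarrow> real^'n \<Rightarrow> real"
  assumes \<nu>: "sets \<nu> = sets borel" and w: "\<And>n. weak_deriv \<nu> (v n) (a n) (b n)"
    and s: "summable (\<lambda>n. weak_norm \<nu> (v n) (a n) (b n))"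
  shows "weak_deriv \<nu> (\<lambda>x. \<Sum>n. v n x) (\<lambda>x. \<Sum>n. a n x) (\<lambda>x. \<Sum>n. b n x)"
    and "summable (\<lambda>n. LINT x|lborel. norm (v n x))" "summable (\<lambda>n. LINT x|\<nu>. norm (a n x))"
      "summable (\<lambda>n. LINT x|lborel. norm (b n x))"
    and "weak_norm \<nu> (\<lambda>x. \<Sum>n. v n x) (\<lambda>x. \<Sum>n. a n x) (\<lambda>x. \<Sum>n. b n x) \<le> (\<Sum>n. weak_norm \<nu> (v n) (a n) (b n))"
proof -
  have i: "integrable lborel (v n)" "integrable \<nu> (a n)" "integrable lborel (b n)" for n
    using w by (auto simp: weak_deriv_def)
  have nn: "(LINT x|lborel. norm (v n x)) \<ge> 0" "(LINT x|\<nu>. norm (a n x)) \<ge> 0" "(LINT x|lborel. norm (b n x)) \<ge> 0" for n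
    by auto
  show sv: "summable (\<lambda>n. LINT x|lborel. norm (v n x))"
    by (rule summable_comparison_test'[OF s, of 0]) (use nn in \<open>auto simp: weak_norm_def\<close>)
  show sa: "summable (\<lambda>n. LINT x|\<nu>. norm (a n x))"
    by (rule summable_comparison_test'[OF s, of 0]) (use nn in \<open>auto simp: weak_norm_def\<close>)
  show sb: "summable (\<lambda>n. LINT x|lborel. norm (b n x))"
    by (rule summable_comparison_test'[OF s, of 0]) (use nn in \<open>auto simp: weak_norm_def\<close>)
  show "weak_norm \<nu> (\<lambda>x. \<Sum>n. v n x) (\<lambda>x. \<Sum>n. a n x) (\<lambda>x. \<Sum>n. b n x) \<le> (\<Sum>n. weak_norm \<nu> (v n) (a n) (b n))"
    unfolding weak_norm_def
    using integral_norm_suminf_le[OF i(1) sv] integral_norm_suminf_le[OF i(2) sa] integral_norm_suminf_le[OF i(3) sb]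
      suminf_add[OF sv sa] suminf_add[OF summable_add[OF sv sa] sb] by simp
  show "weak_deriv \<nu> (\<lambda>x. \<Sum>n. v n x) (\<lambda>x. \<Sum>n. a n x) (\<lambda>x. \<Sum>n. b n x)"
    unfolding weak_deriv_def
  proof (intro conjI allI impI)
    show "integrable lborel (\<lambda>x. \<Sum>n. v n x)" "integrable \<nu> (\<lambda>x. \<Sum>n. a n x)" "integrable lborel (\<lambda>x. \<Sum>n. b n x)"
      by (intro integrable_suminf AE_summable_norm i sv sa sb)+
    fix g :: "real^'n \<Rightarrow> real^'n" assume g: "Cc_infinity g"
    obtain B where B: "g \<in> borel_measurable borel" "\<And>x. norm (g x) \<le> B" using test_field_bounded[OF g] by blast
    obtain B' where B': "divergence g \<in> borel_measurable borel" "\<And>x. norm (divergence g x) \<le> B'"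
      using divergence_continuous_bounded[OF g] borel_measurable_continuous_onI by blast
    have e: "(LINT x|lborel. divergence g x \<bullet> v n x) = - ((LINT x|\<nu>. g x \<bullet> a n x) + (LINT x|lborel. g x \<bullet> b n x))" for n
      using w[of n] g by (simp add: weak_deriv_def mult.commute)
    have s1: "(\<lambda>n. - ((LINT x|\<nu>. g x \<bullet> a n x) + (LINT x|lborel. g x \<bullet> b n x))) sums
        - ((LINT x|\<nu>. g x \<bullet> (\<Sum>n. a n x)) + (LINT x|lborel. g x \<bullet> (\<Sum>n. b n x)))"
      by (intro sums_minus sums_add integral_inner_sums[OF \<nu> i(2) sa B] integral_inner_sums[OF sets_lborel i(3) sb B])
    have s2: "(\<lambda>n. - ((LINT x|\<nu>. g x \<bullet> a n x) + (LINT x|lborel. g x \<bullet> b n x))) sums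
        (LINT x|lborel. divergence g x \<bullet> (\<Sum>n. v n x))"
      using integral_inner_sums[OF sets_lborel i(1) sv B'] unfolding e .
    show "(LINT x|lborel. (\<Sum>n. v n x) * divergence g x) =
      - ((LINT x|\<nu>. g x \<bullet> (\<Sum>n. a n x)) + (LINT x|lborel. g x \<bullet> (\<Sum>n. b n x)))"
      using sums_unique2[OF s2 s1] by (simp add: mult.commute[of _ "divergence g _"])
  qed
qed

lemma weak_deriv_zero: "weak_deriv \<nu> (\<lambda>x. 0) (\<lambda>x. 0) (\<lambda>x. 0)"
  by (simp add: weak_deriv_def)

text \<open>For a finite set F of indices the error is minus the series in which the terms of F are
  replaced by zero, so its BV norm is at most the sum of the remaining weak norms. That bound
  depends on F alone and tends to 0 along all finite sets, which gives unconditional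
  convergence.\<close>

lemma BV_has_sum_series:
  fixes v :: "nat \<Rightarrow> real^'n \<Rightarrow> real" and \<phi> :: "real^'n \<Rightarrow> real"
  assumes \<phi>: "mollifier \<phi>" and \<nu>: "sets \<nu> = sets borel" and w: "\<And>n. weak_deriv \<nu> (v n) (a n) (b n)"
    and s: "summable (\<lambda>n. weak_norm \<nu> (v n) (a n) (b n))"
    and f: "\<And>j. j \<in> J \<Longrightarrow> AE x in lebesgue. f j x = v j x"
    and z: "\<And>n. n \<notin> J \<Longrightarrow> v n = (\<lambda>x. 0) \<and> a n = (\<lambda>x. 0) \<and> b n = (\<lambda>x. 0)"
  shows "BV_has_sum f J (\<lambda>x. \<Sum>n. v n x)"
  unfolding BV_has_sum_def
proof (intro conjI ballI)
  show "BV (f j)" if "j \<in> J" for j by (rule has_deriv_measure_two_measure(2)[OF \<nu> w f[OF that]])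
  show "BV (\<lambda>x. \<Sum>n. v n x)"
    by (rule has_deriv_measure_two_measure(2)[OF \<nu> weak_deriv_suminf(1)[OF \<nu> w s]]) simp
  define c where "c n = weak_norm \<nu> (v n) (a n) (b n)" for n
  have c0: "c n \<ge> 0" for n by (simp add: c_def weak_norm_def)
  have cJ: "c n = 0" if "n \<notin> J" for n using z[OF that] by (simp add: c_def weak_norm_def)
  have sc: "summable c" using s by (simp add: c_def[abs_def])
  have vae: "AE x in lebesgue. summable (\<lambda>n. norm (v n x))"
    by (rule AE_completion, rule AE_summable_norm) (use weak_deriv_suminf(2)[OF \<nu> w s] w in \<open>auto simp: weak_deriv_def\<close>)
  have bound: "BV_norm (\<lambda>x. (\<Sum>j\<in>F. f j x) - (\<Sum>n. v n x)) \<le> ennreal ((\<Sum>n. c n) - sum c F)"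
    if F: "finite F" "F \<subseteq> J" for F
  proof -
    define v' where "v' n = (if n \<in> F then (\<lambda>x. 0) else v n)" for n
    define a' where "a' n = (if n \<in> F then (\<lambda>x. 0) else a n)" for n
    define b' where "b' n = (if n \<in> F then (\<lambda>x. 0) else b n)" for n
    have w': "weak_deriv \<nu> (v' n) (a' n) (b' n)" for n
      using w[of n] weak_deriv_zero[of \<nu>] by (simp add: v'_def a'_def b'_def)
    have c': "weak_norm \<nu> (v' n) (a' n) (b' n) = c n - (if n \<in> F then c n else 0)" for n
      by (simp add: v'_def a'_def b'_def c_def) (simp add: weak_norm_def)
    have sF: "(\<lambda>n. if n \<in> F then c n else 0) sums (sum c F)"
      using sums_If_finite_set[OF F(1), of c] by simp
    have s': "summable (\<lambda>n. weak_norm \<nu> (v' n) (a' n) (b' n))"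
      unfolding c' by (intro summable_diff sc sums_summable[OF sF])
    \<comment> \<open>The error is written as 0 minus the remaining series, so that its derivative
      comes from \<open>weak_deriv_diff\<close>.\<close>
    note W = weak_deriv_diff[OF \<nu> weak_deriv_zero weak_deriv_suminf(1)[OF \<nu> w' s']]
    have "BV_norm (\<lambda>x. (\<Sum>j\<in>F. f j x) - (\<Sum>n. v n x)) \<le> ennreal (weak_norm \<nu> (\<lambda>x. 0 - (\<Sum>n. v' n x)) (\<lambda>x. 0 - (\<Sum>n. a' n x)) (\<lambda>x. 0 - (\<Sum>n. b' n x)))"
    proof (rule BV_norm_le_weak_norm[OF \<phi> \<nu> W])
      have "AE x in lebesgue. \<forall>j\<in>F. f j x = v j x"
        using F f by (intro AE_finite_allI) auto
      then show "AE x in lebesgue. (\<Sum>j\<in>F. f j x) - (\<Sum>n. v n x) = 0 - (\<Sum>n. v' n x)"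
        using vae
      proof eventually_elim
        fix x assume e: "\<forall>j\<in>F. f j x = v j x" and sx: "summable (\<lambda>n. norm (v n x))"
        have fin: "(\<lambda>n. if n \<in> F then v n x else 0) sums (\<Sum>n\<in>F. v n x)" by (rule sums_If_finite_set[OF F(1)])
        have "(\<lambda>n. v n x - (if n \<in> F then v n x else 0)) sums ((\<Sum>n. v n x) - (\<Sum>n\<in>F. v n x))"
          by (intro sums_diff fin summable_sums summable_norm_cancel[OF sx])
        moreover have "(\<lambda>n. v n x - (if n \<in> F then v n x else 0)) = (\<lambda>n. v' n x)" by (auto simp: v'_def)
        ultimately have "(\<Sum>n. v' n x) = (\<Sum>n. v n x) - (\<Sum>n\<in>F. v n x)" by (simp add: sums_iff)
        then show "(\<Sum>j\<in>F. f j x) - (\<Sum>n. v n x) = 0 - (\<Sum>n. v' n x)" using e by simp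
      qed
    qed
    also have "\<dots> \<le> ennreal (\<Sum>n. weak_norm \<nu> (v' n) (a' n) (b' n))"
      using weak_deriv_suminf(5)[OF \<nu> w' s'] by (intro ennreal_leI) (simp add: weak_norm_def)
    also have "(\<Sum>n. weak_norm \<nu> (v' n) (a' n) (b' n)) = (\<Sum>n. c n) - sum c F"
      unfolding c' using suminf_diff[OF sc sums_summable[OF sF]] sums_unique[OF sF] by simp
    finally show ?thesis .
  qed
  have "(c has_sum (\<Sum>n. c n)) UNIV"
    using sc c0 by (intro norm_summable_imp_has_sum summable_sums) auto
  then have "(c has_sum (\<Sum>n. c n)) J"
    by (rule has_sum_cong_neutral[THEN iffD1, rotated -1]) (use cJ in auto)
  then have "((\<lambda>F. ennreal ((\<Sum>n. c n) - sum c F)) \<longlongrightarrow> ennreal ((\<Sum>n. c n) - (\<Sum>n. c n))) (finite_subsets_at_top J)"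
    unfolding has_sum_def by (intro tendsto_ennrealI tendsto_intros)
  then have lim: "((\<lambda>F. ennreal ((\<Sum>n. c n) - sum c F)) \<longlongrightarrow> 0) (finite_subsets_at_top J)" by simp
  show "((\<lambda>F. BV_norm (\<lambda>x. (\<Sum>j\<in>F. f j x) - (\<Sum>n. v n x))) \<longlongrightarrow> 0) (finite_subsets_at_top J)"
    by (rule tendsto_sandwich[OF _ _ tendsto_const lim])
      (auto intro!: eventually_finite_subsets_at_top_weakI bound)
qed

text \<open>The BV norm contains the L^1 norm, so two limits of the same net of partial sums have
  L^1 distance zero.\<close>

lemma BV_has_sum_unique_AE:
  assumes 1: "BV_has_sum f J v" and 2: "BV_has_sum f J v'"
  shows "AE x in lebesgue. v x = v' x"
proof -
  have m: "v \<in> borel_measurable lebesgue" "v' \<in> borel_measurable lebesgue"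
    "\<And>j. j \<in> J \<Longrightarrow> f j \<in> borel_measurable lebesgue"
    using 1 2 by (auto simp: BV_has_sum_def BV_def)
  let ?S = "\<lambda>F x. \<Sum>j\<in>F. f j x"
  have "((\<lambda>F. BV_norm (\<lambda>x. ?S F x - v x) + BV_norm (\<lambda>x. ?S F x - v' x)) \<longlongrightarrow> 0 + 0) (finite_subsets_at_top J)"
    using 1 2 unfolding BV_has_sum_def by (intro tendsto_add) auto
  moreover have "\<forall>\<^sub>F F in finite_subsets_at_top J. (\<integral>\<^sup>+x. ennreal \<bar>v x - v' x\<bar> \<partial>lebesgue) \<le>
      BV_norm (\<lambda>x. ?S F x - v x) + BV_norm (\<lambda>x. ?S F x - v' x)"
  proof (rule eventually_finite_subsets_at_top_weakI)
    fix F assume F: "finite F" "F \<subseteq> J"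
    have [measurable]: "?S F \<in> borel_measurable lebesgue" using F m(3) by (intro borel_measurable_sum) auto
    note [measurable] = m(1,2)
    have "(\<integral>\<^sup>+x. ennreal \<bar>v x - v' x\<bar> \<partial>lebesgue) \<le> (\<integral>\<^sup>+x. ennreal \<bar>?S F x - v x\<bar> + ennreal \<bar>?S F x - v' x\<bar> \<partial>lebesgue)"
      by (intro nn_integral_mono) (simp flip: ennreal_plus add: ennreal_leI)
    also have "\<dots> = (\<integral>\<^sup>+x. ennreal \<bar>?S F x - v x\<bar> \<partial>lebesgue) + (\<integral>\<^sup>+x. ennreal \<bar>?S F x - v' x\<bar> \<partial>lebesgue)"
      by (rule nn_integral_add) measurable
    also have "\<dots> \<le> BV_norm (\<lambda>x. ?S F x - v x) + BV_norm (\<lambda>x. ?S F x - v' x)"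
      unfolding BV_norm_def by (intro add_mono add_increasing2) auto
    finally show "(\<integral>\<^sup>+x. ennreal \<bar>v x - v' x\<bar> \<partial>lebesgue) \<le> BV_norm (\<lambda>x. ?S F x - v x) + BV_norm (\<lambda>x. ?S F x - v' x)" .
  qed
  ultimately have "(\<integral>\<^sup>+x. ennreal \<bar>v x - v' x\<bar> \<partial>lebesgue) \<le> 0 + 0"
    by (rule tendsto_lowerbound) (rule finite_subsets_at_top_neq_bot)
  then have "AE x in lebesgue. ennreal \<bar>v x - v' x\<bar> = 0"
    using m nn_integral_0_iff_AE[of "\<lambda>x. ennreal \<bar>v x - v' x\<bar>" lebesgue] by simp
  then show ?thesis by eventually_elim (simp add: ennreal_eq_0_iff)
qed

text \<open>The indicators of the sets sum to at most K times the indicator of U; integrate and let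
  the number of terms grow.\<close>

lemma sum_measure_overlap:
  fixes C :: "nat \<Rightarrow> 'a::topological_space set" and K :: nat
  assumes N: "finite_measure N" "sets N = sets borel" and C: "\<And>j. j \<in> J \<Longrightarrow> C j \<in> sets borel"
    and CU: "\<And>j. j \<in> J \<Longrightarrow> C j \<subseteq> U" and U: "U \<in> sets borel"
    and K: "\<And>x. finite {j \<in> J. x \<in> C j} \<and> card {j \<in> J. x \<in> C j} \<le> K"
  shows "summable (\<lambda>n. if n \<in> J then measure N (C n) else 0)"
    and "(\<Sum>n. if n \<in> J then measure N (C n) else 0) \<le> K * measure N U"
proof -
  interpret finite_measure N by (rule N(1))
  have le: "(\<Sum>n<m. if n \<in> J then measure N (C n) else 0) \<le> K * measure N U" for m
  proof -
    have CN: "C n \<in> sets N" if "n \<in> J" for n using C[OF that] N(2) by simp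
    have UN: "U \<in> sets N" using U N(2) by simp
    have "(\<Sum>n<m. if n \<in> J then measure N (C n) else 0) = (\<Sum>n\<in>{n \<in> {..<m}. n \<in> J}. measure N (C n))"
      by (rule sum.inter_filter[symmetric]) simp
    also have "\<dots> = (\<Sum>n\<in>{n \<in> {..<m}. n \<in> J}. \<integral>x. indicator (C n) x \<partial>N)"
      using CN by (intro sum.cong refl) (auto simp: sets.Int_space_eq2)
    also have "\<dots> = (\<integral>x. (\<Sum>n\<in>{n \<in> {..<m}. n \<in> J}. indicator (C n) x) \<partial>N)"
      using CN by (intro Bochner_Integration.integral_sum[symmetric]) (auto intro!: integrable_real_indicator simp: less_top[symmetric])
    also have "\<dots> \<le> (\<integral>x. real K * indicator U x \<partial>N)"
    proof (rule integral_mono)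
      show "integrable N (\<lambda>x. \<Sum>n\<in>{n \<in> {..<m}. n \<in> J}. indicator (C n) x :: real)"
        using CN by (intro Bochner_Integration.integrable_sum integrable_real_indicator) (auto simp: less_top[symmetric])
      show "integrable N (\<lambda>x. real K * indicator U x :: real)"
        using UN by (intro integrable_mult_right integrable_real_indicator) (auto simp: less_top[symmetric])
      fix x
      show "(\<Sum>n\<in>{n \<in> {..<m}. n \<in> J}. indicator (C n) x :: real) \<le> real K * indicator U x"
      proof (cases "x \<in> U")
        case True
        have "(\<Sum>n\<in>{n \<in> {..<m}. n \<in> J}. indicator (C n) x :: real) = card {n \<in> {n \<in> {..<m}. n \<in> J}. x \<in> C n}"
          by (simp add: indicator_def of_bool_def sum.inter_filter[symmetric])
        also have "\<dots> \<le> card {j \<in> J. x \<in> C j}"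
          using K[of x] by (intro of_nat_mono card_mono) auto
        also have "\<dots> \<le> K" using K[of x] by (intro of_nat_mono) auto
        finally show ?thesis using True by simp
      next
        case False
        then have "x \<notin> C n" if "n \<in> J" for n using CU[OF that] by blast
        then have "(\<Sum>n\<in>{n \<in> {..<m}. n \<in> J}. indicator (C n) x :: real) = 0" by (intro sum.neutral) auto
        then show ?thesis by simp
      qed
    qed
    also have "\<dots> = K * measure N U" using UN by (simp add: sets.Int_space_eq2)
    finally show ?thesis .
  qed
  show s: "summable (\<lambda>n. if n \<in> J then measure N (C n) else 0)"
    by (rule summableI_nonneg_bounded[OF _ le]) simp
  show "(\<Sum>n. if n \<in> J then measure N (C n) else 0) \<le> K * measure N U"
    by (rule suminf_le_const[OF s le])
qed

section \<open>The bad part belonging to one cube\<close>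

context bv_cube
begin

text \<open>The derivative of \<open>bad\<close> has the \<nu>-density \<open>bad_a\<close>, which
  comes from the unmollified w alone, and the Lebesgue density \<open>bad_b\<close>, which collects
  F and everything that mollification has made absolutely continuous.\<close>

definition bad where "bad \<psi> x = w x - conv \<psi> lborel w x"
definition bad_a where "bad_a x = \<eta> x *\<^sub>R \<sigma> x"
definition bad_b where "bad_b \<psi> x = F x - (conv \<psi> \<nu> bad_a x + conv \<psi> lborel F x)"

lemma integrable_bad_a: "integrable \<nu> bad_a"
  using integrable_\<eta>\<sigma> by (simp add: bad_a_def[abs_def])

lemma weak_deriv_bad:
  assumes "kernel \<psi> \<epsilon>" shows "weak_deriv \<nu> (bad \<psi>) bad_a (bad_b \<psi>)"
proof -
  interpret kernel \<psi> \<epsilon> by fact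
  have w: "weak_deriv \<nu> w bad_a F" using weak_deriv_w by (simp add: bad_a_def[abs_def])
  show ?thesis
    using weak_deriv_diff[OF sets_\<nu> w weak_deriv_conv[OF sf_\<nu> sets_\<nu> w]]
    by (simp add: bad_def[abs_def] bad_b_def[abs_def])
qed

lemma abs_\<eta>_le: 
  assumes "3/4 * r \<le> s" shows "\<bar>\<eta> x\<bar> \<le> indicator (cube z s) x"
proof (cases "x \<in> cube z (3/4 * r)")
  case True
  then have "x \<in> cube z s" using cube_mono[OF assms] by blast
  then show ?thesis using \<eta>_nonneg[of x] \<eta>_le[of x] True by simp
next
  case False
  then show ?thesis using \<eta>_nonneg[of x] \<eta>_le[of x] by simp
qed

lemma integral_norm_bad_a: "(LINT x|\<nu>. norm (bad_a x)) \<le> measure \<nu> V"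
proof -
  interpret \<nu>: finite_measure \<nu> by (rule finite_\<nu>)
  have VN: "V \<in> sets \<nu>" by (simp add: sets_\<nu>)
  have "(LINT x|\<nu>. norm (bad_a x)) \<le> (LINT x|\<nu>. indicator V x)"
  proof (rule integral_mono)
    show "integrable \<nu> (\<lambda>x. norm (bad_a x))" using integrable_bad_a by simp
    show "integrable \<nu> (indicator V :: _ \<Rightarrow> real)" using VN by (intro integrable_real_indicator) (auto simp: less_top[symmetric])
    fix x
    have "\<bar>\<eta> x\<bar> \<le> indicator V x"
      unfolding V_def by (rule abs_\<eta>_le) (use r in simp)
    then show "norm (bad_a x) \<le> indicator V x"
      using mult_mono[OF _ norm_\<sigma>[of x], of "\<bar>\<eta> x\<bar>" "indicator V x"] by (simp add: bad_a_def)
  qed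
  also have "\<dots> = measure \<nu> V" using VN by (simp add: sets.Int_space_eq2)
  finally show ?thesis .
qed

lemma integral_norm_conv_le:
  fixes f :: "real^'n \<Rightarrow> 'b::euclidean_space"
  assumes "kernel \<psi> \<epsilon>" and N: "sigma_finite_measure N" "sets N = sets borel" "integrable N f"
  shows "(LINT x|lborel. norm (conv \<psi> N f x)) \<le> (LINT x|N. norm (f x))"
  using kernel.nn_integral_conv_le_UNIV[OF assms]
    nn_integral_eq_integral[OF integrable_norm[OF kernel.integrable_conv_lborel[OF assms]]]
    nn_integral_eq_integral[OF integrable_norm[OF N(3)]]
  by (simp add: ennreal_le_iff)

text \<open>Convolution does not increase the mass: F and its mollification contribute c0 CP each,
  and the mollified \<nu>-part contributes 1.\<close>

lemma integral_norm_bad_b: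
  assumes ker: "kernel \<psi> \<epsilon>"
  shows "(LINT x|lborel. norm (bad_b \<psi> x)) \<le> (1 + 2 * c0 * CP) * measure \<nu> V"
proof -
  note l = lborel.sigma_finite_measure_axioms sets_lborel
  have i: "integrable lborel (conv \<psi> \<nu> bad_a)" "integrable lborel (conv \<psi> lborel F)"
    by (rule kernel.integrable_conv_lborel[OF ker sf_\<nu> sets_\<nu> integrable_bad_a],
        rule kernel.integrable_conv_lborel[OF ker l integrable_F])
  have "(LINT x|lborel. norm (bad_b \<psi> x)) \<le> (LINT x|lborel. norm (F x) + (norm (conv \<psi> \<nu> bad_a x) + norm (conv \<psi> lborel F x)))"
  proof (rule integral_mono)
    show "integrable lborel (\<lambda>x. norm (bad_b \<psi> x))" using i integrable_F by (simp add: bad_b_def)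
    show "integrable lborel (\<lambda>x. norm (F x) + (norm (conv \<psi> \<nu> bad_a x) + norm (conv \<psi> lborel F x)))"
      using i integrable_F by simp
    show "norm (bad_b \<psi> x) \<le> norm (F x) + (norm (conv \<psi> \<nu> bad_a x) + norm (conv \<psi> lborel F x))" for x
      unfolding bad_b_def by (rule order_trans[OF norm_triangle_ineq4 add_left_mono[OF norm_triangle_ineq]])
  qed
  also have "\<dots> = (LINT x|lborel. norm (F x)) + ((LINT x|lborel. norm (conv \<psi> \<nu> bad_a x)) + (LINT x|lborel. norm (conv \<psi> lborel F x)))"
    using i integrable_F by simp
  also have "\<dots> \<le> c0 * CP * measure \<nu> V + (measure \<nu> V + c0 * CP * measure \<nu> V)"
    using integral_norm_conv_le[OF ker sf_\<nu> sets_\<nu> integrable_bad_a] integral_norm_conv_le[OF ker l integrable_F]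
      integral_norm_bad_a integral_norm_F by (intro add_mono) auto
  finally show ?thesis by (simp add: algebra_simps)
qed

text \<open>A factor 2 for w and its mollification, and another for u and the constant c, whose L^1
  norm on Q the assumption bounds by that of u.\<close>

lemma integral_norm_bad:
  assumes ker: "kernel \<psi> \<epsilon>" and c: "\<bar>c\<bar> * measure lborel (cube z r) \<le> (LINT x|lborel. indicator (cube z r) x * \<bar>u x\<bar>)"
  shows "(LINT x|lborel. norm (bad \<psi> x)) \<le> 4 * (LINT x|lborel. indicator (cube z r) x * \<bar>u x\<bar>)"
proof -
  note l = lborel.sigma_finite_measure_axioms sets_lborel
  have i: "integrable lborel (conv \<psi> lborel w)"
    by (rule kernel.integrable_conv_lborel[OF ker l integrable_w])
  have iu: "integrable lborel (\<lambda>x. indicator (cube z r) x * \<bar>u x\<bar>)"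
    using integrable_indicator_scaleR[OF sets_lborel integrable_abs[OF integrable_u] borel_cube] by simp
  have ic: "integrable lborel (\<lambda>x. \<bar>c\<bar> * indicator (cube z r) x)"
    using emeasure_bounded_finite[OF bounded_cube, of z r] by (intro integrable_mult_right integrable_real_indicator) auto
  have "(LINT x|lborel. norm (bad \<psi> x)) \<le> (LINT x|lborel. norm (w x) + norm (conv \<psi> lborel w x))"
    using i integrable_w by (intro integral_mono) (auto simp: bad_def norm_triangle_ineq4)
  also have "\<dots> \<le> (LINT x|lborel. norm (w x)) + (LINT x|lborel. norm (w x))"
    using i integrable_w integral_norm_conv_le[OF ker l integrable_w] by simp
  also have "(LINT x|lborel. norm (w x)) \<le> (LINT x|lborel. indicator (cube z r) x * \<bar>u x\<bar> + \<bar>c\<bar> * indicator (cube z r) x)"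
  proof (rule integral_mono)
    show "integrable lborel (\<lambda>x. norm (w x))" using integrable_w by simp
    show "integrable lborel (\<lambda>x. indicator (cube z r) x * \<bar>u x\<bar> + \<bar>c\<bar> * indicator (cube z r) x)"
      using iu ic by simp
    fix x
    have "\<bar>\<eta> x\<bar> \<le> indicator (cube z r) x"
      by (rule abs_\<eta>_le) (use r in simp)
    then have "\<bar>\<eta> x\<bar> * \<bar>u x - c\<bar> \<le> indicator (cube z r) x * (\<bar>u x\<bar> + \<bar>c\<bar>)"
      by (intro mult_mono abs_triangle_ineq4) auto
    then show "norm (w x) \<le> indicator (cube z r) x * \<bar>u x\<bar> + \<bar>c\<bar> * indicator (cube z r) x"
      by (simp add: w_def abs_mult distrib_left mult.commute)
  qed
  also have "\<dots> = (LINT x|lborel. indicator (cube z r) x * \<bar>u x\<bar>) + \<bar>c\<bar> * measure lborel (cube z r)"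
    using iu ic by simp
  finally show ?thesis using c by simp
qed

text \<open>Moving the kernel onto \<rho> splits the pairing into the \<nu>-term that
  \<open>S_op\<close> subtracts and the commutator of F, the only term left to estimate.\<close>

lemma pairing_bad:
  assumes ker: "kernel \<psi> \<epsilon>" and \<rho>: "\<rho> \<in> borel_measurable borel" "\<And>x. norm (\<rho> x) \<le> B"
  shows "(LINT x|\<nu>. \<rho> x \<bullet> bad_a x) + (LINT x|lborel. \<rho> x \<bullet> bad_b \<psi> x) =
    (LINT x|\<nu>. (\<rho> x - conv \<psi> lborel \<rho> x) \<bullet> bad_a x) +
    ((LINT x|lborel. \<rho> x \<bullet> F x) - (LINT x|lborel. conv \<psi> lborel \<rho> x \<bullet> F x))"
proof -
  note l = lborel.sigma_finite_measure_axioms sets_lborel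
  have i: "integrable lborel (conv \<psi> \<nu> bad_a)" "integrable lborel (conv \<psi> lborel F)"
    by (rule kernel.integrable_conv_lborel[OF ker sf_\<nu> sets_\<nu> integrable_bad_a],
        rule kernel.integrable_conv_lborel[OF ker l integrable_F])
  have m: "conv \<psi> lborel \<rho> \<in> borel_measurable borel" "\<And>x. norm (conv \<psi> lborel \<rho> x) \<le> B"
    by (rule kernel.borel_measurable_conv[OF ker l \<rho>(1)], rule kernel.norm_conv_bounded[OF ker \<rho>])
  have "(LINT x|lborel. \<rho> x \<bullet> bad_b \<psi> x) = (LINT x|lborel. \<rho> x \<bullet> F x) -
      ((LINT x|lborel. \<rho> x \<bullet> conv \<psi> \<nu> bad_a x) + (LINT x|lborel. \<rho> x \<bullet> conv \<psi> lborel F x))"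
    using integrable_inner_bounded[OF l(2) i(1) \<rho>] integrable_inner_bounded[OF l(2) i(2) \<rho>]
      integrable_inner_bounded[OF l(2) integrable_F \<rho>]
    by (simp add: bad_b_def inner_diff_right inner_add_right)
  moreover have "(LINT x|\<nu>. (\<rho> x - conv \<psi> lborel \<rho> x) \<bullet> bad_a x) =
      (LINT x|\<nu>. \<rho> x \<bullet> bad_a x) - (LINT x|\<nu>. conv \<psi> lborel \<rho> x \<bullet> bad_a x)"
    using integrable_inner_bounded[OF sets_\<nu> integrable_bad_a \<rho>] integrable_inner_bounded[OF sets_\<nu> integrable_bad_a m]
    by (simp add: inner_diff_left)
  ultimately show ?thesis
    using kernel.integral_inner_conv[OF ker sf_\<nu> sets_\<nu> integrable_bad_a \<rho>] kernel.integral_inner_conv[OF ker l integrable_F \<rho>]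
    by simp
qed

end

section \<open>The commutator estimate\<close>

text \<open>A violation of the bound would hold on a non-empty open set, which is not negligible. It
  converts the essential suprema in \<open>whitney_partition\<close> into pointwise bounds on
  derivatives.\<close>

lemma AE_norm_le_imp_norm_le:
  fixes f :: "real^'n \<Rightarrow> 'b::real_normed_vector"
  assumes f: "continuous_on UNIV f" and ae: "AE x in lebesgue. norm (f x) \<le> c"
  shows "norm (f x) \<le> c"
proof (rule ccontr)
  assume "\<not> norm (f x) \<le> c"
  define S where "S = {x. c < norm (f x)}"
  have "open S" unfolding S_def by (intro open_Collect_less continuous_intros f)
  moreover have "S \<noteq> {}" using \<open>\<not> norm (f x) \<le> c\<close> by (auto simp: S_def not_le)
  moreover have "negligible S"
  proof -
    obtain N where N: "N \<in> null_sets lebesgue" "{x. \<not> norm (f x) \<le> c} \<subseteq> N"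
      using ae unfolding eventually_ae_filter by auto
    then have "S \<in> null_sets lebesgue"
      by (intro null_sets_completion_subset[OF _ N(1)]) (auto simp: S_def)
    then show ?thesis by (simp add: negligible_iff_null_sets)
  qed
  ultimately show False using open_not_negligible by blast
qed

lemma norm_le_of_Linf_norm:
  fixes f :: "real^'n \<Rightarrow> 'b::real_normed_vector"
  assumes f: "continuous_on UNIV f" and s: "s > 0" and b: "b \<ge> 0" and le: "ennreal s * Linf_norm f \<le> ennreal b"
  shows "norm (f x) \<le> b / s"
proof (rule AE_norm_le_imp_norm_le[OF f])
  have "Linf_norm f \<le> ennreal (b / s)"
  proof (cases "Linf_norm f")
    case (real L)
    then have "s * L \<le> b" using le s b by (simp add: ennreal_mult[symmetric] ennreal_le_iff)
    then show ?thesis using real s by (simp add: field_simps ennreal_leI)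
  next
    case top
    then show ?thesis using le s by (simp add: ennreal_mult_top top_unique)
  qed
  then have "AE x in lebesgue. ennreal (norm (f x)) \<le> ennreal (b / s)"
    using esssup_AE[of "\<lambda>x. ennreal (norm (f x))" lebesgue] unfolding Linf_norm_def
    by (auto elim: eventually_mono intro: order_trans)
  then show "AE x in lebesgue. norm (f x) \<le> b / s"
    using s b by (simp add: ennreal_le_iff)
qed

lemma Linf_norm_le:
  fixes f :: "real^'n \<Rightarrow> 'b::euclidean_space"
  assumes "f \<in> borel_measurable borel" "\<And>x. norm (f x) \<le> B"
  shows "Linf_norm f \<le> ennreal B"
  unfolding Linf_norm_def
proof (rule esssup_I)
  show "(\<lambda>x. ennreal (norm (f x))) \<in> borel_measurable lebesgue"
    using assms(1) by (intro measurable_completion) simp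
qed (use assms in \<open>auto intro: ennreal_leI\<close>)

text \<open>By continuity the essential supremum itself is a pointwise bound, so no constant is
  lost; this matters for non-expansiveness.\<close>

lemma Cc_field_Linf_norm:
  assumes "Cc_field \<Omega> \<rho>"
  obtains B where "B \<ge> 0" "\<rho> \<in> borel_measurable borel" "\<And>x. norm (\<rho> x) \<le> B" "Linf_norm \<rho> = ennreal B"
proof -
  have c: "continuous_on UNIV \<rho>" "compact (supp \<rho>)" using assms by (auto simp: Cc_field_def)
  have m: "\<rho> \<in> borel_measurable borel" by (rule borel_measurable_continuous_onI[OF c(1)])
  obtain C where C: "\<And>x. norm (\<rho> x) \<le> C" using compact_supp_bounded[OF c] by blast
  have "Linf_norm \<rho> \<le> ennreal C" by (rule Linf_norm_le[OF m C])
  then obtain B where B: "B \<ge> 0" "Linf_norm \<rho> = ennreal B"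
    by (cases "Linf_norm \<rho>") (auto simp: top_unique)
  then have "norm (\<rho> x) \<le> B" for x
    using norm_le_of_Linf_norm[OF c(1), of 1 B x] by simp
  then show ?thesis using that B m by blast
qed

text \<open>A point p of 3/4 Q outside \<Omega> has distance at least r/8 to the complement of Q.
  The corkscrew condition at p with radius r/8 puts into Q - \<Omega> a ball of radius \<kappa> r /
  8, whose volume gives the constant. For the whole space the condition is vacuous.\<close>

lemma exterior_density:
  fixes \<Omega> :: "(real^'n) set"
  assumes \<Omega>: "\<Omega> = UNIV \<or> (open \<Omega> \<and> bounded \<Omega> \<and> lipschitz_boundary \<Omega>)"
  shows "\<exists>k>0. \<forall>z r. r > 0 \<longrightarrow> \<not> cube z (3/4 * r) \<subseteq> \<Omega> \<longrightarrow> k * r ^ CARD('n) \<le> measure lborel (cube z r - \<Omega>)"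
proof (cases "\<Omega> = UNIV")
  case False
  then have lip: "open \<Omega>" "bounded \<Omega>" "lipschitz_boundary \<Omega>" using \<Omega> by auto
  obtain \<kappa> where \<kappa>: "\<kappa> > 0" and cs: "\<And>p r. p \<notin> \<Omega> \<Longrightarrow> r > 0 \<Longrightarrow> \<exists>q. ball q (\<kappa> * r) \<subseteq> ball p r - \<Omega>"
    using lipschitz_boundary_corkscrew[OF lip] by auto
  let ?k = "unit_ball_vol CARD('n) * (\<kappa> / 8) ^ CARD('n)"
  show ?thesis
  proof (rule exI[of _ ?k], intro conjI allI impI)
    show "?k > 0" using \<kappa> by simp
    fix z :: "real^'n" and r :: real assume r: "r > 0" and "\<not> cube z (3/4 * r) \<subseteq> \<Omega>"
    then obtain p where p: "p \<in> cube z (3/4 * r)" "p \<notin> \<Omega>" by blast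
    obtain q where q: "ball q (\<kappa> * (r / 8)) \<subseteq> ball p (r / 8) - \<Omega>" using cs[OF p(2), of "r / 8"] r by auto
    have "ball p (r / 8) \<subseteq> cube z r"
    proof
      fix y assume "y \<in> ball p (r / 8)"
      then have "norm (y - p) \<le> (r - 3/4 * r) / 2" by (simp add: dist_norm norm_minus_commute)
      then show "y \<in> cube z r" by (rule cube_thicken[OF p(1)])
    qed
    then have sub: "ball q (\<kappa> * (r / 8)) \<subseteq> cube z r - \<Omega>" using q by blast
    have "?k * r ^ CARD('n) = measure lborel (ball q (\<kappa> * (r / 8)))"
      using \<kappa> r by (simp add: content_ball power_mult_distrib power_divide)
    also have "\<dots> \<le> measure lborel (cube z r - \<Omega>)"
    proof (rule measure_mono_fmeasurable[OF sub])
      show "cube z r - \<Omega> \<in> fmeasurable lborel"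
        using lip(1) emeasure_bounded_finite[OF bounded_subset[OF bounded_cube, of "cube z r - \<Omega>" z r]]
        by (intro fmeasurableI) auto
    qed simp
    finally show "?k * r ^ CARD('n) \<le> measure lborel (cube z r - \<Omega>)" .
  qed
qed (auto intro: exI[of _ 1])

text \<open>
  \<open>u\<close> is a Borel representative of the given function \<open>u0\<close>, which is only Lebesgue measurable.
\<close>

locale whitney_setup = bv_pair u \<nu> \<sigma>
  for u :: "real^'n \<Rightarrow> real" and \<nu> \<sigma> +
  fixes \<Omega> U :: "(real^'n) set" and \<phi> :: "real^'n \<Rightarrow> real" and hl c0 k :: real
    and J :: "nat set" and z :: "nat \<Rightarrow> real^'n" and r :: "nat \<Rightarrow> real" and \<eta> :: "nat \<Rightarrow> real^'n \<Rightarrow> real"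
    and u0 :: "real^'n \<Rightarrow> real"
  assumes \<phi>: "mollifier \<phi>" and hl: "0 < hl" "hl \<le> 1"
    and cover: "whitney_cover U J z r" and partition: "whitney_partition c0 J z r \<eta>" and c0: "c0 \<ge> 1"
    and \<Omega>: "\<Omega> \<in> sets borel" and k: "0 < k" "k \<le> 1"
    and density: "\<And>z r. r > 0 \<Longrightarrow> \<not> cube z (3/4 * r) \<subseteq> \<Omega> \<Longrightarrow> k * r ^ CARD('n) \<le> measure lborel (cube z r - \<Omega>)"
    and u0: "AE x in lebesgue. u0 x = u x" and zero: "AE x in lebesgue. x \<notin> \<Omega> \<longrightarrow> u0 x = 0"
begin

section \<open>Consequences of the Whitney conditions\<close>

lemma r_pos: "j \<in> J \<Longrightarrow> r j > 0"
  using cover by (simp add: whitney_cover_def)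

lemma U_eq: "(\<Union>j\<in>J. cube (z j) (1/2 * r j)) = U"
  using cover unfolding whitney_cover_def by (elim conjE)

lemma cube_8_subset: "j \<in> J \<Longrightarrow> cube (z j) (8 * r j) \<subseteq> U"
  using cover by (simp add: whitney_cover_def)

lemma overlap_4: "finite {j \<in> J. x \<in> cube (z j) (4 * r j)} \<and> card {j \<in> J. x \<in> cube (z j) (4 * r j)} \<le> 120 ^ CARD('n)"
  using cover unfolding whitney_cover_def by (elim conjE) (rule spec)

lemma finite_neighbours: "j \<in> J \<Longrightarrow> finite (whitney_neighbours J z r j)"
  using cover by (simp add: whitney_cover_def)

lemma borel_U: "U \<in> sets borel"
  unfolding U_eq[symmetric] by (intro borel_open open_UN ballI open_cube)

lemma sub_cube_subset: "j \<in> J \<Longrightarrow> s \<le> 8 \<Longrightarrow> cube (z j) (s * r j) \<subseteq> U"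
  using cube_8_subset[of j] cube_mono[of "s * r j" "8 * r j" "z j"] r_pos[of j] by auto

lemma overlap: "s \<le> 4 \<Longrightarrow> finite {j \<in> J. x \<in> cube (z j) (s * r j)} \<and> card {j \<in> J. x \<in> cube (z j) (s * r j)} \<le> 120 ^ CARD('n)"
proof -
  assume s: "s \<le> 4"
  have sub: "{j \<in> J. x \<in> cube (z j) (s * r j)} \<subseteq> {j \<in> J. x \<in> cube (z j) (4 * r j)}"
  proof clarify
    fix j assume j: "j \<in> J" "x \<in> cube (z j) (s * r j)"
    have "s * r j \<le> 4 * r j" using s r_pos[OF j(1)] by simp
    then show "x \<in> cube (z j) (4 * r j)" using j cube_mono by blast
  qed
  then show ?thesis
    using overlap_4[of x] card_mono[OF _ sub] finite_subset[OF sub] by (meson order_trans)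
qed

lemma \<eta>_smooth: "j \<in> J \<Longrightarrow> Cc_infinity (\<eta> j)"
  using partition by (simp add: whitney_partition_def)

lemma \<eta>_bounds: 
  assumes "j \<in> J" shows "0 \<le> \<eta> j x" "\<eta> j x \<le> indicator (cube (z j) (3/4 * r j)) x"
proof -
  have "inverse c0 * indicator (cube (z j) (1/2 * r j)) x \<le> \<eta> j x \<and> \<eta> j x \<le> indicator (cube (z j) (3/4 * r j)) x"
    using partition assms unfolding whitney_partition_def by blast
  moreover have "0 \<le> inverse c0 * indicator (cube (z j) (1/2 * r j)) x" using c0 by simp
  ultimately show "0 \<le> \<eta> j x" "\<eta> j x \<le> indicator (cube (z j) (3/4 * r j)) x" by linarith+
qed

lemma \<eta>_eq_0: "j \<in> J \<Longrightarrow> x \<notin> cube (z j) (3/4 * r j) \<Longrightarrow> \<eta> j x = 0"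
  using \<eta>_bounds[of j x] by simp

lemma \<eta>_sum: "j \<in> J \<Longrightarrow> x \<in> cube (z j) (3/4 * r j) \<Longrightarrow> (\<Sum>i \<in> whitney_neighbours J z r j. \<eta> i x) = 1"
  using partition unfolding whitney_partition_def by blast

lemma \<eta>_derivatives:
  assumes j: "j \<in> J"
  shows "norm (gradient (\<eta> j) x) \<le> c0 / r j" "\<bar>partial_deriv i (partial_deriv m (\<eta> j)) x\<bar> \<le> c0 / (r j)\<^sup>2"
proof -
  have sm: "C_infinity (\<eta> j)" using \<eta>_smooth[OF j] by (simp add: Cc_infinity_def)
  have sum: "Linf_norm (\<eta> j) + ennreal (r j) * Linf_norm (gradient (\<eta> j)) +
       ennreal ((r j)\<^sup>2) * Linf_norm (hessian (\<eta> j)) \<le> ennreal c0"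
    using partition j unfolding whitney_partition_def by blast
  have 1: "ennreal (r j) * Linf_norm (gradient (\<eta> j)) \<le> ennreal c0"
    by (rule order_trans[OF _ sum]) (simp add: add_increasing add_increasing2)
  have 2: "ennreal ((r j)\<^sup>2) * Linf_norm (hessian (\<eta> j)) \<le> ennreal c0"
    by (rule order_trans[OF _ sum]) (simp add: add_increasing)
  show "norm (gradient (\<eta> j) x) \<le> c0 / r j"
    using c0 by (intro norm_le_of_Linf_norm[OF continuous_on_gradient[OF sm] r_pos[OF j] _ 1]) simp
  have "continuous_on UNIV (hessian (\<eta> j))"
    unfolding hessian_def by (intro continuous_on_vec_lambda C_infinity_continuous C_infinity_partial sm)
  then have "norm (hessian (\<eta> j) x) \<le> c0 / (r j)\<^sup>2"
    by (rule norm_le_of_Linf_norm[OF _ _ _ 2]) (use c0 r_pos[OF j] in auto)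
  moreover have "\<bar>hessian (\<eta> j) x $ i $ m\<bar> \<le> norm (hessian (\<eta> j) x $ i)" by (rule component_le_norm_cart)
  moreover have "norm (hessian (\<eta> j) x $ i) \<le> norm (hessian (\<eta> j) x)" by (rule Finite_Cartesian_Product.norm_nth_le)
  ultimately show "\<bar>partial_deriv i (partial_deriv m (\<eta> j)) x\<bar> \<le> c0 / (r j)\<^sup>2"
    by (simp add: hessian_def)
qed

section \<open>The bad parts of all cubes and their summability\<close>

definition ker where "ker j = mollifier_scaled \<phi> (1/4 * hl * r j)"
definition mean where "mean j = local_mean \<Omega> u0 (z j) (r j)"
definition E where "E j = (if cube (z j) (3/4 * r j) \<subseteq> \<Omega> then cube (z j) (r j) else cube (z j) (r j) - \<Omega>)"
definition CP where "CP = CARD('n) * (3/2) * 3 ^ CARD('n) / k"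
definition CF where "CF = c0 + c0 * (CARD('n))\<^sup>2 * CP"
definition F where "F j x = (u x - mean j) *\<^sub>R gradient (\<eta> j) x"
text \<open>Terms outside \<open>J\<close> are set to zero, so that sums over the cover are ordinary
  series over the natural numbers. The formulas repeat \<open>bad\<close>, \<open>bad_a\<close> and
  \<open>bad_b\<close> of \<open>bv_cube\<close>, a locale that describes one cube at a
  time.\<close>

definition vB where
  "vB j = (if j \<in> J then (\<lambda>x. \<eta> j x * (u x - mean j) - conv (ker j) lborel (\<lambda>x. \<eta> j x * (u x - mean j)) x) else (\<lambda>x. 0))"
definition aB where "aB j = (if j \<in> J then (\<lambda>x. \<eta> j x *\<^sub>R \<sigma> x) else (\<lambda>x. 0))"
definition bB where
  "bB j = (if j \<in> J then (\<lambda>x. F j x - (conv (ker j) \<nu> (\<lambda>x. \<eta> j x *\<^sub>R \<sigma> x) x + conv (ker j) lborel (F j) x)) else (\<lambda>x. 0))"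

lemma kernel_ker: "j \<in> J \<Longrightarrow> kernel (ker j) (1/4 * hl * r j)"
  unfolding ker_def using hl r_pos[of j] by (intro kernel_mollifier_scaled[OF \<phi>]) simp

lemma borel_E: "E j \<in> sets borel" and E_subset: "E j \<subseteq> cube (z j) (r j)"
  using \<Omega> by (auto simp: E_def)

text \<open>If 3/4 Q lies in \<Omega>, then E = Q and the claim is the definition of the mean.
  Otherwise the constant is 0, and u vanishes a.e. on E, which lies outside \<Omega>.\<close>

lemma mean_E: "j \<in> J \<Longrightarrow> (LINT x|lborel. indicator (E j) x * u x) = mean j * measure lborel (E j)"
  and mean_le: "j \<in> J \<Longrightarrow> \<bar>mean j\<bar> * measure lborel (cube (z j) (r j)) \<le>
    (LINT x|lborel. indicator (cube (z j) (r j)) x * \<bar>u x\<bar>)"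
proof -
  assume j: "j \<in> J"
  let ?Q = "cube (z j) (r j)"
  have pos: "measure lborel ?Q > 0" using r_pos[OF j] by (simp add: measure_cube)
  have "(LINT x|lborel. indicator (E j) x * u x) = mean j * measure lborel (E j) \<and>
    \<bar>mean j\<bar> * measure lborel ?Q \<le> (LINT x|lborel. indicator ?Q x * \<bar>u x\<bar>)"
  proof (cases "cube (z j) (3/4 * r j) \<subseteq> \<Omega>")
    case True
    have "(LINT x:?Q|lebesgue. u0 x) = (LINT x|lborel. indicator ?Q x * u x)"
      unfolding set_lebesgue_integral_def
      by (rule integral_lebesgue_cong_AE) (use u0 in auto)
    then have "mean j = (LINT x|lborel. indicator ?Q x * u x) / measure lborel ?Q"
      using True by (simp add: mean_def local_mean_def)
    then have eq: "(LINT x|lborel. indicator ?Q x * u x) = mean j * measure lborel ?Q" using pos by simp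
    have "\<bar>mean j\<bar> * measure lborel ?Q = \<bar>LINT x|lborel. indicator ?Q x * u x\<bar>" unfolding eq by (simp add: abs_mult)
    also have "\<dots> \<le> (LINT x|lborel. \<bar>indicator ?Q x * u x\<bar>)" by (rule integral_abs_bound)
    finally show ?thesis using True eq by (simp add: E_def abs_mult)
  next
    case False
    have m: "mean j = 0" using False by (simp add: mean_def local_mean_def)
    have "AE x in lborel. indicator (E j) x * u x = 0"
      using u0 zero unfolding AE_completion_iff
      by eventually_elim (use False in \<open>auto simp: E_def indicator_def\<close>)
    then have "(LINT x|lborel. indicator (E j) x * u x) = 0" by (rule integral_eq_zero_AE)
    then show ?thesis using m by simp
  qed
  then show "(LINT x|lborel. indicator (E j) x * u x) = mean j * measure lborel (E j)"
    "\<bar>mean j\<bar> * measure lborel ?Q \<le> (LINT x|lborel. indicator ?Q x * \<bar>u x\<bar>)" by auto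
qed

lemma bv_cube: 
  assumes j: "j \<in> J" shows "bv_cube u \<nu> \<sigma> \<phi> (z j) (r j) (\<eta> j) (E j) (mean j) c0 k"
proof unfold_locales
  \<comment> \<open>When E is the whole cube the bound holds because k is at most 1; otherwise it is
    the exterior density.\<close>
  show "k * r j ^ CARD('n) \<le> measure lborel (E j)"
  proof (cases "cube (z j) (3/4 * r j) \<subseteq> \<Omega>")
    case True
    then show ?thesis using k r_pos[OF j] by (simp add: E_def measure_cube mult_left_le_one_le)
  next
    case False
    then show ?thesis using density[OF r_pos[OF j] False] by (simp add: E_def)
  qed
qed (use \<phi> r_pos[OF j] \<eta>_smooth[OF j] \<eta>_bounds[OF j] \<eta>_derivatives[OF j] borel_E E_subset mean_E[OF j] k c0 in auto)

text \<open>The results on one cube in terms of the indexed families. The factor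
  \<open>hl / 4\<close> is the ratio of the mollification radius to the side length, so the side
  length has dropped out.\<close>

lemma cube_facts:
  assumes j: "j \<in> J"
  shows weak_deriv_B: "weak_deriv \<nu> (vB j) (aB j) (bB j)"
    and weak_norm_B: "weak_norm \<nu> (vB j) (aB j) (bB j) \<le>
      4 * (LINT x|lborel. indicator (cube (z j) (r j)) x * \<bar>u x\<bar>) + (2 + 2 * c0 * CP) * measure \<nu> (cube (z j) (2 * r j))"
    and pairing_B: "\<rho> \<in> borel_measurable borel \<Longrightarrow> (\<And>x. norm (\<rho> x) \<le> B) \<Longrightarrow>
      (LINT x|\<nu>. \<rho> x \<bullet> aB j x) + (LINT x|lborel. \<rho> x \<bullet> bB j x) =
      (LINT x|\<nu>. (\<rho> x - conv (ker j) lborel \<rho> x) \<bullet> aB j x) +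
      ((LINT x|lborel. \<rho> x \<bullet> F j x) - (LINT x|lborel. conv (ker j) lborel \<rho> x \<bullet> F j x))"
    and commutator_B: "\<rho> \<in> borel_measurable borel \<Longrightarrow> (\<And>x. norm (\<rho> x) \<le> B) \<Longrightarrow>
      \<bar>(LINT x|lborel. \<rho> x \<bullet> F j x) - (LINT x|lborel. conv (ker j) lborel \<rho> x \<bullet> F j x)\<bar> \<le>
      B * (CF * hl / 4) * measure \<nu> (cube (z j) (2 * r j))"
proof -
  interpret Q: bv_cube u \<nu> \<sigma> \<phi> "z j" "r j" "\<eta> j" "E j" "mean j" c0 k by (rule bv_cube[OF j])
  note ker = kernel_ker[OF j]
  have F: "F j = Q.F" by (simp add: F_def[abs_def] Q.F_def[abs_def])
  have a: "aB j = Q.bad_a" using j by (simp add: aB_def Q.bad_a_def[abs_def])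
  have v: "vB j = Q.bad (ker j)" using j by (simp add: vB_def Q.bad_def[abs_def] Q.w_def[abs_def])
  have b: "bB j = Q.bad_b (ker j)"
    using j by (simp add: bB_def Q.bad_b_def[abs_def] F Q.bad_a_def[abs_def])
  have CP: "CP = Q.CP" by (simp add: CP_def Q.CP_def)
  have CF: "CF = Q.CF" by (simp add: CF_def Q.CF_def CP)
  show "weak_deriv \<nu> (vB j) (aB j) (bB j)" unfolding v a b by (rule Q.weak_deriv_bad[OF ker])
  show "weak_norm \<nu> (vB j) (aB j) (bB j) \<le>
      4 * (LINT x|lborel. indicator (cube (z j) (r j)) x * \<bar>u x\<bar>) + (2 + 2 * c0 * CP) * measure \<nu> (cube (z j) (2 * r j))"
    unfolding weak_norm_def v a b CP
    using Q.integral_norm_bad[OF ker mean_le[OF j]] Q.integral_norm_bad_a Q.integral_norm_bad_b[OF ker]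
    by (simp add: Q.V_def algebra_simps)
  show "(LINT x|\<nu>. \<rho> x \<bullet> aB j x) + (LINT x|lborel. \<rho> x \<bullet> bB j x) =
      (LINT x|\<nu>. (\<rho> x - conv (ker j) lborel \<rho> x) \<bullet> aB j x) +
      ((LINT x|lborel. \<rho> x \<bullet> F j x) - (LINT x|lborel. conv (ker j) lborel \<rho> x \<bullet> F j x))"
    if "\<rho> \<in> borel_measurable borel" "\<And>x. norm (\<rho> x) \<le> B"
    unfolding a b F by (rule Q.pairing_bad[OF ker that])
  show "\<bar>(LINT x|lborel. \<rho> x \<bullet> F j x) - (LINT x|lborel. conv (ker j) lborel \<rho> x \<bullet> F j x)\<bar> \<le>
      B * (CF * hl / 4) * measure \<nu> (cube (z j) (2 * r j))"
    if \<rho>: "\<rho> \<in> borel_measurable borel" "\<And>x. norm (\<rho> x) \<le> B"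
  proof -
    have "1/4 * hl * r j \<le> r j / 4" using hl r_pos[OF j] by simp
    then show ?thesis
      using Q.commutator_estimate[OF ker _ _ \<rho>] hl r_pos[OF j] by (simp add: F CF Q.V_def mult.assoc)
  qed
qed

lemma CP_nonneg: "CP \<ge> 0" and CF_nonneg: "CF \<ge> 0"
  using k c0 by (auto simp: CP_def CF_def)

lemma zero_B: "n \<notin> J \<Longrightarrow> vB n = (\<lambda>x. 0) \<and> aB n = (\<lambda>x. 0) \<and> bB n = (\<lambda>x. 0)"
  by (simp add: vB_def aB_def bB_def)

lemma weak_deriv_B': "weak_deriv \<nu> (vB n) (aB n) (bB n)"
  using weak_deriv_B[of n] zero_B[of n] weak_deriv_zero[of \<nu>] by (cases "n \<in> J") auto

lemma summable_\<nu>: "summable (\<lambda>n. if n \<in> J then measure \<nu> (cube (z n) (2 * r n)) else 0)"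
  and suminf_\<nu>: "(\<Sum>n. if n \<in> J then measure \<nu> (cube (z n) (2 * r n)) else 0) \<le> 120 ^ CARD('n) * measure \<nu> U"
proof -
  have sub: "cube (z j) (2 * r j) \<subseteq> U" if "j \<in> J" for j using sub_cube_subset[OF that, of 2] by simp
  have ov: "finite {j \<in> J. x \<in> cube (z j) (2 * r j)} \<and> card {j \<in> J. x \<in> cube (z j) (2 * r j)} \<le> 120 ^ CARD('n)" for x
    using overlap[of 2 x] by simp
  note o = sum_measure_overlap[where C="\<lambda>n. cube (z n) (2 * r n)" and J=J, OF finite_\<nu> sets_\<nu> borel_cube sub borel_U ov]
  show "summable (\<lambda>n. if n \<in> J then measure \<nu> (cube (z n) (2 * r n)) else 0)"
    "(\<Sum>n. if n \<in> J then measure \<nu> (cube (z n) (2 * r n)) else 0) \<le> 120 ^ CARD('n) * measure \<nu> U"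
    using o by simp_all
qed

text \<open>Bounded overlap again, now for the finite measure |u| dx in place of \<nu>.\<close>

lemma summable_u: "summable (\<lambda>n. if n \<in> J then (LINT x|lborel. indicator (cube (z n) (r n)) x * \<bar>u x\<bar>) else 0)"
proof -
  define N where "N = density lborel (\<lambda>x. ennreal \<bar>u x\<bar>)"
  have sN: "sets N = sets borel" by (simp add: N_def)
  have eN: "emeasure N A = ennreal (LINT x|lborel. indicator A x * \<bar>u x\<bar>)" if A: "A \<in> sets borel" for A
  proof -
    have "integrable lborel (\<lambda>x. indicator A x * \<bar>u x\<bar>)"
      using integrable_indicator_scaleR[OF sets_lborel integrable_abs[OF integrable_u] A] by simp
    then have "ennreal (LINT x|lborel. indicator A x * \<bar>u x\<bar>) = (\<integral>\<^sup>+x. ennreal (indicator A x * \<bar>u x\<bar>) \<partial>lborel)"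
      by (intro nn_integral_eq_integral[symmetric]) auto
    also have "\<dots> = (\<integral>\<^sup>+x. ennreal \<bar>u x\<bar> * indicator A x \<partial>lborel)"
      by (intro nn_integral_cong) (auto simp: indicator_def)
    also have "\<dots> = emeasure N A" unfolding N_def using A by (subst emeasure_density) auto
    finally show ?thesis by simp
  qed
  have mN: "measure N A = (LINT x|lborel. indicator A x * \<bar>u x\<bar>)" if "A \<in> sets borel" for A
    using eN[OF that] by (simp add: measure_def)
  have fin: "finite_measure N" using eN[of UNIV] by (intro finite_measureI) (simp add: N_def)
  have sub: "cube (z j) (r j) \<subseteq> U" if "j \<in> J" for j using sub_cube_subset[OF that, of 1] by simp
  have ov: "finite {j \<in> J. x \<in> cube (z j) (r j)} \<and> card {j \<in> J. x \<in> cube (z j) (r j)} \<le> 120 ^ CARD('n)" for x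
    using overlap[of 1 x] by simp
  have "summable (\<lambda>n. if n \<in> J then measure N (cube (z n) (r n)) else 0)"
    by (rule sum_measure_overlap(1)[where C="\<lambda>n. cube (z n) (r n)" and J=J, OF fin sN borel_cube sub borel_U ov])
  moreover have "(\<lambda>n. if n \<in> J then measure N (cube (z n) (r n)) else 0) =
      (\<lambda>n. if n \<in> J then (LINT x|lborel. indicator (cube (z n) (r n)) x * \<bar>u x\<bar>) else 0)"
    by (intro ext if_cong refl mN borel_cube)
  ultimately show ?thesis by (simp only:)
qed

lemma summable_B: "summable (\<lambda>n. weak_norm \<nu> (vB n) (aB n) (bB n))"
proof (rule summable_comparison_test'[where N=0])
  show "summable (\<lambda>n. 4 * (if n \<in> J then (LINT x|lborel. indicator (cube (z n) (r n)) x * \<bar>u x\<bar>) else 0) +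
      (2 + 2 * c0 * CP) * (if n \<in> J then measure \<nu> (cube (z n) (2 * r n)) else 0))"
    by (intro summable_add summable_mult summable_u summable_\<nu>)
  show "norm (weak_norm \<nu> (vB n) (aB n) (bB n)) \<le> 4 * (if n \<in> J then (LINT x|lborel. indicator (cube (z n) (r n)) x * \<bar>u x\<bar>) else 0) +
      (2 + 2 * c0 * CP) * (if n \<in> J then measure \<nu> (cube (z n) (2 * r n)) else 0)" for n
  proof -
    have "weak_norm \<nu> (vB n) (aB n) (bB n) \<ge> 0" by (simp add: weak_norm_def)
    then show ?thesis using weak_norm_B[of n] zero_B[of n] by (cases "n \<in> J") (auto simp: weak_norm_def)
  qed
qed

section \<open>The operators T and S as series over the cover\<close>

lemma mollify_eq:
  fixes f g :: "real^'n \<Rightarrow> 'b::euclidean_space"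
  assumes [measurable]: "g \<in> borel_measurable borel" and "j \<in> J" and "AE x in lebesgue. f x = g x"
  shows "mollify \<phi> hl (r j) f x = conv (ker j) lborel g x"
proof -
  note [measurable] = kernel.meas[OF kernel_ker[OF assms(2)]]
  have "(LINT y|lebesgue. ker j (x - y) *\<^sub>R f y) = (LINT y|lborel. ker j (x - y) *\<^sub>R g y)"
    by (rule integral_lebesgue_cong_AE) (use assms(3) in auto)
  then show ?thesis by (simp add: mollify_def convolve_def conv_def ker_def)
qed

lemma bad_part_AE:
  assumes j: "j \<in> J" shows "AE x in lebesgue. bad_part \<Omega> \<phi> hl z r \<eta> u0 j x = vB j x"
proof -
  have [measurable]: "\<eta> j \<in> borel_measurable borel"
    using test_field_bounded[OF \<eta>_smooth[OF j]] by blast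
  have ae: "AE x in lebesgue. \<eta> j x * (u0 x - mean j) = \<eta> j x * (u x - mean j)"
    using u0 by eventually_elim simp
  have m: "(\<lambda>x. \<eta> j x * (u x - mean j)) \<in> borel_measurable borel" by measurable
  show ?thesis
    using ae
  proof eventually_elim
    fix x assume "\<eta> j x * (u0 x - mean j) = \<eta> j x * (u x - mean j)"
    then show "bad_part \<Omega> \<phi> hl z r \<eta> u0 j x = vB j x"
      using j mollify_eq[OF m j ae, of x] by (simp add: bad_part_def vB_def Let_def mean_def[symmetric])
  qed
qed

text \<open>\<open>BV_sum\<close> is a choice, but the pointwise series is one admissible value, so
  the two agree a.e.; from here on T is explicit.\<close>

lemma T_op_AE: "AE x in lebesgue. T_op \<Omega> \<phi> hl J z r \<eta> u0 x = u x - (\<Sum>n. vB n x)"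
proof -
  let ?f = "bad_part \<Omega> \<phi> hl z r \<eta> u0"
  have s: "BV_has_sum ?f J (\<lambda>x. \<Sum>n. vB n x)"
    by (rule BV_has_sum_series[OF \<phi> sets_\<nu> weak_deriv_B' summable_B]) (use bad_part_AE zero_B in auto)
  then have "BV_has_sum ?f J (BV_sum ?f J)" unfolding BV_sum_def by (rule someI[of "BV_has_sum ?f J"])
  from BV_has_sum_unique_AE[OF this s] u0 show ?thesis
    by eventually_elim (simp add: T_op_def)
qed

text \<open>The derivative of u minus the series has densities \<sigma> minus the sum of the
  \<open>aB n\<close> and minus the sum of the \<open>bB n\<close>; the pairing with \<rho> passes
  through the sums by absolute convergence.\<close>

lemma pairing_T_op:
  assumes \<rho>: "\<rho> \<in> borel_measurable borel" "\<And>x. norm (\<rho> x) \<le> B"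
  shows "(\<lambda>n. (LINT x|\<nu>. \<rho> x \<bullet> aB n x) + (LINT x|lborel. \<rho> x \<bullet> bB n x)) sums
    ((LINT x|\<nu>. \<rho> x \<bullet> \<sigma> x) - pairing (deriv_measure (T_op \<Omega> \<phi> hl J z r \<eta> u0)) \<rho>)"
proof -
  have wu: "weak_deriv \<nu> u \<sigma> (\<lambda>x. 0)"
    using integrable_u integrable_\<sigma> weak by (simp add: weak_deriv_def)
  note S = weak_deriv_suminf[OF sets_\<nu> weak_deriv_B' summable_B]
  note W = weak_deriv_diff[OF sets_\<nu> wu S(1)]
  have iS: "integrable \<nu> (\<lambda>x. \<Sum>n. aB n x)" "integrable lborel (\<lambda>x. \<Sum>n. bB n x)"
    using S(1) by (auto simp: weak_deriv_def)
  have i: "integrable \<nu> (aB n)" "integrable lborel (bB n)" for n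
    using weak_deriv_B'[of n] by (auto simp: weak_deriv_def)
  have "pairing (deriv_measure (T_op \<Omega> \<phi> hl J z r \<eta> u0)) \<rho> =
      (LINT x|\<nu>. \<rho> x \<bullet> (\<sigma> x - (\<Sum>n. aB n x))) + (LINT x|lborel. \<rho> x \<bullet> (0 - (\<Sum>n. bB n x)))"
    unfolding pairing_deriv_measure[OF \<phi> has_deriv_measure_two_measure(1)[OF sets_\<nu> W T_op_AE]]
    by (rule pairing_two_measure[OF sets_\<nu> _ _ \<rho>]) (use integrable_\<sigma> iS in auto)
  also have "\<dots> = (LINT x|\<nu>. \<rho> x \<bullet> \<sigma> x) - ((LINT x|\<nu>. \<rho> x \<bullet> (\<Sum>n. aB n x)) + (LINT x|lborel. \<rho> x \<bullet> (\<Sum>n. bB n x)))"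
    using integrable_inner_bounded[OF sets_\<nu> integrable_\<sigma> \<rho>] integrable_inner_bounded[OF sets_\<nu> iS(1) \<rho>]
    by (simp add: inner_diff_right)
  finally have "(LINT x|\<nu>. \<rho> x \<bullet> \<sigma> x) - pairing (deriv_measure (T_op \<Omega> \<phi> hl J z r \<eta> u0)) \<rho> =
      (LINT x|\<nu>. \<rho> x \<bullet> (\<Sum>n. aB n x)) + (LINT x|lborel. \<rho> x \<bullet> (\<Sum>n. bB n x))" by simp
  then show ?thesis
    using sums_add[OF integral_inner_sums[OF sets_\<nu> i(1) S(3) \<rho>] integral_inner_sums[OF sets_lborel i(2) S(4) \<rho>]] by simp
qed

lemma finite_active: "finite {n \<in> J. \<eta> n x \<noteq> 0}"
proof (rule finite_subset)
  show "{n \<in> J. \<eta> n x \<noteq> 0} \<subseteq> {j \<in> J. x \<in> cube (z j) (3/4 * r j)}" using \<eta>_eq_0 by auto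
  show "finite {j \<in> J. x \<in> cube (z j) (3/4 * r j)}" using overlap[of "3/4" x] by simp
qed

definition sB where "sB \<rho> n x = (if n \<in> J then \<eta> n x *\<^sub>R (\<rho> x - conv (ker n) lborel \<rho> x) else 0)"

text \<open>\<open>A\<close> may be any finite set of indices containing those active at x. It is
  used with the active indices themselves, with the neighbours of a cube through x, and with the
  empty set.\<close>

lemma S_op_eq:
  assumes \<rho>: "\<rho> \<in> borel_measurable borel" and A: "finite A" "A \<subseteq> J" "\<And>n. n \<in> J \<Longrightarrow> \<eta> n x \<noteq> 0 \<Longrightarrow> n \<in> A"
  shows "S_op \<phi> hl J r \<eta> \<rho> x = \<rho> x - (\<Sum>n\<in>A. \<eta> n x *\<^sub>R (\<rho> x - conv (ker n) lborel \<rho> x))"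
proof -
  have "(\<Sum>\<^sub>\<infinity>j\<in>J. \<eta> j x *\<^sub>R (\<rho> x - mollify \<phi> hl (r j) \<rho> x)) = (\<Sum>\<^sub>\<infinity>n\<in>A. \<eta> n x *\<^sub>R (\<rho> x - conv (ker n) lborel \<rho> x))"
  proof (rule infsum_cong_neutral)
    fix n assume "n \<in> J \<inter> A"
    then show "\<eta> n x *\<^sub>R (\<rho> x - mollify \<phi> hl (r n) \<rho> x) = \<eta> n x *\<^sub>R (\<rho> x - conv (ker n) lborel \<rho> x)"
      using mollify_eq[OF \<rho>, of n \<rho> x] by simp
  qed (use A in auto)
  then show ?thesis using A by (simp add: S_op_def)
qed

lemma S_op_sums:
  assumes \<rho>: "\<rho> \<in> borel_measurable borel"
  shows "(\<lambda>n. sB \<rho> n x) sums (\<rho> x - S_op \<phi> hl J r \<eta> \<rho> x)"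
proof -
  let ?A = "{n \<in> J. \<eta> n x \<noteq> 0}"
  have "(\<lambda>n. sB \<rho> n x) sums (\<Sum>n\<in>?A. sB \<rho> n x)"
    by (rule sums_finite[OF finite_active]) (auto simp: sB_def)
  also have "(\<Sum>n\<in>?A. sB \<rho> n x) = \<rho> x - S_op \<phi> hl J r \<eta> \<rho> x"
    by (subst S_op_eq[OF \<rho> finite_active]) (auto simp: sB_def)
  finally show ?thesis .
qed

lemma borel_measurable_S_op:
  assumes \<rho>: "\<rho> \<in> borel_measurable borel" "\<And>x. norm (\<rho> x) \<le> B"
  shows "S_op \<phi> hl J r \<eta> \<rho> \<in> borel_measurable borel"
proof -
  have "sB \<rho> n \<in> borel_measurable borel" for n
  proof (cases "n \<in> J")
    case True
    have [measurable]: "\<eta> n \<in> borel_measurable borel"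
      using test_field_bounded[OF \<eta>_smooth[OF True]] by blast
    have [measurable]: "conv (ker n) lborel \<rho> \<in> borel_measurable borel"
      by (rule kernel.borel_measurable_conv[OF kernel_ker[OF True] lborel.sigma_finite_measure_axioms sets_lborel \<rho>(1)])
    note [measurable] = \<rho>(1)
    show ?thesis unfolding sB_def[abs_def] using True by simp
  qed (simp add: sB_def[abs_def])
  then have "(\<lambda>x. \<rho> x - (\<Sum>n. sB \<rho> n x)) \<in> borel_measurable borel"
    using \<rho>(1) by (intro borel_measurable_diff borel_measurable_suminf)
  moreover have "\<rho> x - (\<Sum>n. sB \<rho> n x) = S_op \<phi> hl J r \<eta> \<rho> x" for x
    by (simp add: sums_unique[OF S_op_sums[OF \<rho>(1), of x], symmetric])
  ultimately show ?thesis by (simp cong: measurable_cong)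
qed

text \<open>On U the point x lies in some 3/4 Q_j, and every index active at x is a neighbour of j.
  The weights \<eta> are non-negative and sum to 1 over these neighbours, so \<rho> cancels and a
  convex combination of averages of \<rho> remains. Off U nothing is subtracted.\<close>

lemma norm_S_op_le:
  assumes \<rho>: "\<rho> \<in> borel_measurable borel" "\<And>x. norm (\<rho> x) \<le> B"
  shows "norm (S_op \<phi> hl J r \<eta> \<rho> x) \<le> B"
proof (cases "x \<in> U")
  case True
  then obtain j where j: "j \<in> J" "x \<in> cube (z j) (1/2 * r j)" using U_eq by blast
  have x: "x \<in> cube (z j) (3/4 * r j)"
    using j cube_mono[of "1/2 * r j" "3/4 * r j" "z j"] r_pos[OF j(1)] by auto
  let ?A = "whitney_neighbours J z r j"
  have "n \<in> ?A" if "n \<in> J" "\<eta> n x \<noteq> 0" for n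
    using \<eta>_eq_0[OF that(1)] that x by (auto simp: whitney_neighbours_def)
  then have "S_op \<phi> hl J r \<eta> \<rho> x = \<rho> x - (\<Sum>n\<in>?A. \<eta> n x *\<^sub>R (\<rho> x - conv (ker n) lborel \<rho> x))"
    by (intro S_op_eq[OF \<rho>(1) finite_neighbours[OF j(1)]]) (auto simp: whitney_neighbours_def)
  also have "\<dots> = \<rho> x - (\<Sum>n\<in>?A. \<eta> n x) *\<^sub>R \<rho> x + (\<Sum>n\<in>?A. \<eta> n x *\<^sub>R conv (ker n) lborel \<rho> x)"
    by (simp add: scaleR_diff_right sum_subtractf scaleR_sum_left)
  also have "\<dots> = (\<Sum>n\<in>?A. \<eta> n x *\<^sub>R conv (ker n) lborel \<rho> x)" using \<eta>_sum[OF j(1) x] by simp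
  also have "norm \<dots> \<le> (\<Sum>n\<in>?A. \<eta> n x * B)"
  proof (rule order_trans[OF norm_sum sum_mono])
    fix n assume "n \<in> ?A"
    then have n: "n \<in> J" by (simp add: whitney_neighbours_def)
    show "norm (\<eta> n x *\<^sub>R conv (ker n) lborel \<rho> x) \<le> \<eta> n x * B"
      using \<eta>_bounds(1)[OF n, of x] kernel.norm_conv_bounded[OF kernel_ker[OF n] \<rho>, of x]
      by (simp add: mult_left_mono)
  qed
  also have "\<dots> = B" using \<eta>_sum[OF j(1) x] by (simp add: sum_distrib_right[symmetric])
  finally show ?thesis .
next
  case False
  have "\<eta> n x = 0" if "n \<in> J" for n
    using \<eta>_eq_0[OF that] sub_cube_subset[OF that, of "3/4"] False by auto
  then have "S_op \<phi> hl J r \<eta> \<rho> x = \<rho> x" using S_op_eq[OF \<rho>(1), of "{}" x] by auto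
  then show ?thesis using \<rho>(2) by simp
qed

text \<open>The series for \<rho> - S \<rho> may be integrated against \<sigma> d\<nu> term by term,
  since its terms are dominated in L^1 by 2 B times those of the summable family
  \<open>aB\<close>.\<close>

lemma integral_S_op:
  assumes \<rho>: "\<rho> \<in> borel_measurable borel" "\<And>x. norm (\<rho> x) \<le> B"
  shows "(\<lambda>n. LINT x|\<nu>. (\<rho> x - conv (ker n) lborel \<rho> x) \<bullet> aB n x) sums
    ((LINT x|\<nu>. \<rho> x \<bullet> \<sigma> x) - (LINT x|\<nu>. S_op \<phi> hl J r \<eta> \<rho> x \<bullet> \<sigma> x))"
proof -
  note S = weak_deriv_suminf[OF sets_\<nu> weak_deriv_B' summable_B]
  let ?h = "\<lambda>n x. (\<rho> x - conv (ker n) lborel \<rho> x) \<bullet> aB n x"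
  have ia: "integrable \<nu> (aB n)" for n using weak_deriv_B'[of n] by (auto simp: weak_deriv_def)
  have h_eq: "?h n x = sB \<rho> n x \<bullet> \<sigma> x" for n x by (simp add: aB_def sB_def)
  have h: "integrable \<nu> (?h n) \<and> (LINT x|\<nu>. norm (?h n x)) \<le> 2 * B * (LINT x|\<nu>. norm (aB n x))" for n
  proof (cases "n \<in> J")
    case True
    note kn = kernel_ker[OF True]
    have m: "(\<lambda>x. \<rho> x - conv (ker n) lborel \<rho> x) \<in> borel_measurable borel"
      using \<rho>(1) kernel.borel_measurable_conv[OF kn lborel.sigma_finite_measure_axioms sets_lborel \<rho>(1)] by simp
    have b: "norm (\<rho> x - conv (ker n) lborel \<rho> x) \<le> 2 * B" for x
      using norm_triangle_ineq4[of "\<rho> x" "conv (ker n) lborel \<rho> x"] \<rho>(2)[of x] kernel.norm_conv_bounded[OF kn \<rho>, of x] by simp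
    have i: "integrable \<nu> (?h n)" by (rule integrable_inner_bounded[OF sets_\<nu> ia m b])
    have "(LINT x|\<nu>. norm (?h n x)) \<le> (LINT x|\<nu>. 2 * B * norm (aB n x))"
      using i ia order_trans[OF Cauchy_Schwarz_ineq2 mult_right_mono[OF b norm_ge_zero]]
      by (intro integral_mono) auto
    then show ?thesis using i by simp
  next
    case False
    then show ?thesis by (simp add: aB_def)
  qed
  have s: "summable (\<lambda>n. LINT x|\<nu>. norm (?h n x))"
    by (rule summable_comparison_test'[OF summable_mult[OF S(3), of "2 * B"], of 0]) (use h in auto)
  have i: "integrable \<nu> (?h n)" for n using h by blast
  have hs: "(\<Sum>n. ?h n x) = (\<rho> x - S_op \<phi> hl J r \<eta> \<rho> x) \<bullet> \<sigma> x" for x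
    unfolding h_eq using bounded_linear.sums[OF bounded_linear_inner_left S_op_sums[OF \<rho>(1), of x], of "\<sigma> x"]
    by (simp add: sums_iff)
  have "(\<lambda>n. LINT x|\<nu>. ?h n x) sums (LINT x|\<nu>. (\<Sum>n. ?h n x))"
    by (rule sums_integral[OF i AE_summable_norm[OF i s] s])
  also have "(LINT x|\<nu>. (\<Sum>n. ?h n x)) = (LINT x|\<nu>. \<rho> x \<bullet> \<sigma> x) - (LINT x|\<nu>. S_op \<phi> hl J r \<eta> \<rho> x \<bullet> \<sigma> x)"
    unfolding hs unfolding inner_diff_left
    using integrable_inner_bounded[OF sets_\<nu> integrable_\<sigma> \<rho>]
      integrable_inner_bounded[OF sets_\<nu> integrable_\<sigma> borel_measurable_S_op[OF \<rho>] norm_S_op_le[OF \<rho>]]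
    by (rule Bochner_Integration.integral_diff)
  finally show ?thesis .
qed

text \<open>The series for T and for S have the same leading term, the pairing of Du with \<rho>,
  which cancels in their difference. By \<open>pairing_B\<close> the difference of the n-th terms is
  the commutator of F_n, and the bounded overlap of the cubes 2Q_n sums the estimates.\<close>

lemma commutator:
  assumes \<rho>: "\<rho> \<in> borel_measurable borel" "\<And>x. norm (\<rho> x) \<le> B"
  shows "\<bar>pairing (deriv_measure (T_op \<Omega> \<phi> hl J z r \<eta> u0)) \<rho> - (LINT x|\<nu>. S_op \<phi> hl J r \<eta> \<rho> x \<bullet> \<sigma> x)\<bar> \<le>
    B * (CF * hl / 4) * (120 ^ CARD('n) * measure \<nu> U)"
proof -
  define d where "d n = ((LINT x|\<nu>. \<rho> x \<bullet> aB n x) + (LINT x|lborel. \<rho> x \<bullet> bB n x)) -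
    (LINT x|\<nu>. (\<rho> x - conv (ker n) lborel \<rho> x) \<bullet> aB n x)" for n
  have B0: "0 \<le> B" using order_trans[OF norm_ge_zero \<rho>(2)] .
  have sums: "d sums ((LINT x|\<nu>. S_op \<phi> hl J r \<eta> \<rho> x \<bullet> \<sigma> x) - pairing (deriv_measure (T_op \<Omega> \<phi> hl J z r \<eta> u0)) \<rho>)"
    using sums_diff[OF pairing_T_op[OF \<rho>] integral_S_op[OF \<rho>]] by (simp add: d_def[abs_def])
  let ?m = "\<lambda>n. if n \<in> J then measure \<nu> (cube (z n) (2 * r n)) else 0"
  have le: "norm (d n) \<le> B * (CF * hl / 4) * ?m n" for n
  proof (cases "n \<in> J")
    case True
    then show ?thesis using pairing_B[OF True \<rho>] commutator_B[OF True \<rho>] by (simp add: d_def)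
  next
    case False
    then show ?thesis by (simp add: d_def zero_B)
  qed
  have sm: "summable (\<lambda>n. B * (CF * hl / 4) * ?m n)" by (rule summable_mult[OF summable_\<nu>])
  have sd: "summable (\<lambda>n. norm (d n))" by (rule summable_comparison_test'[OF sm, of 0]) (use le in simp)
  have "\<bar>pairing (deriv_measure (T_op \<Omega> \<phi> hl J z r \<eta> u0)) \<rho> - (LINT x|\<nu>. S_op \<phi> hl J r \<eta> \<rho> x \<bullet> \<sigma> x)\<bar> = norm (\<Sum>n. d n)"
    using sums_unique[OF sums] by (simp add: abs_minus_commute)
  also have "\<dots> \<le> (\<Sum>n. norm (d n))" by (rule summable_norm[OF sd])
  also have "\<dots> \<le> (\<Sum>n. B * (CF * hl / 4) * ?m n)" by (rule suminf_le[OF le sd sm])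
  also have "\<dots> = B * (CF * hl / 4) * (\<Sum>n. ?m n)" by (rule suminf_mult[OF summable_\<nu>])
  also have "\<dots> \<le> B * (CF * hl / 4) * (120 ^ CARD('n) * measure \<nu> U)"
    using B0 CF_nonneg hl by (intro mult_left_mono suminf_\<nu>) auto
  finally show ?thesis .
qed

end

theorem lemma3p7:
  fixes \<Omega> :: "(real^'n) set" and \<phi> :: "real^'n \<Rightarrow> real" and c0 :: real
  assumes "CARD('n) \<ge> 2"
    and "\<Omega> = UNIV \<or> (open \<Omega> \<and> bounded \<Omega> \<and> lipschitz_boundary \<Omega>)"
    and "mollifier \<phi>" and "c0 \<ge> 1"
  shows "\<exists>c::real. c > 0 \<and>
    (\<forall>(h :: real \<Rightarrow> real) (u :: real^'n \<Rightarrow> real) (l :: real)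
       (J :: nat set) (z :: nat \<Rightarrow> real^'n) (r :: nat \<Rightarrow> real) (\<eta> :: nat \<Rightarrow> real^'n \<Rightarrow> real).
      scale_fun h \<longrightarrow> BV u \<longrightarrow> (AE x in lebesgue. x \<notin> \<Omega> \<longrightarrow> u x = 0) \<longrightarrow> l > 0 \<longrightarrow>
      whitney_cover (bad_set u l) J z r \<longrightarrow> whitney_partition c0 J z r \<eta> \<longrightarrow>
      (\<forall>\<rho>. Cc_field \<Omega> \<rho> \<longrightarrow> Linf_norm (S_op \<phi> (h l) J r \<eta> \<rho>) \<le> Linf_norm \<rho>) \<and>
      (\<forall>\<rho>. Cc_field \<Omega> \<rho> \<longrightarrow>
        ennreal \<bar>pairing (deriv_measure (T_op \<Omega> \<phi> (h l) J z r \<eta> u)) \<rho>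
                 - pairing (deriv_measure u) (S_op \<phi> (h l) J r \<eta> \<rho>)\<bar>
          \<le> ennreal (c * h l) * variation (deriv_measure u) (bad_set u l) * Linf_norm \<rho>))"
proof -
  note \<phi> = assms(3)
  obtain k0 where k0: "k0 > 0" "\<And>z r. r > 0 \<Longrightarrow> \<not> cube z (3/4 * r) \<subseteq> \<Omega> \<Longrightarrow> k0 * r ^ CARD('n) \<le> measure lborel (cube z r - \<Omega>)"
    using exterior_density[OF assms(2)] by metis
  \<comment> \<open>The minimum with 1 makes the same constant valid when E is the whole cube, whose
    measure is exactly the n-th power of the side length.\<close>
  define k where "k = min 1 k0"
  have k: "0 < k" "k \<le> 1" using k0 by (auto simp: k_def)
  have density: "k * r ^ CARD('n) \<le> measure lborel (cube z r - \<Omega>)" if "r > 0" "\<not> cube z (3/4 * r) \<subseteq> \<Omega>" for z r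
    by (rule order_trans[OF mult_right_mono k0(2)[OF that]]) (use that(1) in \<open>auto simp: k_def\<close>)
  have \<Omega>: "\<Omega> \<in> sets borel" using assms(2) by auto
  define CF where "CF = c0 + c0 * (CARD('n))\<^sup>2 * (CARD('n) * (3/2) * 3 ^ CARD('n) / k)"
  have CF: "CF > 0" using assms(4) k by (auto simp: CF_def intro!: add_pos_nonneg)
  \<comment> \<open>1/4 stems from the mollification radius h r_j / 4, the power of 120 from the
    overlap of the cubes, and 2n from comparing \<nu> with |Du|.\<close>
  define c where "c = CF / 4 * 120 ^ CARD('n) * (2 * CARD('n))"
  show ?thesis
  proof (rule exI[of _ c], intro conjI allI impI)
    show "c > 0" using CF by (simp add: c_def)
    fix h :: "real \<Rightarrow> real" and u :: "real^'n \<Rightarrow> real" and l :: real and J :: "nat set"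
      and z :: "nat \<Rightarrow> real^'n" and r :: "nat \<Rightarrow> real" and \<eta> :: "nat \<Rightarrow> real^'n \<Rightarrow> real"
    assume h: "scale_fun h" and u: "BV u" and u0: "AE x in lebesgue. x \<notin> \<Omega> \<longrightarrow> u x = 0" and l: "l > 0"
      and cover: "whitney_cover (bad_set u l) J z r" and part: "whitney_partition c0 J z r \<eta>"
    let ?U = "bad_set u l" and ?\<mu> = "deriv_measure u"
    have hl: "0 < h l" "h l \<le> 1" using h l by (auto simp: scale_fun_def)
    obtain u' where u': "u' \<in> borel_measurable lborel" "AE x in lborel. u x = u' x"
      using completion_ex_borel_measurable_real[of u lborel] u by (auto simp: BV_def)
    have ae: "AE x in lebesgue. u x = u' x" by (rule AE_completion[OF u'(2)])
    have u'b: "u' \<in> borel_measurable borel" using u'(1) by simp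
    have iu': "integrable lborel u'"
    proof -
      have "integrable lebesgue u'"
        by (rule integrable_cong_AE_imp[of lebesgue u]) (use u ae u'(1) in \<open>auto simp: BV_def intro: measurable_completion\<close>)
      then show ?thesis using integrable_completion[OF u'(1)] by simp
    qed
    have D: "has_deriv_measure u ?\<mu>" using u has_deriv_measure_deriv_measure by (auto simp: BV_def)
    then have vm: "vector_measure ?\<mu>" by (simp add: has_deriv_measure_def)
    obtain \<nu> \<sigma> where p: "finite_measure \<nu>" "sets \<nu> = sets borel" "\<sigma> \<in> borel_measurable borel" "\<And>x. norm (\<sigma> x) \<le> 1"
      "\<And>A. A \<in> sets borel \<Longrightarrow> ?\<mu> A = (LINT x|\<nu>. indicator A x *\<^sub>R \<sigma> x)"
      "\<And>A. A \<in> sets borel \<Longrightarrow> emeasure \<nu> A \<le> ennreal (2 * CARD('n)) * variation ?\<mu> A"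
      by (rule vector_measure_polar[OF vm]) (rule that)
    interpret W: whitney_setup u' \<nu> \<sigma> \<Omega> ?U \<phi> "h l" c0 k J z r \<eta> u
    proof (intro whitney_setup.intro bv_pair.intro whitney_setup_axioms.intro)
      fix g :: "real^'n \<Rightarrow> real^'n" assume g: "Cc_infinity g"
      obtain B where B: "g \<in> borel_measurable borel" "\<And>x. norm (g x) \<le> B" using test_field_bounded[OF g] by blast
      have [measurable]: "divergence g \<in> borel_measurable borel"
        using divergence_continuous_bounded(1)[OF g] borel_measurable_continuous_onI by blast
      note [measurable] = u'b
      have "(LINT x|lebesgue. u x * divergence g x) = (LINT x|lborel. u' x * divergence g x)"
        by (rule integral_lebesgue_cong_AE) (use ae in auto)
      then show "(LINT x|lborel. u' x * divergence g x) = - (LINT x|\<nu>. g x \<bullet> \<sigma> x)"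
        using D g pairing_polar(2)[OF p(1-5) B] by (simp add: has_deriv_measure_def)
    qed (fact iu' p(1) p(2) p(3) p(4) \<phi> hl cover part assms(4) \<Omega> k density ae u0)+
    show "Linf_norm (S_op \<phi> (h l) J r \<eta> \<rho>) \<le> Linf_norm \<rho>" if \<rho>: "Cc_field \<Omega> \<rho>" for \<rho>
    proof -
      obtain B where B: "\<rho> \<in> borel_measurable borel" "\<And>x. norm (\<rho> x) \<le> B" "Linf_norm \<rho> = ennreal B"
        using Cc_field_Linf_norm[OF \<rho>] by metis
      show ?thesis unfolding B(3)
        by (rule Linf_norm_le[OF W.borel_measurable_S_op[OF B(1,2)] W.norm_S_op_le[OF B(1,2)]])
    qed
    show "ennreal \<bar>pairing (deriv_measure (T_op \<Omega> \<phi> (h l) J z r \<eta> u)) \<rho> - pairing ?\<mu> (S_op \<phi> (h l) J r \<eta> \<rho>)\<bar>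
        \<le> ennreal (c * h l) * variation ?\<mu> ?U * Linf_norm \<rho>" if \<rho>: "Cc_field \<Omega> \<rho>" for \<rho>
    proof -
      obtain B where B: "B \<ge> 0" "\<rho> \<in> borel_measurable borel" "\<And>x. norm (\<rho> x) \<le> B" "Linf_norm \<rho> = ennreal B"
        using Cc_field_Linf_norm[OF \<rho>] by metis
      have S: "pairing ?\<mu> (S_op \<phi> (h l) J r \<eta> \<rho>) = (LINT x|\<nu>. S_op \<phi> (h l) J r \<eta> \<rho> x \<bullet> \<sigma> x)"
        by (rule pairing_polar(2)[OF p(1-5) W.borel_measurable_S_op[OF B(2,3)] W.norm_S_op_le[OF B(2,3)]])
      have WCF: "W.CF = CF" by (simp add: W.CF_def W.CP_def CF_def)
      let ?K = "B * (CF * h l / 4) * 120 ^ CARD('n)"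
      have K: "?K \<ge> 0" using B CF hl by simp
      have "\<bar>pairing (deriv_measure (T_op \<Omega> \<phi> (h l) J z r \<eta> u)) \<rho> - pairing ?\<mu> (S_op \<phi> (h l) J r \<eta> \<rho>)\<bar> \<le> ?K * measure \<nu> ?U"
        using W.commutator[OF B(2,3)] by (simp add: S WCF mult.assoc)
      then have "ennreal \<bar>pairing (deriv_measure (T_op \<Omega> \<phi> (h l) J z r \<eta> u)) \<rho> - pairing ?\<mu> (S_op \<phi> (h l) J r \<eta> \<rho>)\<bar> \<le> ennreal (?K * measure \<nu> ?U)"
        by (rule ennreal_leI)
      also have "\<dots> = ennreal ?K * emeasure \<nu> ?U"
        unfolding finite_measure.emeasure_eq_measure[OF p(1)] by (rule ennreal_mult[OF K measure_nonneg])
      also have "\<dots> \<le> ennreal ?K * (ennreal (2 * CARD('n)) * variation ?\<mu> ?U)"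
        by (intro mult_left_mono p(6) W.borel_U) simp
      also have "\<dots> = ennreal (?K * (2 * CARD('n))) * variation ?\<mu> ?U"
        unfolding mult.assoc[symmetric] by (subst ennreal_mult[OF K]) auto
      also have "?K * (2 * CARD('n)) = c * h l * B" by (simp add: c_def)
      also have "ennreal (c * h l * B) * variation ?\<mu> ?U = ennreal (c * h l) * variation ?\<mu> ?U * Linf_norm \<rho>"
      proof -
        have "ennreal (c * h l * B) = ennreal (c * h l) * ennreal B"
          using B(1) CF hl by (intro ennreal_mult) (auto simp: c_def)
        then show ?thesis by (simp add: B(4) ac_simps)
      qed
      finally show ?thesis .
    qed
  qed
qed

end
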